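(* Assume that $\Lambda$ is bounded. For any starting point $(x^0,\lambda^0)\in\mathcal X\times\Lambda$, denote by $C^{\mathrm P}_{\mathsf{stoc}}$ and $C^{\mathrm D}_{\mathsf{stoc}}$ the primal and dual oracle complexities of the randomized IPDS algorithm (with the parameters and sub-problem solvers described in the context) to achieve an $\varepsilon$-expected duality gap, i.e. to produce $(x^{\rm out},\lambda^{\rm out})$ with $\mathbb E[\Delta(x^{\rm out},\lambda^{\rm out})]\le\varepsilon$. Then $$C^{\mathrm P}_{\mathsf{stoc}}=O\bigg((n+\sqrt{n\kappa_{\mathcal X}})\sqrt{\frac{L_{\mathrm D}}{\varepsilon}}\log\bigg(\frac{\kappa_{\mathcal X}L_{\mathrm D}(n+\sqrt{n\kappa_{\mathcal X}})}{\varepsilon}\bigg)\bigg),$$ $$C^{\mathrm D}_{\mathsf{stoc}}=O\bigg(\bigg(n\sqrt{\frac{L_{\mathrm D}}{\varepsilon}}+\frac{\sqrt{nL_{\lambda\lambda}L_{\mathrm D}}}{\varepsilon}\bigg)\log\bigg(\frac{L_{\lambda\lambda}(n+\sqrt{nL_{\lambda\lambda}/L_{\mathrm D}})}{\varepsilon}\bigg)\bigg).$$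
   Context: Setting. $\mathbb E_1,\mathbb E_2$ are finite-dimensional real normed spaces (norms $\|\cdot\|$, dual norms $\|\cdot\|_*$, pairing $\langle\cdot,\cdot\rangle$). $\mathcal X\subseteq\mathbb E_1$, $\Lambda\subseteq\mathbb E_2$ are nonempty, closed, convex, $\mathcal X$ bounded. $f,g:\mathbb E_1\to\mathbb R\cup\{+\infty\}$, $h:\mathbb E_2\to\mathbb R\cup\{+\infty\}$ are convex, closed, proper, $\mathcal X\subseteq\mathrm{dom}\,g$, $\Lambda\subseteq\mathrm{dom}\,h$. $f$ is differentiable on an open set containing $\mathcal X$, and $\frac\mu2\|x-x'\|^2\le f(x)-f(x')-\langle\nabla f(x'),x-x'\rangle\le\frac L2\|x-x'\|^2$ for $x,x'\in\mathcal X$, with $L\ge\mu>0$. $\Phi=\frac1n\sum_{i=1}^n\Phi_i$ is real-valued on $\mathbb E_1\times\mathbb E_2$, each $\Phi_i$ is convex-concave and differentiable in each argument with Lipschitz partial gradients on $\mathcal X\times\Lambda$, and for all $x,x'\in\mathcal X$, $\lambda,\lambda'\in\Lambda$: $\|\nabla_x\Phi(x,\lambda)-\nabla_x\Phi(x',\lambda)\|_*\le L_{xx}\|x-x'\|$, $\|\nabla_x\Phi(x,\lambda)-\nabla_x\Phi(x,\lambda')\|_*\le L_{\lambda x}\|\lambda-\lambda'\|$, $\|\nabla_\lambda\Phi(x,\lambda)-\nabla_\lambda\Phi(x',\lambda)\|_*\le L_{\lambda x}\|x-x'\|$, $\|\nabla_\lambda\Phi(x,\lambda)-\nabla_\lambda\Phi(x,\lambda')\|_*\le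 L_{\lambda\lambda}\|\lambda-\lambda'\|$. The problem is $\min_{x\in\mathcal X}\max_{\lambda\in\Lambda}S(x,\lambda)$, $S(x,\lambda):=f(x)+g(x)+\Phi(x,\lambda)-h(\lambda)$; a saddle point exists. $\omega$ is a distance generating function (DGF) w.r.t. $(h,\Lambda)$: convex, closed, proper, $1$-strongly convex and continuous on $\Lambda$, essentially smooth, and such that for all $\alpha>0$, $\upsilon\in\mathbb E_2^*$ the problem $\min_{\lambda\in\Lambda}h(\lambda)+\langle\upsilon,\lambda\rangle+\alpha^{-1}\omega(\lambda)$ has a unique easily computable solution in $\Lambda^o:=\Lambda\cap\mathrm{int}\,\mathrm{dom}\,\omega$. Likewise $\overline\omega$ is a DGF w.r.t. $(g,\mathcal X)$ and $\mathcal X^o:=\mathcal X\cap\mathrm{int}\,\mathrm{dom}\,\overline\omega$. $L_{\mathrm D}:=L_{\lambda\lambda}+L_{\lambda x}^2/\mu$, $\kappa_{\mathcal X}:=(L+L_{xx})/\mu$, $B_{\omega,\Lambda}:=\sup_{\lambda\in\Lambda}|\omega(\lambda)|$. Definitions. $\psi^{\mathrm P}(x):=\sup_{\lambda\in\Lambda}S(x,\lambda)$, $\psi^{\mathrm D}(\lambda):=\inf_{x\in\mathcal X}S(x,\lambda)$, $\Delta(x,\lambda):=\psi^{\mathrm P}(x)-\psi^{\mathrm D}(\lambda)$. For $\rho>0$: $S_\rho(x,\lambda):=S(x,\lambda)-\rho\,\omega(\lambda)$, $\psi^{\mathrm P}_\rho(x):=\sup_{\lambda\in\Lambda}S_\rho(x,\lambda)$.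 Oracles. On input $(x,\lambda,i)$, $i\in\{1,\dots,n\}$, the primal oracle returns $\nabla_x\Phi_i(x,\lambda)$ and the dual oracle returns $\nabla_\lambda\Phi_i(x,\lambda)$; on input $(x,0)$ the primal oracle returns $\nabla f(x)$. Primal (dual) oracle complexity is the number of calls to the primal (dual) oracle. Randomized IPDS algorithm. Parameters: $\rho_0=8L_{\mathrm D}>0$, $\tau_k=\frac{k+1}{k+3}$, $\gamma_k=\eta_k=\frac{\varepsilon}{4(k+3)}$. For $k=0,1,\dots$: (1) produce $\widetilde\lambda_{\rho_k,\eta_k}(x^k)\in\Lambda$ with $\mathbb E[\psi^{\mathrm P}_{\rho_k}(x^k)-S_{\rho_k}(x^k,\widetilde\lambda_{\rho_k,\eta_k}(x^k))\mid\mathcal F_{k,0}]\le\eta_k$ a.s.; (2) $\hat\lambda^k=\tau_k\lambda^k+(1-\tau_k)\widetilde\lambda_{\rho_k,\eta_k}(x^k)$; (3) produce $\widetilde x_{\gamma_k}(\hat\lambda^k)\in\mathcal X$ with $\mathbb E[S(\widetilde x_{\gamma_k}(\hat\lambda^k),\hat\lambda^k)-\psi^{\mathrm D}(\hat\lambda^k)\mid\mathcal F_{k,1}]\le\gamma_k$ a.s.; (4) $x^{k+1}=\tau_kx^k+(1-\tau_k)\widetilde x_{\gamma_k}(\hat\lambda^k)$; (5) $\rho_{k+1}=\tau_k\rho_k$; (6) produce $\widetilde\lambda_{\rho_{k+1},\eta_k}(x^{k+1})\in\Lambda$ with $\mathbb E[\psi^{\mathrm P}_{\rho_{k+1}}(x^{k+1})-S_{\rho_{k+1}}(x^{k+1},\widetilde\lambda_{\rho_{k+1},\eta_k}(x^{k+1}))\mid\mathcal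 F_{k,2}]\le\eta_k$ a.s.; (7) $\lambda^{k+1}=\tau_k\lambda^k+(1-\tau_k)\widetilde\lambda_{\rho_{k+1},\eta_k}(x^{k+1})$. Here $\mathcal F_{0,0}$ is trivial, and $\mathcal F_{k,1}$, $\mathcal F_{k,2}$, $\mathcal F_{k+1,0}$ are obtained by successively adjoining $\widetilde\lambda_{\rho_k,\eta_k}(x^k)$, $\widetilde x_{\gamma_k}(\hat\lambda^k)$, $\widetilde\lambda_{\rho_{k+1},\eta_k}(x^{k+1})$ to $\mathcal F_{k,0}$. The output is the last iterate. Sub-problem solver. Steps (1), (3), (6) use the randomized primal-dual gradient method (RPD). For $\min_{u\in\mathcal U}\Psi(u)=\phi_1(u)+\phi_2(u)$, $\mathcal U$ convex compact, $\phi_1=\frac1m\sum_{i=1}^m\varphi_i$ convex and $L'$-smooth with each $\varphi_i$ convex and smooth, $\Psi$ $\mu'$-strongly convex, $\phi_2$ convex with DGF $\pi$, $\kappa'=L'/\mu'$, minimizer $u^*$, its known guarantee is that, from $u^0\in\mathcal U\cap\mathrm{int}\,\mathrm{dom}\,\pi$, the expected error $\mathbb E[\Psi(\tilde u^N)-\Psi(u^* )]\le e$ holds after $N=2(m+\sqrt{8m\kappa'})\log\big(2(L'/\sqrt{\mu'}+\sqrt{\mu'})^2(m+\sqrt{8m\kappa'})D_{\mathcal U,\pi}(u^0)/e\big)$ (rounded up) iterations, with $O(N)$ component-gradient oracle calls, where $D_{\mathcal U,\pi}(u^0)=\max_{u\in\mathcal U}[\pi(u)-\pi(u^0)-\langle\nabla\pi(u^0),u-u^0\rangle]<\infty$.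 In steps (1), (6): $m=n$, $L'=L_{\lambda\lambda}$, $\mu'=\rho$ (dual oracle calls); in step (3): $m=n$, $L'=L+L_{xx}$, $\mu'=\mu$ (primal oracle calls). Each run uses a fixed starting point in $\Lambda^o$ (resp. $\mathcal X^o$) and this pre-determined number of iterations. $O(\cdot)$ convention: $\varepsilon\to0$, i.e. bounds hold for all sufficiently small $\varepsilon>0$ (threshold depending on the other data); implied constants may depend on $B_{\omega,\Lambda}$ and on $\Delta(x^0,\lambda^0)$ relative to $L_{\mathrm D}$, but not on $\varepsilon,n,\kappa_{\mathcal X}$. For the dual bound, $L_{\lambda\lambda}>0$ is understood. *)

theory Defs
  imports "HOL-Probability.Probability"
begin

class fin_dim_normed = real_normed_vector +
  assumes finite_dimensional: "\<exists>B. finite B \<and> (\<forall>x. \<exists>r. x = (\<Sum>b\<in>B. r b *\<^sub>R b))"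

text \<open>Functions with values in the reals extended by plus infinity.\<close>

definition edom :: "('u \<Rightarrow> ereal) \<Rightarrow> 'u set" where
  "edom F = {u. F u < \<infinity>}"

definition eepi :: "('u \<Rightarrow> ereal) \<Rightarrow> ('u \<times> real) set" where
  "eepi F = {(u, r). F u \<le> ereal r}"

definition closed_convex_proper :: "('u::real_normed_vector \<Rightarrow> ereal) \<Rightarrow> bool" where
  "closed_convex_proper F \<longleftrightarrow> convex (eepi F) \<and> closed (eepi F) \<and>
     (\<forall>u. F u \<noteq> -\<infinity>) \<and> edom F \<noteq> {}"

abbreviation rpart :: "('u \<Rightarrow> ereal) \<Rightarrow> 'u \<Rightarrow> real" where
  "rpart F \<equiv> \<lambda>u. real_of_ereal (F u)"

text \<open>The gradient is an element of the dual space \<open>'u \<Rightarrow>\<^sub>L real\<close>: application is the pairing, and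
  the operator norm is the dual norm. It is meaningful only where \<open>F\<close> is differentiable.\<close>

definition grad :: "('u::real_normed_vector \<Rightarrow> real) \<Rightarrow> 'u \<Rightarrow> 'u \<Rightarrow>\<^sub>L real" where
  "grad F u = Blinfun (frechet_derivative F (at u))"

definition bregman :: "('u::real_normed_vector \<Rightarrow> real) \<Rightarrow> 'u \<Rightarrow> 'u \<Rightarrow> real" where
  "bregman F u u' = F u - F u' - blinfun_apply (grad F u') (u - u')"

text \<open>Smoothness is the quadratic upper bound on \<open>U\<close>, which is the form in which it is assumed of
  the strongly convex part of the objective.\<close>

definition smooth_on :: "'u::real_normed_vector set \<Rightarrow> real \<Rightarrow> ('u \<Rightarrow> real) \<Rightarrow> bool" where
  "smooth_on U L F \<longleftrightarrow> (\<forall>u\<in>U. F differentiable (at u)) \<and>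
     (\<forall>u\<in>U. \<forall>u'\<in>U. bregman F u u' \<le> L / 2 * (norm (u - u'))\<^sup>2)"

definition strongly_convex_on :: "'u::real_normed_vector set \<Rightarrow> real \<Rightarrow> ('u \<Rightarrow> real) \<Rightarrow> bool" where
  "strongly_convex_on U m F \<longleftrightarrow> (\<forall>u\<in>U. \<forall>v\<in>U. \<forall>t\<in>{0..1}.
     F ((1 - t) *\<^sub>R u + t *\<^sub>R v) \<le> (1 - t) * F u + t * F v - m / 2 * t * (1 - t) * (norm (u - v))\<^sup>2)"

text \<open>Essential smoothness in the sense of Rockafellar.\<close>

definition essentially_smooth :: "('u::real_normed_vector \<Rightarrow> ereal) \<Rightarrow> bool" where
  "essentially_smooth F \<longleftrightarrow> interior (edom F) \<noteq> {} \<and>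
     (\<forall>u\<in>interior (edom F). rpart F differentiable (at u)) \<and>
     (\<forall>z b. (\<forall>i. z i \<in> interior (edom F)) \<and> b \<in> frontier (interior (edom F)) \<and> z \<longlonglongrightarrow> b
        \<longrightarrow> filterlim (\<lambda>i::nat. norm (grad (rpart F) (z i))) at_top sequentially)"

text \<open>\<open>dgf w \<phi> U\<close>: \<open>w\<close> is a distance generating function with respect to \<open>(\<phi>, U)\<close>.\<close>

definition dgf :: "('u::real_normed_vector \<Rightarrow> ereal) \<Rightarrow> ('u \<Rightarrow> ereal) \<Rightarrow> 'u set \<Rightarrow> bool" where
  "dgf w \<phi> U \<longleftrightarrow> closed_convex_proper w \<and> U \<subseteq> edom w \<and>
     strongly_convex_on U 1 (rpart w) \<and> continuous_on U (rpart w) \<and> essentially_smooth w \<and>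
     (\<forall>\<alpha>>0. \<forall>v :: 'u \<Rightarrow>\<^sub>L real. \<exists>u \<in> U \<inter> interior (edom w).
        {y \<in> U. \<forall>y'\<in>U. \<phi> y + ereal (blinfun_apply v y) + ereal (inverse \<alpha>) * w y
                       \<le> \<phi> y' + ereal (blinfun_apply v y') + ereal (inverse \<alpha>) * w y'} = {u})"

text \<open>The quantity \<open>D\<close> of the solver's guarantee.\<close>

definition bregman_radius :: "'u::real_normed_vector set \<Rightarrow> ('u \<Rightarrow> ereal) \<Rightarrow> 'u \<Rightarrow> real" where
  "bregman_radius U w u0 = (SUP u\<in>U. bregman (rpart w) u u0)"


section \<open>The sub-problem solver\<close>

text \<open>Input of the solver: minimise \<open>(1/m) \<Sum>\<^sub>i \<phi>\<^sub>i + \<phi>\<^sub>2\<close> over \<open>U\<close>.\<close>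

record 'u composite =
  feas :: "'u set"
  ncomp :: nat
  comps :: "nat \<Rightarrow> 'u \<Rightarrow> real"
  reg :: "'u \<Rightarrow> ereal"
  kernel :: "'u \<Rightarrow> ereal"
  smoothness :: real
  convexity :: real
  start :: 'u

definition mean_comp :: "'u composite \<Rightarrow> 'u \<Rightarrow> real" where
  "mean_comp Q u = (1 / real (ncomp Q)) * (\<Sum>i=1..ncomp Q. comps Q i u)"

definition objective :: "'u composite \<Rightarrow> 'u \<Rightarrow> real" where
  "objective Q u = mean_comp Q u + real_of_ereal (reg Q u)"

definition composite_ok :: "'u::real_normed_vector composite \<Rightarrow> bool" where
  "composite_ok Q \<longleftrightarrow>
     feas Q \<noteq> {} \<and> convex (feas Q) \<and> compact (feas Q) \<and> ncomp Q \<ge> 1 \<and>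
     (\<forall>i\<in>{1..ncomp Q}. convex_on (feas Q) (comps Q i) \<and> (\<exists>l. smooth_on (feas Q) l (comps Q i))) \<and>
     smoothness Q \<ge> 0 \<and> smooth_on (feas Q) (smoothness Q) (mean_comp Q) \<and>
     closed_convex_proper (reg Q) \<and> feas Q \<subseteq> edom (reg Q) \<and>
     convexity Q > 0 \<and> strongly_convex_on (feas Q) (convexity Q) (objective Q) \<and>
     dgf (kernel Q) (reg Q) (feas Q) \<and> start Q \<in> feas Q \<inter> interior (edom (kernel Q))"

text \<open>Number of iterations after which accuracy \<open>e\<close> is guaranteed, rounded up to a positive integer;
  \<open>L\<close>, \<open>\<mu>\<close>, \<open>D\<close> are the smoothness, strong convexity and Bregman radius of the sub-problem.\<close>

definition rpd_iters :: "nat \<Rightarrow> real \<Rightarrow> real \<Rightarrow> real \<Rightarrow> real \<Rightarrow> nat" where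
  "rpd_iters m L \<mu> D e =
     (let a = real m + sqrt (8 * real m * (L / \<mu>))
      in max 1 (nat \<lceil>2 * a * ln (2 * (L / sqrt \<mu> + sqrt \<mu>)\<^sup>2 * a * D / e)\<rceil>))"

text \<open>The solver is a black box: \<open>law Q N\<close> is the distribution of its output after \<open>N\<close> iterations on
  input \<open>Q\<close>, and \<open>calls m N\<close> is the number of component gradients that \<open>N\<close> iterations with \<open>m\<close>
  components evaluate.\<close>

definition rpd_guarantee ::
    "('u::real_normed_vector composite \<Rightarrow> nat \<Rightarrow> 'u measure) \<Rightarrow> (nat \<Rightarrow> nat \<Rightarrow> nat) \<Rightarrow> real \<Rightarrow> bool" where
  "rpd_guarantee law calls c \<longleftrightarrow>
     (\<forall>Q e. composite_ok Q \<and> e > 0 \<longrightarrow>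
       (let N = rpd_iters (ncomp Q) (smoothness Q) (convexity Q)
                  (bregman_radius (feas Q) (kernel Q) (start Q)) e
        in prob_space (law Q N) \<and> sets (law Q N) = sets borel \<and> emeasure (law Q N) (feas Q) = 1 \<and>
           (\<forall>us\<in>feas Q. (\<forall>u\<in>feas Q. objective Q us \<le> objective Q u) \<longrightarrow>
              (\<integral>\<^sup>+u. ennreal (objective Q u - objective Q us) \<partial>law Q N) \<le> ennreal e) \<and>
           real (calls (ncomp Q) N) \<le> c * real N))"


section \<open>The saddle-point problem\<close>

record ('a, 'b) saddle =
  XX :: "'a set"
  LL :: "'b set"
  ff :: "'a \<Rightarrow> ereal"
  gg :: "'a \<Rightarrow> ereal"
  hh :: "'b \<Rightarrow> ereal"
  nn :: nat
  Phi_i :: "nat \<Rightarrow> 'a \<Rightarrow> 'b \<Rightarrow> real"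
  om :: "'b \<Rightarrow> ereal"
  om_bar :: "'a \<Rightarrow> ereal"
  L_f :: real
  mu :: real
  L_xx :: real
  L_lx :: real
  L_ll :: real

definition Phi :: "('a, 'b) saddle \<Rightarrow> 'a \<Rightarrow> 'b \<Rightarrow> real" where
  "Phi P x l = (1 / real (nn P)) * (\<Sum>i=1..nn P. Phi_i P i x l)"

abbreviation grad_x :: "('a::real_normed_vector \<Rightarrow> 'b \<Rightarrow> real) \<Rightarrow> 'a \<Rightarrow> 'b \<Rightarrow> 'a \<Rightarrow>\<^sub>L real" where
  "grad_x F x l \<equiv> grad (\<lambda>y. F y l) x"

abbreviation grad_l :: "('a \<Rightarrow> 'b::real_normed_vector \<Rightarrow> real) \<Rightarrow> 'a \<Rightarrow> 'b \<Rightarrow> 'b \<Rightarrow>\<^sub>L real" where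
  "grad_l F x l \<equiv> grad (F x) l"

definition L_D :: "('a, 'b) saddle \<Rightarrow> real" where
  "L_D P = L_ll P + (L_lx P)\<^sup>2 / mu P"

definition kappa_X :: "('a, 'b) saddle \<Rightarrow> real" where
  "kappa_X P = (L_f P + L_xx P) / mu P"

definition B_om :: "('a, 'b) saddle \<Rightarrow> real" where
  "B_om P = (SUP l\<in>LL P. \<bar>real_of_ereal (om P l)\<bar>)"

definition SS :: "('a, 'b) saddle \<Rightarrow> 'a \<Rightarrow> 'b \<Rightarrow> ereal" where
  "SS P x l = ff P x + gg P x + ereal (Phi P x l) - hh P l"

definition psi_P :: "('a, 'b) saddle \<Rightarrow> 'a \<Rightarrow> ereal" where
  "psi_P P x = (SUP l\<in>LL P. SS P x l)"

definition psi_D :: "('a, 'b) saddle \<Rightarrow> 'b \<Rightarrow> ereal" where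
  "psi_D P l = (INF x\<in>XX P. SS P x l)"

definition gap :: "('a, 'b) saddle \<Rightarrow> 'a \<Rightarrow> 'b \<Rightarrow> ereal" where
  "gap P x l = psi_P P x - psi_D P l"

definition SS_rho :: "('a, 'b) saddle \<Rightarrow> real \<Rightarrow> 'a \<Rightarrow> 'b \<Rightarrow> ereal" where
  "SS_rho P \<rho> x l = SS P x l - ereal \<rho> * om P l"

definition psi_P_rho :: "('a, 'b) saddle \<Rightarrow> real \<Rightarrow> 'a \<Rightarrow> ereal" where
  "psi_P_rho P \<rho> x = (SUP l\<in>LL P. SS_rho P \<rho> x l)"

definition saddle_ok :: "('a::real_normed_vector, 'b::real_normed_vector) saddle \<Rightarrow> bool" where
  "saddle_ok P \<longleftrightarrow>
     XX P \<noteq> {} \<and> closed (XX P) \<and> convex (XX P) \<and> bounded (XX P) \<and>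
     LL P \<noteq> {} \<and> closed (LL P) \<and> convex (LL P) \<and>
     closed_convex_proper (ff P) \<and> closed_convex_proper (gg P) \<and> closed_convex_proper (hh P) \<and>
     XX P \<subseteq> edom (gg P) \<and> LL P \<subseteq> edom (hh P) \<and>
     (\<exists>V. open V \<and> XX P \<subseteq> V \<and> V \<subseteq> edom (ff P) \<and> (\<forall>x\<in>V. rpart (ff P) differentiable (at x))) \<and>
     L_f P \<ge> mu P \<and> mu P > 0 \<and>
     (\<forall>x\<in>XX P. \<forall>x'\<in>XX P. mu P / 2 * (norm (x - x'))\<^sup>2 \<le> bregman (rpart (ff P)) x x' \<and>
        bregman (rpart (ff P)) x x' \<le> L_f P / 2 * (norm (x - x'))\<^sup>2) \<and>
     nn P \<ge> 1 \<and>
     (\<forall>i\<in>{1..nn P}.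
        (\<forall>l. convex_on UNIV (\<lambda>x. Phi_i P i x l)) \<and> (\<forall>x. concave_on UNIV (Phi_i P i x)) \<and>
        (\<forall>x\<in>XX P. \<forall>l\<in>LL P. (\<lambda>y. Phi_i P i y l) differentiable (at x) \<and>
           Phi_i P i x differentiable (at l)) \<and>
        (\<exists>C. C-lipschitz_on (XX P \<times> LL P) (\<lambda>(x, l). grad_x (Phi_i P i) x l)) \<and>
        (\<exists>C. C-lipschitz_on (XX P \<times> LL P) (\<lambda>(x, l). grad_l (Phi_i P i) x l))) \<and>
     L_xx P \<ge> 0 \<and> L_lx P \<ge> 0 \<and> L_ll P \<ge> 0 \<and>
     (\<forall>x\<in>XX P. \<forall>x'\<in>XX P. \<forall>l\<in>LL P. \<forall>l'\<in>LL P.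
        norm (grad_x (Phi P) x l - grad_x (Phi P) x' l) \<le> L_xx P * norm (x - x') \<and>
        norm (grad_x (Phi P) x l - grad_x (Phi P) x l') \<le> L_lx P * norm (l - l') \<and>
        norm (grad_l (Phi P) x l - grad_l (Phi P) x' l) \<le> L_lx P * norm (x - x') \<and>
        norm (grad_l (Phi P) x l - grad_l (Phi P) x l') \<le> L_ll P * norm (l - l')) \<and>
     (\<exists>x\<in>XX P. \<exists>l\<in>LL P. \<forall>x'\<in>XX P. \<forall>l'\<in>LL P. SS P x l' \<le> SS P x l \<and> SS P x l \<le> SS P x' l) \<and>
     dgf (om P) (hh P) (LL P) \<and> dgf (om_bar P) (gg P) (XX P)"


section \<open>The randomized algorithm\<close>

definition tau :: "nat \<Rightarrow> real" where
  "tau k = (real k + 1) / (real k + 3)"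

primrec rho :: "('a, 'b) saddle \<Rightarrow> nat \<Rightarrow> real" where
  "rho P 0 = 8 * L_D P"
| "rho P (Suc k) = tau k * rho P k"

text \<open>The common value of the accuracies \<open>\<gamma>\<^sub>k\<close> and \<open>\<eta>\<^sub>k\<close>.\<close>

definition acc :: "real \<Rightarrow> nat \<Rightarrow> real" where
  "acc \<epsilon> k = \<epsilon> / (4 * (real k + 3))"

text \<open>Sub-problem of the dual steps, with the sign changed to make it a minimisation, and sub-problem
  of the primal step. Terms not depending on the variable are dropped.\<close>

definition dual_sub :: "('a, 'b) saddle \<Rightarrow> 'b \<Rightarrow> real \<Rightarrow> 'a \<Rightarrow> 'b composite" where
  "dual_sub P l_start \<rho> x =
     \<lparr> feas = LL P, ncomp = nn P, comps = (\<lambda>i l. - Phi_i P i x l),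
       reg = (\<lambda>l. hh P l + ereal \<rho> * om P l), kernel = om P,
       smoothness = L_ll P, convexity = \<rho>, start = l_start \<rparr>"

definition primal_sub :: "('a, 'b) saddle \<Rightarrow> 'a \<Rightarrow> 'b \<Rightarrow> 'a composite" where
  "primal_sub P x_start l =
     \<lparr> feas = XX P, ncomp = nn P, comps = (\<lambda>i x. real_of_ereal (ff P x) + Phi_i P i x l),
       reg = gg P, kernel = om_bar P,
       smoothness = L_f P + L_xx P, convexity = mu P, start = x_start \<rparr>"

definition dual_iters :: "('a, 'b::real_normed_vector) saddle \<Rightarrow> 'b \<Rightarrow> real \<Rightarrow> real \<Rightarrow> nat" where
  "dual_iters P l_start \<rho> e = rpd_iters (nn P) (L_ll P) \<rho> (bregman_radius (LL P) (om P) l_start) e"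

definition primal_iters :: "('a::real_normed_vector, 'b) saddle \<Rightarrow> 'a \<Rightarrow> real \<Rightarrow> nat" where
  "primal_iters P x_start e =
     rpd_iters (nn P) (L_f P + L_xx P) (mu P) (bregman_radius (XX P) (om_bar P) x_start) e"

text \<open>In what follows \<open>lt\<close>, \<open>xt\<close>, \<open>lt'\<close> are the outputs of the solver in the three steps of each
  iteration, as random variables. Both iterates are running averages of solver outputs.\<close>

primrec averaged :: "'u::real_vector \<Rightarrow> (nat \<Rightarrow> 'w \<Rightarrow> 'u) \<Rightarrow> nat \<Rightarrow> 'w \<Rightarrow> 'u" where
  "averaged z0 z 0 = (\<lambda>w. z0)"
| "averaged z0 z (Suc k) = (\<lambda>w. tau k *\<^sub>R averaged z0 z k w + (1 - tau k) *\<^sub>R z k w)"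

definition l_hat :: "'b::real_vector \<Rightarrow> (nat \<Rightarrow> 'w \<Rightarrow> 'b) \<Rightarrow> (nat \<Rightarrow> 'w \<Rightarrow> 'b) \<Rightarrow> nat \<Rightarrow> 'w \<Rightarrow> 'b" where
  "l_hat l0 lt lt' k w = tau k *\<^sub>R averaged l0 lt' k w + (1 - tau k) *\<^sub>R lt k w"

definition adjoin :: "'w measure \<Rightarrow> ('w \<Rightarrow> 'u::topological_space) \<Rightarrow> 'w measure" where
  "adjoin F Y = sigma (space F) (sets F \<union> {Y -` A \<inter> space F | A. A \<in> sets borel})"

primrec filt0 :: "'w measure \<Rightarrow> (nat \<Rightarrow> 'w \<Rightarrow> 'b::topological_space) \<Rightarrow>
    (nat \<Rightarrow> 'w \<Rightarrow> 'a::topological_space) \<Rightarrow> (nat \<Rightarrow> 'w \<Rightarrow> 'b) \<Rightarrow> nat \<Rightarrow> 'w measure" where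
  "filt0 M lt xt lt' 0 = sigma (space M) {}"
| "filt0 M lt xt lt' (Suc k) = adjoin (adjoin (adjoin (filt0 M lt xt lt' k) (lt k)) (xt k)) (lt' k)"

definition filt1 where
  "filt1 M lt xt lt' k = adjoin (filt0 M lt xt lt' k) (lt k)"

definition filt2 where
  "filt2 M lt xt lt' k = adjoin (filt1 M lt xt lt' k) (xt k)"

text \<open>\<open>Y\<close> is drawn, given the past \<open>F\<close>, from the random distribution \<open>\<nu>\<close>.\<close>

definition draws :: "'w measure \<Rightarrow> 'w measure \<Rightarrow> ('w \<Rightarrow> 'u measure) \<Rightarrow> ('w \<Rightarrow> 'u::topological_space) \<Rightarrow> bool" where
  "draws M F \<nu> Y \<longleftrightarrow> Y \<in> borel_measurable M \<and>
     (\<forall>A\<in>sets borel. AE w in M. real_cond_exp M F (indicator (Y -` A \<inter> space M)) w = measure (\<nu> w) A)"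

definition ipds_run ::
    "('a::real_normed_vector, 'b::real_normed_vector) saddle \<Rightarrow>
     ('a composite \<Rightarrow> nat \<Rightarrow> 'a measure) \<Rightarrow> ('b composite \<Rightarrow> nat \<Rightarrow> 'b measure) \<Rightarrow>
     'a \<Rightarrow> 'b \<Rightarrow> 'a \<Rightarrow> 'b \<Rightarrow> real \<Rightarrow>
     'w measure \<Rightarrow> (nat \<Rightarrow> 'w \<Rightarrow> 'b) \<Rightarrow> (nat \<Rightarrow> 'w \<Rightarrow> 'a) \<Rightarrow> (nat \<Rightarrow> 'w \<Rightarrow> 'b) \<Rightarrow> bool" where
  "ipds_run P rpdX rpdL x_start l_start x0 l0 \<epsilon> M lt xt lt' \<longleftrightarrow> prob_space M \<and>
     (\<forall>k. (\<forall>w\<in>space M. lt k w \<in> LL P \<and> xt k w \<in> XX P \<and> lt' k w \<in> LL P) \<and>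
       draws M (filt0 M lt xt lt' k)
         (\<lambda>w. rpdL (dual_sub P l_start (rho P k) (averaged x0 xt k w))
                (dual_iters P l_start (rho P k) (acc \<epsilon> k))) (lt k) \<and>
       draws M (filt1 M lt xt lt' k)
         (\<lambda>w. rpdX (primal_sub P x_start (l_hat l0 lt lt' k w))
                (primal_iters P x_start (acc \<epsilon> k))) (xt k) \<and>
       draws M (filt2 M lt xt lt' k)
         (\<lambda>w. rpdL (dual_sub P l_start (rho P (Suc k)) (averaged x0 xt (Suc k) w))
                (dual_iters P l_start (rho P (Suc k)) (acc \<epsilon> k))) (lt' k))"

text \<open>The accuracy demanded of the three inexact steps. The errors are nonnegative, so nothing is lost
  by passing to \<open>ennreal\<close>.\<close>

definition ipds_accuracy ::
    "('a::real_normed_vector, 'b::real_normed_vector) saddle \<Rightarrow> 'a \<Rightarrow> 'b \<Rightarrow> real \<Rightarrow>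
     'w measure \<Rightarrow> (nat \<Rightarrow> 'w \<Rightarrow> 'b) \<Rightarrow> (nat \<Rightarrow> 'w \<Rightarrow> 'a) \<Rightarrow> (nat \<Rightarrow> 'w \<Rightarrow> 'b) \<Rightarrow> bool" where
  "ipds_accuracy P x0 l0 \<epsilon> M lt xt lt' \<longleftrightarrow>
     (\<forall>k. (AE w in M. nn_cond_exp M (filt0 M lt xt lt' k)
            (\<lambda>w. let x = averaged x0 xt k w
                 in e2ennreal (psi_P_rho P (rho P k) x - SS_rho P (rho P k) x (lt k w))) w
            \<le> ennreal (acc \<epsilon> k)) \<and>
          (AE w in M. nn_cond_exp M (filt1 M lt xt lt' k)
            (\<lambda>w. let l = l_hat l0 lt lt' k w
                 in e2ennreal (SS P (xt k w) l - psi_D P l)) w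
            \<le> ennreal (acc \<epsilon> k)) \<and>
          (AE w in M. nn_cond_exp M (filt2 M lt xt lt' k)
            (\<lambda>w. let x = averaged x0 xt (Suc k) w
                 in e2ennreal (psi_P_rho P (rho P (Suc k)) x - SS_rho P (rho P (Suc k)) x (lt' k w))) w
            \<le> ennreal (acc \<epsilon> k)))"

text \<open>The gap is nonnegative on the feasible set, hence so is its expectation.\<close>

definition expected_gap ::
    "('a::real_normed_vector, 'b::real_normed_vector) saddle \<Rightarrow> 'a \<Rightarrow> 'b \<Rightarrow>
     'w measure \<Rightarrow> (nat \<Rightarrow> 'w \<Rightarrow> 'a) \<Rightarrow> (nat \<Rightarrow> 'w \<Rightarrow> 'b) \<Rightarrow> nat \<Rightarrow> ennreal" where
  "expected_gap P x0 l0 M xt lt' K =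
     (\<integral>\<^sup>+w. e2ennreal (gap P (averaged x0 xt K w) (averaged l0 lt' K w)) \<partial>M)"

text \<open>Oracle calls made in the first \<open>K\<close> iterations. A component gradient of a primal sub-problem
  needs two primal oracle calls, one for \<open>\<nabla>f\<close> and one for \<open>\<nabla>\<^sub>x\<Phi>\<^sub>i\<close>.\<close>

definition primal_calls ::
    "('a::real_normed_vector, 'b) saddle \<Rightarrow> (nat \<Rightarrow> nat \<Rightarrow> nat) \<Rightarrow> 'a \<Rightarrow> real \<Rightarrow> nat \<Rightarrow> nat" where
  "primal_calls P calls x_start \<epsilon> K =
     (\<Sum>k<K. 2 * calls (nn P) (primal_iters P x_start (acc \<epsilon> k)))"

definition dual_calls ::
    "('a, 'b::real_normed_vector) saddle \<Rightarrow> (nat \<Rightarrow> nat \<Rightarrow> nat) \<Rightarrow> 'b \<Rightarrow> real \<Rightarrow> nat \<Rightarrow> nat" where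
  "dual_calls P calls l_start \<epsilon> K =
     (\<Sum>k<K. calls (nn P) (dual_iters P l_start (rho P k) (acc \<epsilon> k)) +
             calls (nn P) (dual_iters P l_start (rho P (Suc k)) (acc \<epsilon> k)))"

end

theory Submission
  imports Defs
begin

text \<open>The algorithm is an excessive gap method. Let \<open>\<psi>\<^sub>k\<close> be the primal value function smoothed with
  \<open>\<rho>\<^sub>k\<close>, and \<open>G\<^sub>k = \<psi>\<^sub>k(x\<^sub>k) - \<psi>\<^sup>D(\<lambda>\<^sub>k)\<close>. Two quadratic terms compete in one iteration. The smoothed
  saddle function is strongly concave in the dual variable, so that even an inexact maximizer forces a
  quadratic decrease (\<open>dual_near_maximizer\<close>). The dual value function has, up to \<open>h\<close>, a quadratic lower
  model of curvature \<open>L_D\<close> around the point at which the primal sub-problem is solved, because strong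
  convexity in \<open>x\<close> limits how fast the primal minimizer can move (\<open>dval_lower_model\<close>). With the chosen
  parameters the first term dominates the second, and
  \<open>G\<^sub>k\<^sub>+\<^sub>1 \<le> \<tau>\<^sub>k G\<^sub>k\<close> up to a fixed combination of the three sub-problem errors (\<open>excessive_gap_step\<close>).
  Since \<open>\<rho>\<^sub>k = 16 L_D / ((k + 1)(k + 2))\<close>, multiplying by \<open>(k + 1)(k + 2)\<close> makes the recursion
  telescope. The expected duality gap after \<open>K\<close> iterations is at most
  \<open>(2 \<Delta> + 32 L_D B) / ((K + 1)(K + 2)) + \<epsilon> / 2\<close> (\<open>expected_gap_le\<close>), so \<open>K\<close> of order
  \<open>sqrt (L_D / \<epsilon>)\<close> suffices.

  The solver promises an accuracy for each fixed sub-problem, whereas the sub-problems met during a run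
  are random and determined by the past. Their optimal values and objectives are Lipschitz in the
  datum that defines them, so the past can be cut into finitely many events on which the sub-problem is
  almost constant, and the promise carries over to the conditional expectation
  (\<open>draws_expected_error\<close>). That every sub-problem meets the requirements of the
  solver is the content of \<open>composite_ok_dual_sub\<close> and \<open>composite_ok_primal_sub\<close>.

  For the oracle calls, the argument of the logarithm in an iteration count grows at most polynomially in
  \<open>k\<close> and \<open>1/\<epsilon>\<close>, and \<open>k + 3 \<le> 1/\<epsilon>\<close> for small \<open>\<epsilon>\<close>. Hence the logarithm is at most a multiple of
  \<open>ln (1/\<epsilon>)\<close>, which in turn is at most twice the logarithm in the claimed bound. The condition number of
  the dual sub-problem grows like \<open>k\<^sup>2\<close>, and summing its square root over the iterations produces the
  term of order \<open>1/\<epsilon>\<close> in the dual bound.\<close>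

section \<open>Finite-dimensional normed spaces\<close>

text \<open>By induction on the basis: the span of the earlier vectors is complete in their coordinates, hence
  closed, so the new vector has a positive distance from it, and this distance controls the new
  coordinate.\<close>

lemma independent_coordinates_bounded:
  fixes B :: "'a::real_normed_vector set"
  assumes "finite B" "independent B"
  shows "\<exists>c>0. \<forall>r. (\<Sum>b\<in>B. \<bar>r b\<bar>) \<le> c * norm (\<Sum>b\<in>B. r b *\<^sub>R b)"
  using assms
proof (induction B rule: finite_induct)
  case empty
  show ?case by (auto intro: exI[of _ 1])
next
  case (insert a B)
  have ind: "independent B" and a: "a \<notin> span B"
    using insert.prems insert.hyps by (auto simp: independent_insert)
  obtain c where c: "c > 0" "\<And>r. (\<Sum>b\<in>B. \<bar>r b\<bar>) \<le> c * norm (\<Sum>b\<in>B. r b *\<^sub>R b)"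
    using insert.IH[OF ind] by auto
  have "closed (span B)"
    unfolding closed_sequential_limits
  proof (intro allI impI, elim conjE)
    fix x l assume xs: "\<forall>n. x n \<in> span B" and xl: "x \<longlonglongrightarrow> l"
    from xs have "\<forall>n. \<exists>r. x n = (\<Sum>b\<in>B. r b *\<^sub>R b)"
      by (auto simp: span_finite[OF insert.hyps(1)])
    then obtain r where r: "\<And>n. x n = (\<Sum>b\<in>B. r n b *\<^sub>R b)" by metis
    have coord: "\<bar>r n b - r m b\<bar> \<le> c * norm (x n - x m)" if "b \<in> B" for n m b
    proof -
      have "\<bar>r n b - r m b\<bar> \<le> (\<Sum>b\<in>B. \<bar>r n b - r m b\<bar>)"
        using that insert.hyps(1) by (intro member_le_sum) auto
      also have "\<dots> \<le> c * norm (\<Sum>b\<in>B. (r n b - r m b) *\<^sub>R b)" by (rule c(2))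
      also have "(\<Sum>b\<in>B. (r n b - r m b) *\<^sub>R b) = x n - x m"
        by (simp add: r scaleR_diff_left sum_subtractf)
      finally show ?thesis .
    qed
    have "Cauchy x" using xl LIMSEQ_imp_Cauchy by blast
    have "Cauchy (\<lambda>n. r n b)" if "b \<in> B" for b
    proof (rule metric_CauchyI)
      fix e :: real assume "e > 0"
      then obtain M where M: "\<And>m n. m \<ge> M \<Longrightarrow> n \<ge> M \<Longrightarrow> dist (x m) (x n) < e / c"
        using metric_CauchyD[OF \<open>Cauchy x\<close>, of "e / c"] c(1) by auto
      have "dist (r m b) (r n b) < e" if "m \<ge> M" "n \<ge> M" for m n
      proof -
        have "c * norm (x m - x n) < c * (e / c)"
          using M[OF that] c(1) by (intro mult_strict_left_mono) (auto simp: dist_norm)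
        then show ?thesis
          using coord[OF \<open>b \<in> B\<close>, of m n] c(1) by (simp add: dist_real_def)
      qed
      then show "\<exists>M. \<forall>m\<ge>M. \<forall>n\<ge>M. dist (r m b) (r n b) < e" by blast
    qed
    then have "\<forall>b\<in>B. \<exists>s. (\<lambda>n. r n b) \<longlonglongrightarrow> s"
      using real_Cauchy_convergent convergent_def by blast
    then obtain s where s: "\<And>b. b \<in> B \<Longrightarrow> (\<lambda>n. r n b) \<longlonglongrightarrow> s b" by metis
    have "(\<lambda>n. \<Sum>b\<in>B. r n b *\<^sub>R b) \<longlonglongrightarrow> (\<Sum>b\<in>B. s b *\<^sub>R b)"
      by (intro tendsto_sum tendsto_scaleR s tendsto_const)
    then have "l = (\<Sum>b\<in>B. s b *\<^sub>R b)"
      using xl LIMSEQ_unique unfolding r[symmetric] by blast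
    then show "l \<in> span B" by (simp add: span_finite[OF insert.hyps(1)])
  qed
  then have "open (- span B)" by (rule open_Compl)
  then obtain d where d: "d > 0" "ball a d \<subseteq> - span B"
    using a by (meson ComplI openE)
  have far: "d * \<bar>t\<bar> \<le> norm (t *\<^sub>R a + y)" if "y \<in> span B" for t y
  proof (cases "t = 0")
    case False
    have "(- (1 / t)) *\<^sub>R y \<in> span B" using that by (rule span_scale)
    then have "(- (1 / t)) *\<^sub>R y \<notin> ball a d" using d(2) by auto
    then have "d \<le> norm (a + (1 / t) *\<^sub>R y)" by (simp add: dist_norm)
    then have "\<bar>t\<bar> * d \<le> \<bar>t\<bar> * norm (a + (1 / t) *\<^sub>R y)" by (simp add: mult_left_mono)
    also have "\<dots> = norm (t *\<^sub>R (a + (1 / t) *\<^sub>R y))" by simp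
    also have "t *\<^sub>R (a + (1 / t) *\<^sub>R y) = t *\<^sub>R a + y" using False by (simp add: scaleR_add_right)
    finally show ?thesis by (simp add: mult.commute)
  qed simp
  define c' where "c' = c * (1 + norm a / d) + 1 / d"
  have "0 < 1 + norm a / d" using d(1) by (simp add: add_pos_nonneg)
  then have "c' > 0" using c(1) d(1) unfolding c'_def
    by (simp only: add_pos_pos mult_pos_pos divide_pos_pos zero_less_one)
  moreover have "(\<Sum>b\<in>insert a B. \<bar>r b\<bar>) \<le> c' * norm (\<Sum>b\<in>insert a B. r b *\<^sub>R b)" for r
  proof -
    define y where "y = (\<Sum>b\<in>B. r b *\<^sub>R b)"
    define N where "N = norm (r a *\<^sub>R a + y)"
    have "y \<in> span B" unfolding y_def by (intro span_sum span_scale span_base)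
    then have ra: "\<bar>r a\<bar> \<le> N / d" using far[of y "r a"] d(1) by (simp add: N_def field_simps)
    have "norm y = norm ((r a *\<^sub>R a + y) - r a *\<^sub>R a)" by simp
    also have "\<dots> \<le> N + \<bar>r a\<bar> * norm a" unfolding N_def by (metis norm_scaleR norm_triangle_ineq4)
    also have "\<dots> \<le> N + N / d * norm a" using ra by (intro add_left_mono mult_right_mono) auto
    finally have "norm y \<le> N + N / d * norm a" .
    then have "c * norm y \<le> c * (N + N / d * norm a)" using c(1) by simp
    moreover have "(\<Sum>b\<in>B. \<bar>r b\<bar>) \<le> c * norm y" unfolding y_def by (rule c(2))
    ultimately have "\<bar>r a\<bar> + (\<Sum>b\<in>B. \<bar>r b\<bar>) \<le> N / d + c * (N + N / d * norm a)" using ra by linarith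
    also have "\<dots> = c' * N" by (simp add: c'_def algebra_simps)
    finally show ?thesis using insert.hyps by (simp add: N_def y_def)
  qed
  ultimately show ?case by blast
qed

lemma compact_bounded_combinations:
  fixes B :: "'a::real_normed_vector set"
  assumes "finite B"
  shows "compact {\<Sum>b\<in>B. r b *\<^sub>R b | r. \<forall>b\<in>B. \<bar>r b\<bar> \<le> R}"
  using assms
proof (induction B rule: finite_induct)
  case empty
  then show ?case by simp
next
  case (insert a B)
  let ?T = "{\<Sum>b\<in>B. r b *\<^sub>R b | r. \<forall>b\<in>B. \<bar>r b\<bar> \<le> R}"
  let ?S = "(\<lambda>t. t *\<^sub>R a) ` {-R..R}"
  have "compact ?S"
    by (intro compact_continuous_image continuous_intros compact_Icc)
  then have "compact {x + y |x y. x \<in> ?S \<and> y \<in> ?T}"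
    using insert.IH by (rule compact_sums)
  moreover have "{x + y |x y. x \<in> ?S \<and> y \<in> ?T} =
    {\<Sum>b\<in>insert a B. r b *\<^sub>R b | r. \<forall>b\<in>insert a B. \<bar>r b\<bar> \<le> R}" (is "?L = ?R")
  proof (intro set_eqI iffI)
    fix z assume "z \<in> ?L"
    then obtain t r where tr: "t \<in> {-R..R}" "\<forall>b\<in>B. \<bar>r b\<bar> \<le> R" "z = t *\<^sub>R a + (\<Sum>b\<in>B. r b *\<^sub>R b)" by blast
    have "(\<Sum>b\<in>B. (r(a := t)) b *\<^sub>R b) = (\<Sum>b\<in>B. r b *\<^sub>R b)"
      using insert.hyps by (intro sum.cong) auto
    then have "z = (\<Sum>b\<in>insert a B. (r(a := t)) b *\<^sub>R b)" using tr insert.hyps by simp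
    moreover have "\<forall>b\<in>insert a B. \<bar>(r(a := t)) b\<bar> \<le> R" using tr by auto
    ultimately show "z \<in> ?R" by blast
  next
    fix z assume "z \<in> ?R"
    then obtain r where r: "\<forall>b\<in>insert a B. \<bar>r b\<bar> \<le> R" "z = (\<Sum>b\<in>insert a B. r b *\<^sub>R b)" by blast
    then have "z = r a *\<^sub>R a + (\<Sum>b\<in>B. r b *\<^sub>R b)" using insert.hyps by simp
    moreover have "r a *\<^sub>R a \<in> ?S" using r(1) by (auto simp: abs_le_iff)
    ultimately show "z \<in> ?L" using r(1) by auto
  qed
  ultimately show ?case by simp
qed

text \<open>Bounded sequences have bounded coordinates, so they live in a compact set of linear combinations. With
  this and the next instance, the general results on compact sets and on Borel measurable functions
  apply to the spaces of the problem.\<close>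

instance fin_dim_normed \<subseteq> heine_borel
proof
  fix f :: "nat \<Rightarrow> 'a" assume "bounded (range f)"
  then obtain R where R: "\<And>n. norm (f n) \<le> R" by (auto simp: bounded_iff)
  obtain B0 :: "'a set" where B0: "finite B0" "\<And>x. \<exists>r. x = (\<Sum>b\<in>B0. r b *\<^sub>R b)"
    using finite_dimensional by blast
  obtain B where B: "B \<subseteq> B0" "independent B" "B0 \<subseteq> span B"
    using maximal_independent_subset by blast
  have fin: "finite B" using B(1) B0(1) finite_subset by blast
  have "x \<in> span B" for x
  proof -
    obtain r where "x = (\<Sum>b\<in>B0. r b *\<^sub>R b)" using B0(2) by blast
    then show ?thesis using B(3) by (auto intro!: span_sum span_scale)
  qed
  then have sp: "\<exists>r. x = (\<Sum>b\<in>B. r b *\<^sub>R b)" for x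
    by (metis (mono_tags, lifting) span_finite[OF fin] imageE)
  obtain c where c: "c > 0" "\<And>r. (\<Sum>b\<in>B. \<bar>r b\<bar>) \<le> c * norm (\<Sum>b\<in>B. r b *\<^sub>R b)"
    using independent_coordinates_bounded[OF fin B(2)] by auto
  have mem: "f n \<in> {\<Sum>b\<in>B. r b *\<^sub>R b | r. \<forall>b\<in>B. \<bar>r b\<bar> \<le> c * R}" (is "_ \<in> ?K") for n
  proof -
    obtain r where r: "f n = (\<Sum>b\<in>B. r b *\<^sub>R b)" using sp by blast
    have "\<bar>r b\<bar> \<le> c * R" if "b \<in> B" for b
    proof -
      have "\<bar>r b\<bar> \<le> (\<Sum>b\<in>B. \<bar>r b\<bar>)" using that fin by (intro member_le_sum) auto
      also have "\<dots> \<le> c * norm (f n)" unfolding r by (rule c(2))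
      also have "\<dots> \<le> c * R" using R c(1) by simp
      finally show ?thesis .
    qed
    with r show ?thesis by blast
  qed
  have "seq_compact ?K" using compact_bounded_combinations[OF fin] compact_imp_seq_compact by blast
  then show "\<exists>l r. strict_mono (r::nat\<Rightarrow>nat) \<and> ((f \<circ> r) \<longlongrightarrow> l) sequentially"
    using mem unfolding seq_compact_def by blast
qed

text \<open>Balls are totally bounded; the balls around the points of finite nets for all radii form a countable
  basis.\<close>

instance fin_dim_normed \<subseteq> second_countable_topology
proof
  have "\<exists>N. finite N \<and> cball (0::'a) (real n) \<subseteq> (\<Union>x\<in>N. ball x (1 / real (Suc m)))" for n m :: nat
  proof -
    have "compact (cball (0::'a) (real n))" by simp
    then show ?thesis
      using seq_compact_imp_totally_bounded[OF compact_imp_seq_compact] by (metis of_nat_0_less_iff zero_less_Suc zero_less_divide_1_iff)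
  qed
  then obtain N where N: "\<And>n m. finite (N n m)"
      "\<And>n m. cball (0::'a) (real n) \<subseteq> (\<Union>x\<in>N n m. ball x (1 / real (Suc m)))" by metis
  define BB where "BB = (\<Union>n m. (\<lambda>x. ball x (1 / real (Suc m))) ` N n m)"
  have "countable BB" unfolding BB_def
    by (intro countable_UN countableI_type countable_image countable_finite N)
  moreover have "topological_basis BB"
  proof (rule topological_basisI)
    fix S assume "S \<in> BB" then show "open S" unfolding BB_def by auto
  next
    fix S :: "'a set" and x assume "open S" "x \<in> S"
    then obtain e where e: "e > 0" "ball x e \<subseteq> S" using openE by blast
    obtain m where m: "2 / real (Suc m) < e"
      using reals_Archimedean[of "e/2"] e(1) by (auto simp: field_simps)
    obtain n where "norm x \<le> real n" using real_arch_simple by blast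
    then obtain y where y: "y \<in> N n m" "x \<in> ball y (1 / real (Suc m))"
      using N(2)[of n m] by auto
    have "ball y (1 / real (Suc m)) \<subseteq> ball x e"
    proof
      fix z assume "z \<in> ball y (1 / real (Suc m))"
      then have "dist x z < 1 / real (Suc m) + 1 / real (Suc m)"
        using y(2) dist_triangle_less_add[of x y "1 / real (Suc m)" z "1 / real (Suc m)"]
        by (simp add: dist_commute)
      then show "z \<in> ball x e" using m by simp
    qed
    then show "\<exists>B'\<in>BB. x \<in> B' \<and> B' \<subseteq> S" using y e(2) unfolding BB_def by blast
  qed
  ultimately show "\<exists>B::'a set set. countable B \<and> open = generate_topology B"
    using topological_basis_imp_subbasis by blast
qed

section \<open>Convex functions, gradients and Bregman distances\<close>

lemma convex_on_sum_functions:
  assumes "finite I" "convex U" "\<And>i. i \<in> I \<Longrightarrow> convex_on U (F i)"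
  shows "convex_on U (\<lambda>u. \<Sum>i\<in>I. F i u :: real)"
  using assms(1,3)
proof (induction I rule: finite_induct)
  case empty
  show ?case using assms(2) by (simp add: convex_on_def)
next
  case (insert i I)
  then show ?case by (auto intro!: convex_on_add)
qed

lemma has_derivative_grad:
  assumes "F differentiable (at u)"
  shows "(F has_derivative blinfun_apply (grad F u)) (at u)"
proof -
  have d: "(F has_derivative frechet_derivative F (at u)) (at u)"
    using assms frechet_derivative_works by blast
  then have "bounded_linear (frechet_derivative F (at u))" by (rule has_derivative_bounded_linear)
  then show ?thesis using d by (simp add: grad_def bounded_linear_Blinfun_apply)
qed

lemma grad_eqI:
  assumes "(F has_derivative blinfun_apply D) (at u)"
  shows "grad F u = D"
  unfolding grad_def frechet_derivative_at[OF assms, symmetric] by (rule blinfun_apply_inverse)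

lemma grad_uminus:
  assumes "F differentiable (at u)"
  shows "grad (\<lambda>u. - F u) u = - grad F u"
  by (rule grad_eqI) (use has_derivative_minus[OF has_derivative_grad[OF assms]] in \<open>simp add: uminus_blinfun.rep_eq\<close>)

lemma grad_add:
  assumes "F differentiable (at u)" "G differentiable (at u)"
  shows "grad (\<lambda>u. F u + G u) u = grad F u + grad G u"
  by (rule grad_eqI)
    (use has_derivative_add[OF has_derivative_grad[OF assms(1)] has_derivative_grad[OF assms(2)]] in
      \<open>simp add: plus_blinfun.rep_eq\<close>)

lemma bregman_uminus:
  assumes "F differentiable (at v)"
  shows "bregman (\<lambda>u. - F u) u v = - bregman F u v"
  using assms by (simp add: bregman_def grad_uminus uminus_blinfun.rep_eq)

lemma bregman_add:
  assumes "F differentiable (at v)" "G differentiable (at v)"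
  shows "bregman (\<lambda>u. F u + G u) u v = bregman F u v + bregman G u v"
  using assms by (simp add: bregman_def grad_add plus_blinfun.rep_eq)

lemma has_real_derivative_along_line:
  assumes "F differentiable (at (v + s *\<^sub>R d))"
  shows "((\<lambda>s. F (v + s *\<^sub>R d)) has_real_derivative blinfun_apply (grad F (v + s *\<^sub>R d)) d) (at s)"
proof -
  have "((\<lambda>s. F (v + s *\<^sub>R d)) has_derivative (\<lambda>h. blinfun_apply (grad F (v + s *\<^sub>R d)) (h *\<^sub>R d))) (at s)"
    by (rule has_derivative_compose[where g = F and f = "\<lambda>s. v + s *\<^sub>R d", OF _ has_derivative_grad[OF assms]])
       (auto intro!: derivative_eq_intros)
  then show ?thesis
    by (simp add: has_field_derivative_def blinfun.scaleR_right mult.commute[of _ "blinfun_apply _ _"])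
qed

text \<open>The difference quotients along the segment towards \<open>u\<close> are bounded by \<open>F u - F v\<close> because of convexity,
  and they converge to the directional derivative.\<close>

lemma convex_on_imp_bregman_nonneg:
  assumes "convex_on U F" "u \<in> U" "v \<in> U" "F differentiable (at v)"
  shows "0 \<le> bregman F u v"
proof -
  define d where "d = u - v"
  let ?D = "blinfun_apply (grad F v) d"
  have "((\<lambda>s. F (v + s *\<^sub>R d)) has_real_derivative ?D) (at 0)"
    using has_real_derivative_along_line[of F v 0 d] assms(4) by simp
  then have "((\<lambda>s. (F (v + s *\<^sub>R d) - F v) / s) \<longlongrightarrow> ?D) (at_right 0)"
    by (auto simp: DERIV_def intro: filterlim_at_within_not_equal filterlim_mono[OF _ order_refl at_le])
  moreover have "eventually (\<lambda>s. (F (v + s *\<^sub>R d) - F v) / s \<le> F u - F v) (at_right 0)"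
  proof (rule eventually_at_rightI[of 0 1])
    fix s :: real assume s: "s \<in> {0<..<1}"
    have "F ((1 - s) *\<^sub>R v + s *\<^sub>R u) \<le> (1 - s) * F v + s * F u"
      using convex_onD[OF assms(1), of s v u] s assms(2,3) by auto
    moreover have "(1 - s) *\<^sub>R v + s *\<^sub>R u = v + s *\<^sub>R d" by (simp add: d_def algebra_simps)
    ultimately show "(F (v + s *\<^sub>R d) - F v) / s \<le> F u - F v"
      using s by (simp add: field_simps)
  qed simp
  ultimately have "?D \<le> F u - F v"
    by (rule tendsto_upperbound) simp
  then show ?thesis by (simp add: bregman_def d_def)
qed

text \<open>The tangent inequality at both points replaces the mean value theorem.\<close>

lemma convex_on_lipschitz_if_grad_bounded:
  assumes "convex_on U F" "u \<in> U" "v \<in> U"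
    and "\<And>w. w \<in> U \<Longrightarrow> F differentiable (at w)" "\<And>w. w \<in> U \<Longrightarrow> norm (grad F w) \<le> G"
  shows "\<bar>F u - F v\<bar> \<le> G * norm (u - v)"
proof -
  have *: "F v - F u \<le> G * norm (u - v)" if "u \<in> U" "v \<in> U" for u v
  proof -
    have "F v - F u \<le> - blinfun_apply (grad F v) (u - v)"
      using convex_on_imp_bregman_nonneg[OF assms(1) that assms(4)[OF that(2)]] by (simp add: bregman_def)
    also have "\<dots> \<le> norm (grad F v) * norm (u - v)"
      using norm_blinfun[of "grad F v" "u - v"] by (simp add: abs_le_iff)
    also have "\<dots> \<le> G * norm (u - v)"
      using assms(5)[OF that(2)] by (intro mult_right_mono) auto
    finally show ?thesis .
  qed
  show ?thesis using *[OF assms(2,3)] *[OF assms(3,2)] by (simp add: norm_minus_commute abs_le_iff)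
qed

text \<open>The descent lemma. The gradient is only controlled on \<open>U\<close>, so the argument compares derivatives along the
  segment from \<open>v\<close> to \<open>u\<close>.\<close>

lemma lipschitz_grad_imp_bregman_le:
  assumes "convex U" "u \<in> U" "v \<in> U"
    and diff: "\<And>w. w \<in> U \<Longrightarrow> F differentiable (at w)"
    and lip: "\<And>w. w \<in> U \<Longrightarrow> norm (grad F w - grad F v) \<le> L * norm (w - v)"
  shows "bregman F u v \<le> L / 2 * (norm (u - v))\<^sup>2"
proof -
  define d where "d = u - v"
  let ?g = "\<lambda>s. F (v + s *\<^sub>R d) - s * blinfun_apply (grad F v) d - L / 2 * s\<^sup>2 * (norm d)\<^sup>2"
  have "?g 1 \<le> ?g 0"
  proof (rule DERIV_nonpos_imp_nonincreasing[where f = ?g])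
    fix s :: real assume s: "0 \<le> s" "s \<le> 1"
    let ?w = "v + s *\<^sub>R d"
    have "?w = (1 - s) *\<^sub>R v + s *\<^sub>R u" by (simp add: d_def algebra_simps)
    then have w: "?w \<in> U" using assms(1-3) s by (metis convex_alt)
    have "(?g has_real_derivative blinfun_apply (grad F ?w) d - blinfun_apply (grad F v) d - L * s * (norm d)\<^sup>2) (at s)"
      by (auto intro!: derivative_eq_intros has_real_derivative_along_line diff[OF w])
    moreover have "blinfun_apply (grad F ?w) d - blinfun_apply (grad F v) d - L * s * (norm d)\<^sup>2 \<le> 0"
    proof -
      have "blinfun_apply (grad F ?w) d - blinfun_apply (grad F v) d = blinfun_apply (grad F ?w - grad F v) d"
        by (simp add: minus_blinfun.rep_eq)
      also have "\<dots> \<le> norm (grad F ?w - grad F v) * norm d"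
        using norm_blinfun[of "grad F ?w - grad F v" d] by (simp add: abs_le_iff)
      also have "\<dots> \<le> L * norm (?w - v) * norm d"
        by (intro mult_right_mono lip w) auto
      also have "\<dots> = L * s * (norm d)\<^sup>2" using s by (simp add: power2_eq_square)
      finally show ?thesis by simp
    qed
    ultimately show "\<exists>y. (?g has_real_derivative y) (at s) \<and> y \<le> 0" by blast
  qed simp
  then show ?thesis by (simp add: bregman_def d_def)
qed

lemma strongly_convex_on_add:
  assumes "strongly_convex_on U m F" "convex_on U G"
  shows "strongly_convex_on U m (\<lambda>u. F u + G u)"
  unfolding strongly_convex_on_def
proof (intro ballI)
  fix u v t assume uv: "u \<in> U" "v \<in> U" and t: "t \<in> {0..1::real}"
  have "F ((1 - t) *\<^sub>R u + t *\<^sub>R v) \<le> (1 - t) * F u + t * F v - m / 2 * t * (1 - t) * (norm (u - v))\<^sup>2"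
    using assms(1) uv t unfolding strongly_convex_on_def by blast
  moreover have "G ((1 - t) *\<^sub>R u + t *\<^sub>R v) \<le> (1 - t) * G u + t * G v"
    using convex_onD[OF assms(2), of t u v] uv t by auto
  ultimately show "F ((1 - t) *\<^sub>R u + t *\<^sub>R v) + G ((1 - t) *\<^sub>R u + t *\<^sub>R v)
      \<le> (1 - t) * (F u + G u) + t * (F v + G v) - m / 2 * t * (1 - t) * (norm (u - v))\<^sup>2"
    by (simp add: algebra_simps)
qed

lemma strongly_convex_on_scale:
  assumes "strongly_convex_on U 1 F" "0 \<le> m"
  shows "strongly_convex_on U m (\<lambda>u. m * F u)"
  unfolding strongly_convex_on_def
proof (intro ballI)
  fix u v t assume uv: "u \<in> U" "v \<in> U" and t: "t \<in> {0..1::real}"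
  have "m * F ((1 - t) *\<^sub>R u + t *\<^sub>R v) \<le> m * ((1 - t) * F u + t * F v - 1 / 2 * t * (1 - t) * (norm (u - v))\<^sup>2)"
    using assms uv t unfolding strongly_convex_on_def by (intro mult_left_mono) blast+
  then show "m * F ((1 - t) *\<^sub>R u + t *\<^sub>R v) \<le> (1 - t) * (m * F u) + t * (m * F v) - m / 2 * t * (1 - t) * (norm (u - v))\<^sup>2"
    by (simp add: algebra_simps)
qed

text \<open>Both end points are compared with the tangent at the intermediate point, where the linear terms cancel.\<close>

lemma strongly_convex_on_if_bregman:
  assumes "convex U" "\<And>u v. u \<in> U \<Longrightarrow> v \<in> U \<Longrightarrow> m / 2 * (norm (u - v))\<^sup>2 \<le> bregman F u v"
  shows "strongly_convex_on U m F"
  unfolding strongly_convex_on_def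
proof (intro ballI)
  fix u v t assume uv: "u \<in> U" "v \<in> U" and t: "t \<in> {0..1::real}"
  define z where "z = (1 - t) *\<^sub>R u + t *\<^sub>R v"
  define D where "D = blinfun_apply (grad F z) (u - v)"
  define N where "N = (norm (u - v))\<^sup>2"
  have z: "z \<in> U" using assms(1) uv t unfolding z_def by (auto simp: convex_alt)
  have e: "u - z = t *\<^sub>R (u - v)" "v - z = (- (1 - t)) *\<^sub>R (u - v)" by (simp_all add: z_def algebra_simps)
  have sq: "(norm (t *\<^sub>R (u - v)))\<^sup>2 = t\<^sup>2 * N" "(norm ((- (1 - t)) *\<^sub>R (u - v)))\<^sup>2 = (1 - t)\<^sup>2 * N"
    by (simp_all only: N_def norm_scaleR power_mult_distrib power2_abs power2_minus)
  have "m / 2 * (t\<^sup>2 * N) \<le> F u - F z - t * D"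
    using assms(2)[OF uv(1) z] unfolding bregman_def e sq D_def by (simp only: blinfun.scaleR_right real_scaleR_def)
  then have "(1 - t) * (m / 2 * (t\<^sup>2 * N)) \<le> (1 - t) * (F u - F z - t * D)"
    using t by (intro mult_left_mono) auto
  moreover have "m / 2 * ((1 - t)\<^sup>2 * N) \<le> F v - F z - (- (1 - t)) * D"
    using assms(2)[OF uv(2) z] unfolding bregman_def e sq D_def by (simp only: blinfun.scaleR_right real_scaleR_def)
  then have "t * (m / 2 * ((1 - t)\<^sup>2 * N)) \<le> t * (F v - F z - (- (1 - t)) * D)"
    using t by (intro mult_left_mono) auto
  moreover have "(1 - t) * (F u - F z - t * D) + t * (F v - F z - (- (1 - t)) * D) = (1 - t) * F u + t * F v - F z"
    by (simp add: algebra_simps)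
  moreover have "(1 - t) * (m / 2 * (t\<^sup>2 * N)) + t * (m / 2 * ((1 - t)\<^sup>2 * N)) = m / 2 * t * (1 - t) * N"
  proof -
    have "(1 - t) * (m / 2 * (t\<^sup>2 * N)) + t * (m / 2 * ((1 - t)\<^sup>2 * N)) = m / 2 * N * ((1 - t) * t\<^sup>2 + t * (1 - t)\<^sup>2)"
      by (simp only: distrib_left mult_ac)
    also have "(1 - t) * t\<^sup>2 + t * (1 - t)\<^sup>2 = t * (1 - t)"
      by (simp add: power2_eq_square algebra_simps)
    finally show ?thesis by (simp only: mult_ac)
  qed
  ultimately have "F z \<le> (1 - t) * F u + t * F v - m / 2 * t * (1 - t) * N"
    by linarith
  then show "F ((1 - t) *\<^sub>R u + t *\<^sub>R v) \<le> (1 - t) * F u + t * F v - m / 2 * t * (1 - t) * (norm (u - v))\<^sup>2"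
    by (simp add: z_def N_def)
qed

text \<open>The value at points of the segment towards \<open>u\<close> cannot fall below the minimum; dividing by the step length
  and letting it tend to zero leaves the full quadratic term.\<close>

lemma strongly_convex_on_minimizer:
  assumes sc: "strongly_convex_on U m F" and "convex U" "us \<in> U" "u \<in> U" "\<And>v. v \<in> U \<Longrightarrow> F us \<le> F v"
  shows "F us + m / 2 * (norm (u - us))\<^sup>2 \<le> F u"
proof -
  let ?N = "(norm (u - us))\<^sup>2"
  have "eventually (\<lambda>t. m / 2 * (1 - t) * ?N \<le> F u - F us) (at_right 0)"
  proof (rule eventually_at_rightI[of 0 1])
    fix t :: real assume t: "t \<in> {0<..<1}"
    have "(1 - t) *\<^sub>R us + t *\<^sub>R u \<in> U" using assms(2-4) t by (auto simp: convex_alt)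
    then have "F us \<le> F ((1 - t) *\<^sub>R us + t *\<^sub>R u)" by (rule assms(5))
    also have "\<dots> \<le> (1 - t) * F us + t * F u - m / 2 * t * (1 - t) * (norm (us - u))\<^sup>2"
      using sc assms(3,4) t unfolding strongly_convex_on_def by auto
    finally have "t * (m / 2 * (1 - t) * ?N) \<le> t * (F u - F us)"
      by (simp add: algebra_simps norm_minus_commute)
    then show "m / 2 * (1 - t) * ?N \<le> F u - F us" using t by simp
  qed simp
  moreover have "((\<lambda>t. m / 2 * (1 - t) * ?N) \<longlongrightarrow> m / 2 * (1 - 0) * ?N) (at_right 0)"
    by (intro tendsto_intros)
  ultimately have "m / 2 * (1 - 0) * ?N \<le> F u - F us"
    using tendsto_upperbound trivial_limit_at_right_real by blast
  then show ?thesis by simp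
qed

text \<open>The form in which inexact solutions enter the analysis: the growth is measured from the approximate
  minimizer \<open>w\<close> instead of the unknown exact one, at the price of half the curvature and of the error \<open>e\<close>.\<close>

lemma strongly_convex_on_near_minimizer:
  assumes sc: "strongly_convex_on U m F" and "convex U" "us \<in> U" "\<And>v. v \<in> U \<Longrightarrow> F us \<le> F v"
    and "0 \<le> m" "w \<in> U" "F w \<le> F us + e" "v \<in> U"
  shows "F us + m / 4 * (norm (v - w))\<^sup>2 - e \<le> F v"
proof -
  have "norm (v - w) \<le> norm (v - us) + norm (w - us)"
    using norm_triangle_ineq4[of "v - us" "w - us"] by simp
  then have "(norm (v - w))\<^sup>2 \<le> (norm (v - us) + norm (w - us))\<^sup>2" by (intro power_mono) auto
  also have "\<dots> \<le> 2 * (norm (v - us))\<^sup>2 + 2 * (norm (w - us))\<^sup>2" using sum_squares_bound[of "norm (v - us)" "norm (w - us)"] by (simp add: power2_sum)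
  finally have "m / 4 * (norm (v - w))\<^sup>2 \<le> m / 4 * (2 * (norm (v - us))\<^sup>2 + 2 * (norm (w - us))\<^sup>2)"
    using assms(5) by (intro mult_left_mono) auto
  then show ?thesis
    using strongly_convex_on_minimizer[OF sc assms(2,3) assms(8,4)]
      strongly_convex_on_minimizer[OF sc assms(2,3) assms(6,4)] assms(7)
    by (simp add: algebra_simps)
qed

lemma ereal_rpart:
  assumes "closed_convex_proper F" "u \<in> edom F"
  shows "F u = ereal (rpart F u)"
  using assms by (cases "F u") (auto simp: closed_convex_proper_def edom_def)

lemma closed_convex_proper_convex_on:
  assumes "closed_convex_proper F" "U \<subseteq> edom F" "convex U"
  shows "convex_on U (rpart F)"
proof (rule convex_onI)
  fix t :: real and u v assume t: "0 < t" "t < 1" and uv: "u \<in> U" "v \<in> U"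
  have "(u, rpart F u) \<in> eepi F" "(v, rpart F v) \<in> eepi F"
    using ereal_rpart[OF assms(1)] uv assms(2) by (auto simp: eepi_def)
  then have "(1 - t) *\<^sub>R (u, rpart F u) + t *\<^sub>R (v, rpart F v) \<in> eepi F"
    using assms(1) t by (intro convexD_alt) (auto simp: closed_convex_proper_def)
  then have "F ((1 - t) *\<^sub>R u + t *\<^sub>R v) \<le> ereal ((1 - t) * rpart F u + t * rpart F v)"
    by (simp add: eepi_def)
  moreover have "(1 - t) *\<^sub>R u + t *\<^sub>R v \<in> edom F"
    using assms(2,3) uv t by (auto simp: convex_alt)
  ultimately show "rpart F ((1 - t) *\<^sub>R u + t *\<^sub>R v) \<le> (1 - t) * rpart F u + t * rpart F v"
    using ereal_rpart[OF assms(1)] by (metis ereal_less_eq(3))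
qed (rule assms(3))

lemma closed_convex_proper_sublevel_closed:
  assumes "closed_convex_proper F"
  shows "closed {u. F u \<le> ereal r}"
proof -
  have "closed ((\<lambda>u. (u, r)) -` eepi F)"
    using assms by (intro closed_vimage continuous_intros) (auto simp: closed_convex_proper_def)
  then show ?thesis by (simp add: eepi_def vimage_def)
qed

lemma closed_convex_proper_measurable:
  assumes "closed_convex_proper F"
  shows "F \<in> borel_measurable borel"
proof (rule borel_measurableI_le)
  fix y :: ereal
  show "{u \<in> space borel. F u \<le> y} \<in> sets borel"
  proof (cases y)
    case (real r)
    then show ?thesis using closed_convex_proper_sublevel_closed[OF assms] by simp
  next
    case MInf
    then have "{u \<in> space borel. F u \<le> y} = {}" using assms by (auto simp: closed_convex_proper_def)
    then show ?thesis by simp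
  qed simp
qed

lemma closed_convex_proper_scale:
  assumes F: "closed_convex_proper F" and "0 < (r::real)"
  shows "closed_convex_proper (\<lambda>u. ereal r * F u)"
proof -
  have iff: "ereal r * F u \<le> ereal s \<longleftrightarrow> F u \<le> ereal (s / r)" for u s
    using assms(2) by (cases "F u") (auto simp: field_simps)
  have epi: "eepi (\<lambda>u. ereal r * F u) = (\<lambda>(u, s). (u, s / r)) -` eepi F"
    by (auto simp: eepi_def iff)
  have "closed (eepi (\<lambda>u. ereal r * F u))"
    unfolding epi using F assms(2)
    by (intro closed_vimage) (auto simp: closed_convex_proper_def case_prod_unfold intro!: continuous_intros)
  moreover have "linear (\<lambda>(u::'a, s). (u, s / r))"
    by (rule linearI) (auto simp: add_divide_distrib)
  then have "convex (eepi (\<lambda>u. ereal r * F u))"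
    unfolding epi using F by (intro convex_linear_vimage) (auto simp: closed_convex_proper_def)
  moreover have "ereal r * F u \<noteq> -\<infinity>" for u
    using F assms(2) by (cases "F u") (auto simp: closed_convex_proper_def)
  moreover have "edom (\<lambda>u. ereal r * F u) = edom F"
    using assms(2) by (auto simp: edom_def ereal_mult_less_right ereal_mult_eq_PInfty less_top[symmetric] top_ereal_def)
  ultimately show ?thesis using F by (simp add: closed_convex_proper_def)
qed

text \<open>Only closedness needs an argument: if the sum exceeds \<open>r\<close> at the limit, then real lower bounds of the two
  values that still add up to more than \<open>r\<close> persist along the sequence.\<close>

lemma closed_convex_proper_add:
  assumes F: "closed_convex_proper F" and G: "closed_convex_proper G" and "edom F \<inter> edom G \<noteq> {}"
  shows "closed_convex_proper (\<lambda>u. F u + G u)"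
proof -
  have nm: "F u \<noteq> -\<infinity>" "G u \<noteq> -\<infinity>" for u
    using F G by (auto simp: closed_convex_proper_def)
  have "convex (eepi (\<lambda>u. F u + G u))"
    unfolding convex_alt
  proof (safe, goal_cases)
    case (1 u r v s t)
    then obtain a b a' b' where ab: "F u = ereal a" "G u = ereal b" "F v = ereal a'" "G v = ereal b'"
        "a + b \<le> r" "a' + b' \<le> s"
      using nm[of u] nm[of v]
      by (cases "F u"; cases "G u"; cases "F v"; cases "G v") (auto simp: eepi_def)
    let ?z = "(1 - t) *\<^sub>R u + t *\<^sub>R v"
    have "(1 - t) *\<^sub>R (u, a) + t *\<^sub>R (v, a') \<in> eepi F" "(1 - t) *\<^sub>R (u, b) + t *\<^sub>R (v, b') \<in> eepi G"
      using F G 1 ab unfolding closed_convex_proper_def convex_alt by (auto simp: eepi_def)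
    then have "F ?z + G ?z \<le> ereal ((1 - t) * a + t * a') + ereal ((1 - t) * b + t * b')"
      by (intro add_mono) (auto simp: eepi_def)
    also have "\<dots> = ereal ((1 - t) * (a + b) + t * (a' + b'))" by (simp add: algebra_simps)
    also have "\<dots> \<le> ereal ((1 - t) * r + t * s)"
      using 1 ab by (auto intro!: add_mono mult_left_mono)
    finally show ?case by (simp add: eepi_def)
  qed
  moreover have "closed (eepi (\<lambda>u. F u + G u))"
    unfolding closed_sequential_limits
  proof (intro allI impI, elim conjE)
    fix z l assume z: "\<forall>n. z n \<in> eepi (\<lambda>u. F u + G u)" and l: "z \<longlonglongrightarrow> l"
    define u r where "u = fst l" "r = snd l"
    have ul: "(\<lambda>n. fst (z n)) \<longlonglongrightarrow> u" and rl: "(\<lambda>n. snd (z n)) \<longlonglongrightarrow> r"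
      using tendsto_fst[OF l] tendsto_snd[OF l] by (auto simp: u_r_def)
    have "F u + G u \<le> ereal r"
    proof (rule ccontr)
      assume "\<not> F u + G u \<le> ereal r"
      then have gt: "ereal r < F u + G u" by simp
      obtain \<alpha> \<beta> where ab: "ereal \<alpha> < F u" "ereal \<beta> < G u" "r < \<alpha> + \<beta>"
      proof (cases "F u"; cases "G u")
        fix a b assume *: "F u = ereal a" "G u = ereal b"
        show ?thesis using gt * by (intro that[of "a - (a + b - r) / 3" "b - (a + b - r) / 3"]) (auto simp: field_simps)
      next
        fix a assume *: "F u = ereal a" "G u = \<infinity>"
        show ?thesis using * by (intro that[of "a - 1" "r - a + 2"]) auto
      next
        fix b assume *: "F u = \<infinity>" "G u = ereal b"
        show ?thesis using * by (intro that[of "r - b + 2" "b - 1"]) auto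
      next
        assume *: "F u = \<infinity>" "G u = \<infinity>"
        show ?thesis using * by (intro that[of "r + 1" 0]) auto
      qed (use nm[of u] in auto)
      have "open (- {v. F v \<le> ereal \<alpha>})" "open (- {v. G v \<le> ereal \<beta>})"
        using closed_convex_proper_sublevel_closed F G by auto
      then have "eventually (\<lambda>n. fst (z n) \<in> - {v. F v \<le> ereal \<alpha>}) sequentially"
          "eventually (\<lambda>n. fst (z n) \<in> - {v. G v \<le> ereal \<beta>}) sequentially"
        using ab topological_tendstoD[OF ul, of "- {v. F v \<le> ereal \<alpha>}"]
          topological_tendstoD[OF ul, of "- {v. G v \<le> ereal \<beta>}"] by simp_all
      then have "eventually (\<lambda>n. \<alpha> + \<beta> \<le> snd (z n)) sequentially"
      proof eventually_elim
        case (elim n)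
        have "F (fst (z n)) + G (fst (z n)) \<le> ereal (snd (z n))"
          using z by (auto simp: eepi_def case_prod_unfold)
        then show ?case using elim
          by (cases "F (fst (z n))"; cases "G (fst (z n))") auto
      qed
      then have "\<alpha> + \<beta> \<le> r" using rl tendsto_lowerbound by (metis trivial_limit_sequentially)
      then show False using ab by simp
    qed
    then show "l \<in> eepi (\<lambda>u. F u + G u)" by (simp add: eepi_def u_r_def case_prod_unfold)
  qed
  moreover have "edom F \<inter> edom G \<subseteq> edom (\<lambda>u. F u + G u)"
    by (auto simp: edom_def)
  ultimately show ?thesis using nm assms(3) by (auto simp: closed_convex_proper_def)
qed

text \<open>The sets of points that are at least as good as a given point are closed, and finitely many of them
  always intersect, namely in the best of the given points. Compactness yields a point in all of them.\<close>

lemma attains_minimum: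
  assumes F: "closed_convex_proper F" and U: "compact U" "U \<noteq> {}" "U \<subseteq> edom F" and c: "continuous_on U c"
  shows "\<exists>u\<in>U. \<forall>v\<in>U. c u + rpart F u \<le> c v + rpart F v"
proof -
  define val where "val u = c u + rpart F u" for u
  have "U \<inter> (\<Inter>v\<in>U. {u \<in> U. val u \<le> val v}) \<noteq> {}"
  proof (rule compact_imp_fip_image[OF U(1)])
    fix v assume "v \<in> U"
    have "closed (eepi F)" using F by (simp add: closed_convex_proper_def)
    then have "closed (U \<inter> (\<lambda>u. (u, val v - c u)) -` eepi F)"
      by (intro continuous_closed_preimage continuous_intros c compact_imp_closed[OF U(1)])
    moreover have "U \<inter> (\<lambda>u. (u, val v - c u)) -` eepi F = {u \<in> U. val u \<le> val v}"
    proof -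
      have "F u \<le> ereal (val v - c u) \<longleftrightarrow> val u \<le> val v" if "u \<in> U" for u
        using ereal_rpart[OF F, of u] that U(3) by (metis val_def ereal_less_eq(3) le_diff_eq add.commute subsetD)
      then show ?thesis by (auto simp: eepi_def)
    qed
    ultimately show "closed {u \<in> U. val u \<le> val v}" by simp
  next
    fix I assume I: "finite I" "I \<subseteq> U"
    show "U \<inter> (\<Inter>v\<in>I. {u \<in> U. val u \<le> val v}) \<noteq> {}"
    proof (cases "I = {}")
      case False
      then obtain w where "w \<in> I" "\<forall>v\<in>I. val w \<le> val v"
        using ex_is_arg_min_if_finite[OF I(1) False, of val] by (auto simp: is_arg_min_linorder)
      then show ?thesis using I(2) by blast
    qed (use U in auto)
  qed
  then show ?thesis unfolding val_def by blast
qed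

lemma continuous_on_of_one_sided_lipschitz:
  fixes g :: "'z::real_normed_vector \<Rightarrow> real"
  assumes "0 \<le> G" "\<And>x y. x \<in> S \<Longrightarrow> y \<in> S \<Longrightarrow> g x \<le> g y + G * norm (x - y)"
  shows "continuous_on S g"
proof (rule lipschitz_on_continuous_on, rule lipschitz_onI[OF _ assms(1)])
  fix x y assume "x \<in> S" "y \<in> S"
  then show "dist (g x) (g y) \<le> G * dist x y"
    using assms(2)[of x y] assms(2)[of y x] by (simp add: dist_real_def dist_norm norm_minus_commute)
qed

lemma lipschitz_grad_imp_smooth_on:
  assumes "convex U" "\<And>u. u \<in> U \<Longrightarrow> F differentiable (at u)"
    and "\<And>u v. u \<in> U \<Longrightarrow> v \<in> U \<Longrightarrow> norm (grad F u - grad F v) \<le> L * norm (u - v)"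
  shows "smooth_on U L F" "smooth_on U L (\<lambda>u. - F u)"
proof -
  show "smooth_on U L F"
    unfolding smooth_on_def
    by (intro conjI ballI assms(2,3) lipschitz_grad_imp_bregman_le[OF assms(1)])
  have *: "norm (grad (\<lambda>u. - F u) u - grad (\<lambda>u. - F u) v) \<le> L * norm (u - v)" if "u \<in> U" "v \<in> U" for u v
    using assms(3)[OF that] by (simp add: grad_uminus assms(2) that norm_minus_commute)
  show "smooth_on U L (\<lambda>u. - F u)"
    unfolding smooth_on_def
    by (intro conjI ballI lipschitz_grad_imp_bregman_le[OF assms(1)] differentiable_minus * assms(2))
qed

lemma smooth_on_add:
  assumes "smooth_on U L F" "smooth_on U K G"
  shows "smooth_on U (L + K) (\<lambda>u. F u + G u)"
  unfolding smooth_on_def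
proof (intro conjI ballI)
  have dF: "F differentiable (at u)" "G differentiable (at u)" if "u \<in> U" for u
    using assms that by (auto simp: smooth_on_def)
  fix u assume u: "u \<in> U"
  show "(\<lambda>u. F u + G u) differentiable (at u)" by (intro differentiable_add dF u)
  fix v assume v: "v \<in> U"
  have "bregman F u v \<le> L / 2 * (norm (u - v))\<^sup>2" "bregman G u v \<le> K / 2 * (norm (u - v))\<^sup>2"
    using assms u v by (auto simp: smooth_on_def)
  then show "bregman (\<lambda>u. F u + G u) u v \<le> (L + K) / 2 * (norm (u - v))\<^sup>2"
    unfolding bregman_add[OF dF[OF v]] by (simp add: algebra_simps add_divide_distrib)
qed

lemma strongly_convex_on_cong:
  assumes "strongly_convex_on U m F" "convex U" "\<And>u. u \<in> U \<Longrightarrow> G u = F u"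
  shows "strongly_convex_on U m G"
  unfolding strongly_convex_on_def
proof (intro ballI)
  fix u v and t :: real assume *: "u \<in> U" "v \<in> U" "t \<in> {0..1}"
  then have "(1 - t) *\<^sub>R u + t *\<^sub>R v \<in> U" using assms(2) by (auto simp: convex_alt)
  then show "G ((1 - t) *\<^sub>R u + t *\<^sub>R v) \<le> (1 - t) * G u + t * G v - m / 2 * t * (1 - t) * (norm (u - v))\<^sup>2"
    using assms(1,3) * unfolding strongly_convex_on_def by simp
qed

text \<open>The dual sub-problems put a multiple of the distance generating function into the regularizer; this only
  changes the coefficient \<open>1/\<alpha>\<close> of the proximal problem.\<close>

lemma dgf_absorb_multiple:
  assumes w: "dgf w \<phi> U" and \<phi>: "\<And>u. u \<in> U \<Longrightarrow> \<bar>\<phi> u\<bar> \<noteq> \<infinity>" and "0 < (\<rho>::real)"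
  shows "dgf w (\<lambda>u. \<phi> u + ereal \<rho> * w u) U"
proof -
  have unique: "\<exists>u \<in> U \<inter> interior (edom w).
        {y \<in> U. \<forall>y'\<in>U. \<phi> y + ereal (blinfun_apply v y) + ereal (inverse \<alpha>) * w y
                       \<le> \<phi> y' + ereal (blinfun_apply v y') + ereal (inverse \<alpha>) * w y'} = {u}"
    if "0 < \<alpha>" for \<alpha> and v :: "'a \<Rightarrow>\<^sub>L real"
    by (rule w[unfolded dgf_def, THEN conjunct2, THEN conjunct2, THEN conjunct2, THEN conjunct2, THEN conjunct2,
        THEN spec, THEN mp, OF that, THEN spec])
  have wfin: "\<bar>w u\<bar> \<noteq> \<infinity>" if "u \<in> U" for u
  proof -
    have "closed_convex_proper w" by (rule w[unfolded dgf_def, THEN conjunct1])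
    moreover have "u \<in> edom w" by (rule subsetD[OF w[unfolded dgf_def, THEN conjunct2, THEN conjunct1] that])
    ultimately have "w u = ereal (rpart w u)" by (rule ereal_rpart)
    then show ?thesis by (cases "w u") auto
  qed
  have "\<exists>u \<in> U \<inter> interior (edom w).
        {y \<in> U. \<forall>y'\<in>U. \<phi> y + ereal \<rho> * w y + ereal (blinfun_apply v y) + ereal (inverse \<alpha>) * w y
                       \<le> \<phi> y' + ereal \<rho> * w y' + ereal (blinfun_apply v y') + ereal (inverse \<alpha>) * w y'} = {u}"
    if \<alpha>: "0 < \<alpha>" for \<alpha> and v :: "'a \<Rightarrow>\<^sub>L real"
  proof -
    define \<beta> where "\<beta> = inverse (\<rho> + inverse \<alpha>)"
    have \<beta>: "0 < \<beta>" "inverse \<beta> = \<rho> + inverse \<alpha>" using \<alpha> assms(3) by (simp_all add: \<beta>_def add_pos_pos)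
    have eq: "\<phi> y + ereal \<rho> * w y + ereal (blinfun_apply v y) + ereal (inverse \<alpha>) * w y
      = \<phi> y + ereal (blinfun_apply v y) + ereal (inverse \<beta>) * w y" if y: "y \<in> U" for y
    proof -
      obtain a where a: "\<phi> y = ereal a" using \<phi>[OF y] by (cases "\<phi> y") auto
      obtain b where b: "w y = ereal b" using wfin[OF y] by (cases "w y") auto
      show ?thesis unfolding a b \<beta>(2) by (simp add: algebra_simps)
    qed
    have "{y \<in> U. \<forall>y'\<in>U. \<phi> y + ereal \<rho> * w y + ereal (blinfun_apply v y) + ereal (inverse \<alpha>) * w y
                       \<le> \<phi> y' + ereal \<rho> * w y' + ereal (blinfun_apply v y') + ereal (inverse \<alpha>) * w y'}
      = {y \<in> U. \<forall>y'\<in>U. \<phi> y + ereal (blinfun_apply v y) + ereal (inverse \<beta>) * w y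
                       \<le> \<phi> y' + ereal (blinfun_apply v y') + ereal (inverse \<beta>) * w y'}"
    proof (rule Collect_cong, rule conj_cong[OF refl], rule ball_cong[OF refl])
      fix y y' assume "y \<in> U" "y' \<in> U"
      then show "(\<phi> y + ereal \<rho> * w y + ereal (blinfun_apply v y) + ereal (inverse \<alpha>) * w y
                       \<le> \<phi> y' + ereal \<rho> * w y' + ereal (blinfun_apply v y') + ereal (inverse \<alpha>) * w y')
        = (\<phi> y + ereal (blinfun_apply v y) + ereal (inverse \<beta>) * w y
                       \<le> \<phi> y' + ereal (blinfun_apply v y') + ereal (inverse \<beta>) * w y')"
        by (simp only: eq)
    qed
    then show ?thesis using unique[OF \<beta>(1), of v] by (simp only:)
  qed
  note unique' = this
  have "\<forall>\<alpha>>0. \<forall>v :: 'a \<Rightarrow>\<^sub>L real. \<exists>u \<in> U \<inter> interior (edom w).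
        {y \<in> U. \<forall>y'\<in>U. \<phi> y + ereal \<rho> * w y + ereal (blinfun_apply v y) + ereal (inverse \<alpha>) * w y
                       \<le> \<phi> y' + ereal \<rho> * w y' + ereal (blinfun_apply v y') + ereal (inverse \<alpha>) * w y'} = {u}"
    by (intro allI impI) (rule unique')
  then show ?thesis using w unfolding dgf_def by (elim conjE) (intro conjI)
qed

section \<open>Draws from random distributions\<close>

lemma space_adjoin [simp]: "space (adjoin F Y) = space F"
  by (simp add: adjoin_def space_measure_of_conv)

lemma sets_adjoin:
  "sets (adjoin F Y) = sigma_sets (space F) (sets F \<union> {Y -` A \<inter> space F | A. A \<in> sets borel})"
  unfolding adjoin_def using sets.sets_into_space[of _ F] by (intro sets_measure_of) blast

lemma subalgebra_adjoin: "subalgebra (adjoin F Y) F"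
  by (auto simp: subalgebra_def sets_adjoin)

lemma measurable_adjoin [measurable]: "Y \<in> borel_measurable (adjoin F Y)"
  by (rule measurableI) (auto simp: sets_adjoin)

lemma subalgebra_adjoin_ambient:
  assumes "subalgebra M F" "Y \<in> borel_measurable M"
  shows "subalgebra M (adjoin F Y)"
proof -
  have sp: "space F = space M" and le: "sets F \<subseteq> sets M" using assms(1) by (auto simp: subalgebra_def)
  have "sigma_sets (space M) (sets F \<union> {Y -` A \<inter> space F | A. A \<in> sets borel}) \<subseteq> sets M"
    using le assms(2) by (intro sets.sigma_sets_subset) (auto simp: sp)
  then show ?thesis by (simp add: subalgebra_def sets_adjoin sp)
qed

text \<open>Nothing is known about the measurability of \<open>w \<mapsto> \<nu> w\<close>, only that the probabilities of Borel sets agree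
  almost everywhere with conditional expectations. The conclusion therefore speaks of a measurable
  function \<open>q\<close> that agrees with the integral almost everywhere; it is built up from indicators.\<close>

lemma draws_disintegration:
  fixes \<phi> :: "'u::topological_space \<Rightarrow> ennreal"
  assumes M: "prob_space M" and F: "subalgebra M F" and dr: "draws M F \<nu> Y"
    and \<nu>: "\<And>w. w \<in> space M \<Longrightarrow> prob_space (\<nu> w) \<and> sets (\<nu> w) = sets borel"
    and \<phi>: "\<phi> \<in> borel_measurable borel"
  shows "\<exists>q\<in>borel_measurable F. (AE w in M. q w = (\<integral>\<^sup>+u. \<phi> u \<partial>\<nu> w)) \<and>
    (\<forall>A\<in>sets F. (\<integral>\<^sup>+w\<in>A. \<phi> (Y w) \<partial>M) = (\<integral>\<^sup>+w\<in>A. q w \<partial>M))"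
proof -
  interpret prob_space M by (rule M)
  interpret finite_measure_subalgebra M F using F by unfold_locales
  have Y [measurable]: "Y \<in> borel_measurable M" using dr by (simp add: draws_def)
  have FM: "A \<in> sets M" if "A \<in> sets F" for A using F that by (auto simp: subalgebra_def)
  have FMm: "f \<in> borel_measurable M" if "f \<in> borel_measurable F" for f :: "_ \<Rightarrow> ennreal"
    using measurable_from_subalg[OF F that] .
  have \<nu>m: "f \<in> borel_measurable (\<nu> w)" if "f \<in> borel_measurable borel" "w \<in> space M" for f :: "_ \<Rightarrow> ennreal" and w
  proof -
    have "sets (\<nu> w) = sets borel" using \<nu>[OF that(2)] by blast
    from measurable_cong_sets[OF this refl] that(1) show ?thesis by blast
  qed
  show ?thesis using \<phi>
  proof (induction rule: borel_measurable_induct)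
    case (cong f g)
    then have "f = g" by auto
    with cong show ?case by simp
  next
    case (set A)
    let ?I = "indicator (Y -` A \<inter> space M) :: _ \<Rightarrow> real"
    define r where "r = real_cond_exp M F ?I"
    have I: "integrable M ?I" using set by (intro integrable_real_indicator) (auto simp: emeasure_eq_measure)
    have r: "AE w in M. r w = measure (\<nu> w) A" using dr set unfolding draws_def r_def by blast
    then have r0: "AE w in M. 0 \<le> r w" by eventually_elim simp
    have m2: "AE w in M. ennreal (r w) = (\<integral>\<^sup>+u. indicator A u \<partial>\<nu> w)"
      using r AE_space
    proof eventually_elim
      case (elim w)
      interpret n: prob_space "\<nu> w" using \<nu>[OF elim(2)] by blast
      have "A \<in> sets (\<nu> w)" using set \<nu>[OF elim(2)] by simp
      then show ?case by (simp add: n.emeasure_eq_measure elim(1))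
    qed
    have m3: "(\<integral>\<^sup>+w\<in>B. indicator A (Y w) \<partial>M) = (\<integral>\<^sup>+w\<in>B. ennreal (r w) \<partial>M)" if B: "B \<in> sets F" for B
    proof -
      have BM [measurable]: "B \<in> sets M" using FM B .
      have iB: "integrable M (\<lambda>w. indicator B w * ?I w)"
        using integrable_mult_indicator[OF BM I] by simp
      have Bm: "(indicator B :: _ \<Rightarrow> real) \<in> borel_measurable F" using B by simp
      note rr = real_cond_exp_intg[OF iB Bm borel_measurable_integrable[OF I], folded r_def]
      have "(\<integral>\<^sup>+w\<in>B. ennreal (r w) \<partial>M) = (\<integral>\<^sup>+w. ennreal (indicator B w * r w) \<partial>M)"
        by (intro nn_integral_cong) (auto split: split_indicator)
      also have "\<dots> = ennreal (\<integral>w. indicator B w * r w \<partial>M)"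
      proof (rule nn_integral_eq_integral[OF rr(1)])
        show "AE w in M. 0 \<le> indicator B w * r w" using r0 by eventually_elim simp
      qed
      also have "(\<integral>w. indicator B w * r w \<partial>M) = (\<integral>w. indicator B w * ?I w \<partial>M)"
        by (rule rr(2))
      also have "ennreal \<dots> = (\<integral>\<^sup>+w. ennreal (indicator B w * ?I w) \<partial>M)"
        by (rule nn_integral_eq_integral[OF iB, symmetric]) simp
      also have "\<dots> = (\<integral>\<^sup>+w\<in>B. indicator A (Y w) \<partial>M)"
        by (intro nn_integral_cong) (auto split: split_indicator)
      finally show ?thesis by simp
    qed
    have m1: "(\<lambda>w. ennreal (r w)) \<in> borel_measurable F" unfolding r_def by measurable
    show ?case by (intro bexI[where x = "\<lambda>w. ennreal (r w)"] conjI ballI m1 m2 m3)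
  next
    case (mult f c)
    then obtain q where q: "q \<in> borel_measurable F" "AE w in M. q w = (\<integral>\<^sup>+u. f u \<partial>\<nu> w)"
        "\<And>A. A \<in> sets F \<Longrightarrow> (\<integral>\<^sup>+w\<in>A. f (Y w) \<partial>M) = (\<integral>\<^sup>+w\<in>A. q w \<partial>M)" by blast
    note [measurable] = mult.hyps FMm[OF q(1)]
    have m2: "AE w in M. c * q w = (\<integral>\<^sup>+u. c * f u \<partial>\<nu> w)"
      using q(2) AE_space by eventually_elim (simp add: nn_integral_cmult \<nu>m mult.hyps)
    have m3: "(\<integral>\<^sup>+w\<in>A. c * f (Y w) \<partial>M) = (\<integral>\<^sup>+w\<in>A. c * q w \<partial>M)" if "A \<in> sets F" for A
      using q(3)[OF that] FM[OF that] by (simp add: mult.assoc nn_integral_cmult)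
    have m1: "(\<lambda>w. c * q w) \<in> borel_measurable F" using q(1) by measurable
    show ?case by (intro bexI[where x = "\<lambda>w. c * q w"] conjI ballI m1 m2 m3)
  next
    case (add f g)
    then obtain q q' where q: "q \<in> borel_measurable F" "AE w in M. q w = (\<integral>\<^sup>+u. f u \<partial>\<nu> w)"
        "\<And>A. A \<in> sets F \<Longrightarrow> (\<integral>\<^sup>+w\<in>A. f (Y w) \<partial>M) = (\<integral>\<^sup>+w\<in>A. q w \<partial>M)"
      and q': "q' \<in> borel_measurable F" "AE w in M. q' w = (\<integral>\<^sup>+u. g u \<partial>\<nu> w)"
        "\<And>A. A \<in> sets F \<Longrightarrow> (\<integral>\<^sup>+w\<in>A. g (Y w) \<partial>M) = (\<integral>\<^sup>+w\<in>A. q' w \<partial>M)" by blast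
    note [measurable] = add.hyps FMm[OF q(1)] FMm[OF q'(1)]
    have m2: "AE w in M. q' w + q w = (\<integral>\<^sup>+u. g u + f u \<partial>\<nu> w)"
      using q(2) q'(2) AE_space by eventually_elim (simp add: nn_integral_add \<nu>m add.hyps)
    have m3: "(\<integral>\<^sup>+w\<in>A. (g (Y w) + f (Y w)) \<partial>M) = (\<integral>\<^sup>+w\<in>A. (q' w + q w) \<partial>M)" if "A \<in> sets F" for A
      using q(3)[OF that] q'(3)[OF that] FM[OF that] by (simp add: distrib_right nn_integral_add)
    have m1: "(\<lambda>w. q' w + q w) \<in> borel_measurable F" using q(1) q'(1) by measurable
    show ?case by (intro bexI[where x = "\<lambda>w. q' w + q w"] conjI ballI m1 m2 m3)
  next
    case (seq f)
    let ?P = "\<lambda>i q. q \<in> borel_measurable F \<and> (AE w in M. q w = (\<integral>\<^sup>+u. f i u \<partial>\<nu> w)) \<and>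
        (\<forall>A\<in>sets F. (\<integral>\<^sup>+w\<in>A. f i (Y w) \<partial>M) = (\<integral>\<^sup>+w\<in>A. q w \<partial>M))"
    have "\<exists>q. ?P i q" for i using seq.IH[of i] unfolding Bex_def .
    then have "\<exists>q. \<forall>i. ?P i (q i)" by (intro choice allI)
    then obtain q where qP: "\<And>i. ?P i (q i)" by blast
    have q: "q i \<in> borel_measurable F" "AE w in M. q i w = (\<integral>\<^sup>+u. f i u \<partial>\<nu> w)" for i
      using qP[of i] by simp_all
    have q3: "(\<integral>\<^sup>+w\<in>A. f i (Y w) \<partial>M) = (\<integral>\<^sup>+w\<in>A. q i w \<partial>M)" if "A \<in> sets F" for i A
      using qP[of i] that by simp
    note [measurable] = seq.hyps(1) FMm[OF q(1)]
    have qa: "AE w in M. \<forall>i. q i w = (\<integral>\<^sup>+u. f i u \<partial>\<nu> w)"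
      unfolding AE_all_countable using q(2) by (rule allI)
    have inc: "f i u \<le> f (Suc i) u" for i u using seq.hyps(3) by (rule incseq_SucD[THEN le_funD])
    have incq: "AE w in M. q i w \<le> q (Suc i) w" for i
      using q(2)[of i] q(2)[of "Suc i"]
    proof eventually_elim
      case (elim w)
      show ?case unfolding elim by (rule nn_integral_mono) (rule inc)
    qed
    have SupR: "Sup (range f) u = (SUP i. f i u)" for u
      by (simp add: image_image)
    have m2: "AE w in M. (SUP i. q i w) = (\<integral>\<^sup>+u. Sup (range f) u \<partial>\<nu> w)"
      using qa AE_space
    proof eventually_elim
      case (elim w)
      have "(SUP i. q i w) = (SUP i. \<integral>\<^sup>+u. f i u \<partial>\<nu> w)" by (simp only: elim(1))
      also have "\<dots> = (\<integral>\<^sup>+u. (SUP i. f i u) \<partial>\<nu> w)"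
        by (rule nn_integral_monotone_convergence_SUP[symmetric]) (rule seq.hyps, rule \<nu>m, rule seq.hyps, rule elim)
      finally show ?case by (simp only: SupR)
    qed
    have m3: "(\<integral>\<^sup>+w\<in>A. Sup (range f) (Y w) \<partial>M) = (\<integral>\<^sup>+w\<in>A. (SUP i. q i w) \<partial>M)" if A: "A \<in> sets F" for A
    proof -
      note [measurable] = FM[OF A]
      have "(\<integral>\<^sup>+w\<in>A. Sup (range f) (Y w) \<partial>M) = (\<integral>\<^sup>+w. (SUP i. f i (Y w) * indicator A w) \<partial>M)"
        by (simp only: SupR SUP_mult_right_ennreal)
      also have "\<dots> = (SUP i. \<integral>\<^sup>+w\<in>A. f i (Y w) \<partial>M)"
      proof (rule nn_integral_monotone_convergence_SUP)
        show "incseq (\<lambda>i w. f i (Y w) * indicator A w)"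
          by (intro incseq_SucI le_funI mult_right_mono inc) simp
      qed measurable
      also have "\<dots> = (SUP i. \<integral>\<^sup>+w\<in>A. q i w \<partial>M)" by (simp only: q3[OF A])
      also have "\<dots> = (\<integral>\<^sup>+w. (SUP i. q i w * indicator A w) \<partial>M)"
      proof (rule nn_integral_monotone_convergence_SUP_AE[symmetric])
        show "AE w in M. q i w * indicator A w \<le> q (Suc i) w * indicator A w" for i
          using incq[of i] by eventually_elim (intro mult_right_mono, auto)
      qed measurable
      finally show ?thesis by (simp only: SUP_mult_right_ennreal)
    qed
    have m1: "(\<lambda>w. SUP i. q i w) \<in> borel_measurable F" using q(1) by measurable
    show ?case by (intro bexI[where x = "\<lambda>w. SUP i. q i w"] conjI ballI m1 m2 m3)
  qed
qed

text \<open>The inequality between integrals, taken over the event on which the conditional expectation exceeds \<open>e\<close>,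
  shows that this event is a null set.\<close>

lemma nn_cond_exp_le_const:
  assumes M: "prob_space M" and F: "subalgebra M F"
    and le: "\<And>A. A \<in> sets F \<Longrightarrow> (\<integral>\<^sup>+w\<in>A. f w \<partial>M) \<le> ennreal e * emeasure M A"
    and f: "f \<in> borel_measurable M"
  shows "AE w in M. nn_cond_exp M F f w \<le> ennreal e"
proof -
  interpret prob_space M by (rule M)
  interpret finite_measure_subalgebra M F using F by unfold_locales
  let ?g = "nn_cond_exp M F f"
  define A where "A = {w \<in> space F. ennreal e < ?g w}"
  have A: "A \<in> sets F" unfolding A_def by measurable
  have AM [measurable]: "A \<in> sets M" using A F unfolding subalgebra_def by blast
  have [measurable]: "?g \<in> borel_measurable M" by (rule borel_measurable_nn_cond_exp2)
  have "(\<integral>\<^sup>+w. indicator A w * ?g w \<partial>M) = (\<integral>\<^sup>+w. indicator A w * f w \<partial>M)"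
    using A by (intro nn_cond_exp_intg f) simp
  then have "(\<integral>\<^sup>+w\<in>A. ?g w \<partial>M) = (\<integral>\<^sup>+w\<in>A. f w \<partial>M)" by (simp only: mult.commute)
  also have "\<dots> \<le> ennreal e * emeasure M A" by (rule le[OF A])
  also have "\<dots> = (\<integral>\<^sup>+w\<in>A. ennreal e \<partial>M)" by (rule nn_integral_cmult_indicator[OF AM, symmetric])
  finally have le': "(\<integral>\<^sup>+w\<in>A. ?g w \<partial>M) \<le> (\<integral>\<^sup>+w\<in>A. ennreal e \<partial>M)" .
  have fin: "(\<integral>\<^sup>+w\<in>A. ennreal e \<partial>M) \<noteq> \<infinity>"
    unfolding nn_integral_cmult_indicator[OF AM] by (simp add: emeasure_eq_measure ennreal_mult_eq_top_iff)
  have "(\<integral>\<^sup>+w. ?g w * indicator A w - ennreal e * indicator A w \<partial>M)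
      = (\<integral>\<^sup>+w\<in>A. ?g w \<partial>M) - (\<integral>\<^sup>+w\<in>A. ennreal e \<partial>M)"
  proof (rule nn_integral_diff[OF _ _ fin])
    show "AE w in M. ennreal e * indicator A w \<le> ?g w * indicator A w"
      by (rule AE_I2) (auto simp: A_def less_imp_le split: split_indicator)
  qed measurable
  also have "\<dots> = 0" using le' fin by (intro diff_eq_0_ennreal) (simp_all add: le_less_trans less_top)
  finally have "AE w in M. ?g w * indicator A w - ennreal e * indicator A w = 0"
    by (subst (asm) nn_integral_0_iff_AE) measurable
  then show ?thesis using AE_space
  proof eventually_elim
    case (elim w)
    show ?case
    proof (rule ccontr)
      assume "\<not> ?thesis"
      then have lt: "ennreal e < ?g w" by simp
      then have "w \<in> A" using elim(2) F by (simp add: A_def subalgebra_def)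
      then have "?g w - ennreal e = 0" using elim(1) by simp
      then have "?g w \<le> ennreal e" by (rule ennreal_minus_eq_0)
      then show False using lt by simp
    qed
  qed
qed

text \<open>The parameter \<open>X\<close> is known given the past, but it varies with the outcome, while
  \<open>draws_disintegration\<close> handles a fixed integrand. On an event where \<open>X\<close> stays within \<open>\<delta>\<close> of some \<open>c\<close>,
  replacing \<open>X\<close> by \<open>c\<close>, averaging over the draw and going back to \<open>X\<close> costs at most \<open>2 * C * \<delta>\<close>. By
  compactness finitely many such events suffice, and \<open>\<delta>\<close> is arbitrary. The function \<open>f\<close> may
  differ from the error off the sample space, where the iterates need not be feasible.\<close>

lemma draws_expected_error:
  fixes X :: "'w \<Rightarrow> 'x::{metric_space, second_countable_topology}" and Y :: "'w \<Rightarrow> 'u::topological_space"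
    and H :: "'x \<Rightarrow> 'u \<Rightarrow> real"
  assumes M: "prob_space M" and F: "subalgebra M F" and dr: "draws M F \<nu> Y"
    and X: "X \<in> borel_measurable F" "\<And>w. w \<in> space M \<Longrightarrow> X w \<in> K" and K: "compact K"
    and U: "U \<in> sets borel" "\<And>w. w \<in> space M \<Longrightarrow> Y w \<in> U"
    and \<nu>: "\<And>w. w \<in> space M \<Longrightarrow> prob_space (\<nu> w) \<and> sets (\<nu> w) = sets borel \<and> emeasure (\<nu> w) U = 1"
    and H: "\<And>x. x \<in> K \<Longrightarrow> (\<lambda>u. indicator U u * H x u) \<in> borel_measurable borel"
      "\<And>x u. x \<in> K \<Longrightarrow> u \<in> U \<Longrightarrow> 0 \<le> H x u"
    and lip: "\<And>x x' u. x \<in> K \<Longrightarrow> x' \<in> K \<Longrightarrow> u \<in> U \<Longrightarrow> H x u \<le> H x' u + C * dist x x'" and "0 \<le> C"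
    and le: "\<And>w. w \<in> space M \<Longrightarrow> (\<integral>\<^sup>+u. ennreal (H (X w) u) \<partial>\<nu> w) \<le> ennreal e" and "0 \<le> e"
    and meas: "(\<lambda>w. H (X w) (Y w)) \<in> borel_measurable M"
    and f: "\<And>w. w \<in> space M \<Longrightarrow> f w = ennreal (H (X w) (Y w))"
  shows "f \<in> borel_measurable M" "AE w in M. nn_cond_exp M F f w \<le> ennreal e" "(\<integral>\<^sup>+w. f w \<partial>M) \<le> ennreal e"
proof -
  have meas': "(\<lambda>w. ennreal (H (X w) (Y w))) \<in> borel_measurable M" using meas by measurable
  then show fm: "f \<in> borel_measurable M" using measurable_cong[of M f "\<lambda>w. ennreal (H (X w) (Y w))"] f by simp
  interpret prob_space M by (rule M)
  have FM: "A \<in> sets M" if "A \<in> sets F" for A using F that by (auto simp: subalgebra_def)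
  have sp: "space F = space M" using F by (simp add: subalgebra_def)
  have FMm: "f \<in> borel_measurable M" if "f \<in> borel_measurable F" for f :: "_ \<Rightarrow> ennreal"
    using measurable_from_subalg[OF F that] .
  note [measurable] = meas'
  have piece: "(\<integral>\<^sup>+w\<in>A. ennreal (H (X w) (Y w)) \<partial>M) \<le> ennreal (e + 2 * C * \<delta>) * emeasure M A"
    if A: "A \<in> sets F" and c: "c \<in> K" and near: "\<And>w. w \<in> A \<Longrightarrow> dist c (X w) < \<delta>" and "0 < \<delta>" for A c \<delta>
  proof -
    have C\<delta>: "C * dist c (X w) \<le> C * \<delta>" if "w \<in> A" for w
      using near[OF that] \<open>0 \<le> C\<close> by (intro mult_left_mono) auto
    have AM [measurable]: "A \<in> sets M" using FM A .
    define \<phi> where "\<phi> u = ennreal (indicator U u * H c u + C * \<delta>)" for u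
    have \<phi>: "\<phi> \<in> borel_measurable borel" unfolding \<phi>_def using H(1)[OF c] by measurable
    have \<nu>': "prob_space (\<nu> w) \<and> sets (\<nu> w) = sets borel" if "w \<in> space M" for w
      using \<nu>[OF that] by simp
    obtain q where "q \<in> borel_measurable F" and
        qq: "(AE w in M. q w = (\<integral>\<^sup>+u. \<phi> u \<partial>\<nu> w)) \<and>
          (\<forall>A\<in>sets F. (\<integral>\<^sup>+w\<in>A. \<phi> (Y w) \<partial>M) = (\<integral>\<^sup>+w\<in>A. q w \<partial>M))"
      using draws_disintegration[OF M F dr \<nu>' \<phi>] by (rule bexE)
    note q2 = qq[THEN conjunct1] and q3 = qq[THEN conjunct2, THEN bspec]
    have "(\<integral>\<^sup>+w\<in>A. ennreal (H (X w) (Y w)) \<partial>M) \<le> (\<integral>\<^sup>+w\<in>A. \<phi> (Y w) \<partial>M)"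
    proof (intro nn_integral_mono)
      fix w assume w: "w \<in> space M"
      show "ennreal (H (X w) (Y w)) * indicator A w \<le> \<phi> (Y w) * indicator A w"
      proof (cases "w \<in> A")
        case True
        have "H (X w) (Y w) \<le> H c (Y w) + C * dist (X w) c" by (intro lip X(2) U(2) w c)
        also have "\<dots> \<le> H c (Y w) + C * \<delta>" using C\<delta>[OF True] by (simp add: dist_commute)
        finally show ?thesis using True U(2)[OF w] by (simp add: \<phi>_def ennreal_leI)
      qed simp
    qed
    also have "\<dots> = (\<integral>\<^sup>+w\<in>A. q w \<partial>M)" by (rule q3[OF A])
    also have "\<dots> \<le> (\<integral>\<^sup>+w\<in>A. ennreal (e + 2 * C * \<delta>) \<partial>M)"
    proof (rule nn_integral_mono_AE, use q2 AE_space in eventually_elim)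
      case (elim w)
      show ?case
      proof (cases "w \<in> A")
        case True
        note nw = \<nu>[OF elim(2)]
        interpret n: prob_space "\<nu> w" by (rule conjunct1[OF nw])
        have sn: "sets (\<nu> w) = sets borel" using nw by simp
        have Un: "U \<in> n.events" unfolding sn by (rule U(1))
        have "n.prob U = 1" using nw by (simp add: measure_def)
        then have AU: "AE u in \<nu> w. u \<in> U" unfolding n.prob_eq_1[OF Un] .
        let ?h = "\<lambda>u. ennreal (indicator U u * H (X w) u)"
        have hm: "?h \<in> borel_measurable (\<nu> w)"
        proof -
          have [measurable]: "(\<lambda>u. indicator U u * H (X w) u) \<in> borel_measurable borel"
            by (rule H(1)[OF X(2)[OF elim(2)]])
          have "?h \<in> borel_measurable borel" by measurable
          then show ?thesis unfolding measurable_cong_sets[OF sn refl] .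
        qed
        have "q w \<le> (\<integral>\<^sup>+u. ?h u + ennreal (2 * C * \<delta>) \<partial>\<nu> w)"
          unfolding elim(1)
        proof (rule nn_integral_mono_AE, use AU in eventually_elim)
          case u: (elim u)
          have "H c u \<le> H (X w) u + C * dist c (X w)" by (intro lip X(2) elim c u)
          also have "\<dots> \<le> H (X w) u + C * \<delta>" using C\<delta>[OF True] by simp
          finally have "H c u + C * \<delta> \<le> H (X w) u + 2 * C * \<delta>" by simp
          then show ?case using u H(2)[OF X(2)[OF elim(2)] u] \<open>0 \<le> C\<close> \<open>0 < \<delta>\<close>
            by (simp add: \<phi>_def ennreal_leI flip: ennreal_plus)
        qed
        also have "\<dots> = (\<integral>\<^sup>+u. ?h u \<partial>\<nu> w) + ennreal (2 * C * \<delta>)"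
          using hm by (simp add: nn_integral_add n.emeasure_space_1)
        also have "(\<integral>\<^sup>+u. ?h u \<partial>\<nu> w) = (\<integral>\<^sup>+u. ennreal (H (X w) u) \<partial>\<nu> w)"
        proof (rule nn_integral_cong_AE, use AU in eventually_elim)
          case u: (elim u)
          then show ?case by simp
        qed
        also have "\<dots> + ennreal (2 * C * \<delta>) \<le> ennreal e + ennreal (2 * C * \<delta>)"
          by (intro add_right_mono le elim)
        also have "\<dots> = ennreal (e + 2 * C * \<delta>)" using \<open>0 \<le> C\<close> \<open>0 < \<delta>\<close> \<open>0 \<le> e\<close> by (simp flip: ennreal_plus)
        finally show ?thesis using True by simp
      qed simp
    qed
    finally show ?thesis by (simp add: nn_integral_cmult_indicator)
  qed
  have step: "(\<integral>\<^sup>+w\<in>A. ennreal (H (X w) (Y w)) \<partial>M) \<le> ennreal (e + 2 * C * \<delta>) * emeasure M A"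
    if "finite N" "N \<subseteq> K" "A \<in> sets F" "\<And>w. w \<in> A \<Longrightarrow> X w \<in> (\<Union>x\<in>N. ball x \<delta>)" "0 < \<delta>" for N A \<delta>
    using that
  proof (induction N arbitrary: A rule: finite_induct)
    case empty
    then have "A = {}" by auto
    then show ?case by simp
  next
    case (insert c N)
    let ?A1 = "A \<inter> (X -` ball c \<delta> \<inter> space F)" and ?A2 = "A - (X -` ball c \<delta> \<inter> space F)"
    let ?t = "ennreal (e + 2 * C * \<delta>)" and ?h = "\<lambda>w. ennreal (H (X w) (Y w))"
    have "X -` ball c \<delta> \<inter> space F \<in> sets F" using X(1) by measurable
    then have S: "?A1 \<in> sets F" "?A2 \<in> sets F" using insert.prems by auto
    note [measurable] = FM[OF S(1)] FM[OF S(2)]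
    have spl: "?A1 \<union> ?A2 = A" "?A1 \<inter> ?A2 = {}" by auto
    have "(\<integral>\<^sup>+w\<in>A. ?h w \<partial>M) = (\<integral>\<^sup>+w. ?h w * indicator ?A1 w + ?h w * indicator ?A2 w \<partial>M)"
      by (intro nn_integral_cong) (auto split: split_indicator)
    also have "\<dots> = (\<integral>\<^sup>+w\<in>?A1. ?h w \<partial>M) + (\<integral>\<^sup>+w\<in>?A2. ?h w \<partial>M)"
      by (intro nn_integral_add) auto
    also have "\<dots> \<le> ?t * emeasure M ?A1 + ?t * emeasure M ?A2"
    proof (rule add_mono)
      show "(\<integral>\<^sup>+w\<in>?A1. ?h w \<partial>M) \<le> ?t * emeasure M ?A1"
        using insert.prems by (intro piece[of _ c] S) auto
      show "(\<integral>\<^sup>+w\<in>?A2. ?h w \<partial>M) \<le> ?t * emeasure M ?A2"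
      proof (rule insert.IH)
        show "X w \<in> (\<Union>x\<in>N. ball x \<delta>)" if "w \<in> ?A2" for w
        proof -
          have "w \<in> space F" using that insert.prems(2) sets.sets_into_space by blast
          then show ?thesis using that insert.prems(3)[of w] by auto
        qed
      qed (use insert.prems S in auto)
    qed
    also have "\<dots> = ?t * (emeasure M ?A1 + emeasure M ?A2)" by (simp add: distrib_left)
    also have "emeasure M ?A1 + emeasure M ?A2 = emeasure M A"
      by (rule plus_emeasure[OF FM[OF S(1)] FM[OF S(2)] spl(2), unfolded spl(1)])
    finally show ?case .
  qed
  have all: "(\<integral>\<^sup>+w\<in>A. ennreal (H (X w) (Y w)) \<partial>M) \<le> ennreal (e + 2 * C * \<delta>) * emeasure M A" if "0 < \<delta>" and A: "A \<in> sets F" for \<delta> A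
  proof -
    obtain N where "finite N" "N \<subseteq> K" "K \<subseteq> (\<Union>x\<in>N. ball x \<delta>)"
      using seq_compact_imp_totally_bounded[OF compact_imp_seq_compact[OF K], rule_format, OF \<open>0 < \<delta>\<close>] by blast
    moreover have "X w \<in> K" if "w \<in> A" for w
      using X(2) sets.sets_into_space[OF A] that unfolding sp by blast
    ultimately show ?thesis using that A by (intro step[of N]) blast+
  qed
  have bound: "(\<integral>\<^sup>+w\<in>A. ennreal (H (X w) (Y w)) \<partial>M) \<le> ennreal e * emeasure M A" if "A \<in> sets F" for A
  proof (rule ennreal_le_epsilon)
    fix \<eta> :: real assume "0 < \<eta>"
    \<comment> \<open>the summand 1 allows for \<open>C = 0\<close>\<close>
    define \<delta> where "\<delta> = \<eta> / (2 * C + 1)"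
    have "0 < \<delta>" using \<open>0 < \<eta>\<close> \<open>0 \<le> C\<close> by (simp add: \<delta>_def)
    have "2 * C * \<delta> \<le> (2 * C + 1) * \<delta>" using \<open>0 < \<delta>\<close> by (simp add: algebra_simps)
    also have "\<dots> = \<eta>" using \<open>0 \<le> C\<close> by (simp add: \<delta>_def)
    finally have le\<eta>: "2 * C * \<delta> \<le> \<eta>" .
    have "(\<integral>\<^sup>+w\<in>A. ennreal (H (X w) (Y w)) \<partial>M) \<le> ennreal (e + 2 * C * \<delta>) * emeasure M A"
      by (rule all[OF \<open>0 < \<delta>\<close> that])
    also have "\<dots> \<le> (ennreal e + ennreal \<eta>) * emeasure M A"
      using le\<eta> \<open>0 \<le> e\<close> \<open>0 < \<eta>\<close> by (intro mult_right_mono) (simp_all add: ennreal_leI flip: ennreal_plus)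
    also have "\<dots> = ennreal e * emeasure M A + ennreal \<eta> * emeasure M A" by (rule distrib_right)
    also have "\<dots> \<le> ennreal e * emeasure M A + ennreal \<eta> * 1"
      by (intro add_left_mono mult_left_mono emeasure_le_1) simp
    finally show "(\<integral>\<^sup>+w\<in>A. ennreal (H (X w) (Y w)) \<partial>M) \<le> ennreal e * emeasure M A + ennreal \<eta>" by simp
  qed
  have int: "(\<integral>\<^sup>+w\<in>A. f w \<partial>M) \<le> ennreal e * emeasure M A" if "A \<in> sets F" for A
  proof -
    have "(\<integral>\<^sup>+w\<in>A. f w \<partial>M) = (\<integral>\<^sup>+w\<in>A. ennreal (H (X w) (Y w)) \<partial>M)"
      by (rule nn_integral_cong) (simp add: f)
    also have "\<dots> \<le> ennreal e * emeasure M A"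
      by (rule bound[OF that])
    finally show ?thesis .
  qed
  show "AE w in M. nn_cond_exp M F f w \<le> ennreal e" by (rule nn_cond_exp_le_const[OF M F int fm])
  have "space M \<in> sets F" using F sets.top[of F] by (simp add: subalgebra_def)
  from int[OF this] have "(\<integral>\<^sup>+w\<in>space M. f w \<partial>M) \<le> ennreal e" by (simp add: prob_space.emeasure_space_1[OF M])
  also have "(\<integral>\<^sup>+w\<in>space M. f w \<partial>M) = (\<integral>\<^sup>+w. f w \<partial>M)" by (rule nn_integral_cong) simp
  finally show "(\<integral>\<^sup>+w. f w \<partial>M) \<le> ennreal e" .
qed

lemma measurable_continuous_on_comp:
  fixes g :: "'x::topological_space \<Rightarrow> real"
  assumes "continuous_on K g" "K \<in> sets borel" "X \<in> borel_measurable M" "\<And>w. w \<in> space M \<Longrightarrow> X w \<in> K"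
  shows "(\<lambda>w. g (X w)) \<in> borel_measurable M"
proof -
  have "(\<lambda>x. indicator K x *\<^sub>R g x) \<in> borel_measurable borel"
    by (rule borel_measurable_continuous_on_indicator[OF assms(2,1)])
  from measurable_compose[OF assms(3) this] have "(\<lambda>w. indicator K (X w) *\<^sub>R g (X w)) \<in> borel_measurable M" .
  moreover have "indicator K (X w) *\<^sub>R g (X w) = g (X w)" if "w \<in> space M" for w using assms(4)[OF that] by simp
  ultimately show ?thesis using measurable_cong[of M "\<lambda>w. indicator K (X w) *\<^sub>R g (X w)" "\<lambda>w. g (X w)"] by simp
qed

section \<open>The saddle function and its partial optima\<close>

text \<open>On the feasible sets all functions of the problem are finite. The locale develops their real-valued
  versions, which are then used in place of the extended real ones.\<close>

locale saddle_problem =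
  fixes P :: "('a::fin_dim_normed, 'b::fin_dim_normed) saddle"
  assumes ok: "saddle_ok P" and dual_bounded: "bounded (LL P)" and L_D_pos: "L_D P > 0"
begin

abbreviation "fr \<equiv> rpart (ff P)"
abbreviation "gr \<equiv> rpart (gg P)"
abbreviation "hr \<equiv> rpart (hh P)"
abbreviation "wr \<equiv> rpart (om P)"

lemma X_facts: "XX P \<noteq> {}" "closed (XX P)" "convex (XX P)" "bounded (XX P)"
  and L_facts: "LL P \<noteq> {}" "closed (LL P)" "convex (LL P)"
  and ccp: "closed_convex_proper (ff P)" "closed_convex_proper (gg P)" "closed_convex_proper (hh P)"
  and dom: "XX P \<subseteq> edom (gg P)" "LL P \<subseteq> edom (hh P)"
  and const_facts: "L_f P \<ge> mu P" "mu P > 0" "nn P \<ge> 1" "L_xx P \<ge> 0" "L_lx P \<ge> 0" "L_ll P \<ge> 0"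
  and dgfs: "dgf (om P) (hh P) (LL P)" "dgf (om_bar P) (gg P) (XX P)"
  by (simp_all only: ok[unfolded saddle_ok_def] simp_thms)

lemma f_open_domain:
  "\<exists>V. open V \<and> XX P \<subseteq> V \<and> V \<subseteq> edom (ff P) \<and> (\<forall>x\<in>V. fr differentiable (at x))"
  using ok unfolding saddle_ok_def by argo

lemma f_bregman_ball:
  "\<forall>x\<in>XX P. \<forall>x'\<in>XX P. mu P / 2 * (norm (x - x'))\<^sup>2 \<le> bregman fr x x' \<and>
        bregman fr x x' \<le> L_f P / 2 * (norm (x - x'))\<^sup>2"
  using ok unfolding saddle_ok_def by argo

lemma Phi_i_ball:
  "\<forall>i\<in>{1..nn P}.
        (\<forall>l. convex_on UNIV (\<lambda>x. Phi_i P i x l)) \<and> (\<forall>x. concave_on UNIV (Phi_i P i x)) \<and>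
        (\<forall>x\<in>XX P. \<forall>l\<in>LL P. (\<lambda>y. Phi_i P i y l) differentiable (at x) \<and>
           Phi_i P i x differentiable (at l)) \<and>
        (\<exists>C. C-lipschitz_on (XX P \<times> LL P) (\<lambda>(x, l). grad_x (Phi_i P i) x l)) \<and>
        (\<exists>C. C-lipschitz_on (XX P \<times> LL P) (\<lambda>(x, l). grad_l (Phi_i P i) x l))"
  using ok unfolding saddle_ok_def by argo

lemma Phi_lip_ball:
  "\<forall>x\<in>XX P. \<forall>x'\<in>XX P. \<forall>l\<in>LL P. \<forall>l'\<in>LL P.
        norm (grad_x (Phi P) x l - grad_x (Phi P) x' l) \<le> L_xx P * norm (x - x') \<and>
        norm (grad_x (Phi P) x l - grad_x (Phi P) x l') \<le> L_lx P * norm (l - l') \<and>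
        norm (grad_l (Phi P) x l - grad_l (Phi P) x' l) \<le> L_lx P * norm (x - x') \<and>
        norm (grad_l (Phi P) x l - grad_l (Phi P) x l') \<le> L_ll P * norm (l - l')"
  using ok unfolding saddle_ok_def by argo

lemma compact_X: "compact (XX P)" and compact_L: "compact (LL P)"
  using X_facts L_facts dual_bounded by (simp_all add: compact_eq_bounded_closed)

lemma X_dom_f: "XX P \<subseteq> edom (ff P)"
  and f_diff: "x \<in> XX P \<Longrightarrow> fr differentiable (at x)"
  using f_open_domain by blast+

lemma f_bregman:
  assumes "x \<in> XX P" "x' \<in> XX P"
  shows "mu P / 2 * (norm (x - x'))\<^sup>2 \<le> bregman fr x x'"
    "bregman fr x x' \<le> L_f P / 2 * (norm (x - x'))\<^sup>2"
  using f_bregman_ball assms by blast+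

lemma Phi_grad_lipschitz:
  assumes "x \<in> XX P" "x' \<in> XX P" "l \<in> LL P" "l' \<in> LL P"
  shows "norm (grad_x (Phi P) x l - grad_x (Phi P) x' l) \<le> L_xx P * norm (x - x')"
    "norm (grad_x (Phi P) x l - grad_x (Phi P) x l') \<le> L_lx P * norm (l - l')"
    "norm (grad_l (Phi P) x l - grad_l (Phi P) x' l) \<le> L_lx P * norm (x - x')"
    "norm (grad_l (Phi P) x l - grad_l (Phi P) x l') \<le> L_ll P * norm (l - l')"
  using Phi_lip_ball assms by blast+

lemma Phi_i_facts:
  assumes "i \<in> {1..nn P}"
  shows "convex_on UNIV (\<lambda>x. Phi_i P i x l)" "convex_on UNIV (\<lambda>l. - Phi_i P i x l)"
    "x \<in> XX P \<Longrightarrow> l \<in> LL P \<Longrightarrow> (\<lambda>y. Phi_i P i y l) differentiable (at x)"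
    "x \<in> XX P \<Longrightarrow> l \<in> LL P \<Longrightarrow> Phi_i P i x differentiable (at l)"
    "\<exists>C. C-lipschitz_on (XX P \<times> LL P) (\<lambda>(x, l). grad_x (Phi_i P i) x l)"
    "\<exists>C. C-lipschitz_on (XX P \<times> LL P) (\<lambda>(x, l). grad_l (Phi_i P i) x l)"
proof -
  note * = bspec[OF Phi_i_ball assms]
  show "convex_on UNIV (\<lambda>x. Phi_i P i x l)" by (rule spec[OF conjunct1[OF *]])
  have "concave_on UNIV (Phi_i P i x)" by (rule spec[OF conjunct1[OF conjunct2[OF *]]])
  then show "convex_on UNIV (\<lambda>l. - Phi_i P i x l)" by (simp add: concave_on_def)
  show "\<exists>C. C-lipschitz_on (XX P \<times> LL P) (\<lambda>(x, l). grad_x (Phi_i P i) x l)"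
    "\<exists>C. C-lipschitz_on (XX P \<times> LL P) (\<lambda>(x, l). grad_l (Phi_i P i) x l)"
    by (rule *[THEN conjunct2, THEN conjunct2, THEN conjunct2, THEN conjunct1],
        rule *[THEN conjunct2, THEN conjunct2, THEN conjunct2, THEN conjunct2])
  assume xl: "x \<in> XX P" "l \<in> LL P"
  have "\<forall>x\<in>XX P. \<forall>l\<in>LL P. (\<lambda>y. Phi_i P i y l) differentiable (at x) \<and>
           Phi_i P i x differentiable (at l)" by (rule *[THEN conjunct2, THEN conjunct2, THEN conjunct1])
  note ** = bspec[OF bspec[OF this xl(1)] xl(2)]
  show "(\<lambda>y. Phi_i P i y l) differentiable (at x)" by (rule conjunct1[OF **])
  show "Phi_i P i x differentiable (at l)" by (rule conjunct2[OF **])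
qed

lemma Phi_facts:
  shows "convex_on UNIV (\<lambda>x. Phi P x l)" "convex_on UNIV (\<lambda>l. - Phi P x l)"
    "x \<in> XX P \<Longrightarrow> l \<in> LL P \<Longrightarrow> (\<lambda>y. Phi P y l) differentiable (at x)"
    "x \<in> XX P \<Longrightarrow> l \<in> LL P \<Longrightarrow> Phi P x differentiable (at l)"
proof -
  show "convex_on UNIV (\<lambda>x. Phi P x l)"
    unfolding Phi_def by (intro convex_on_cmul convex_on_sum_functions Phi_i_facts) auto
  have "- Phi P x l = 1 / real (nn P) * (\<Sum>i=1..nn P. - Phi_i P i x l)" for l
    by (simp add: Phi_def sum_negf)
  then show "convex_on UNIV (\<lambda>l. - Phi P x l)"
    by (simp only:) (intro convex_on_cmul convex_on_sum_functions Phi_i_facts, auto)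
  assume xl: "x \<in> XX P" "l \<in> LL P"
  show "(\<lambda>y. Phi P y l) differentiable (at x)"
    unfolding Phi_def by (intro differentiable_mult differentiable_const differentiable_sum ballI Phi_i_facts xl) auto
  have "(\<lambda>l. 1 / real (nn P) * (\<Sum>i=1..nn P. Phi_i P i x l)) differentiable (at l)"
    by (intro differentiable_mult differentiable_const differentiable_sum ballI Phi_i_facts xl) auto
  then show "Phi P x differentiable (at l)" by (simp add: Phi_def[abs_def])
qed

lemma w_facts:
  shows "closed_convex_proper (om P)" "LL P \<subseteq> edom (om P)" "strongly_convex_on (LL P) 1 wr"
    "continuous_on (LL P) wr"
  using dgfs(1) unfolding dgf_def by (simp_all only: simp_thms)

definition Sr :: "'a \<Rightarrow> 'b \<Rightarrow> real" where
  "Sr x l = fr x + gr x + Phi P x l - hr l"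

lemma ereal_values:
  shows "x \<in> XX P \<Longrightarrow> ff P x = ereal (fr x)" "x \<in> XX P \<Longrightarrow> gg P x = ereal (gr x)"
    "l \<in> LL P \<Longrightarrow> hh P l = ereal (hr l)" "l \<in> LL P \<Longrightarrow> om P l = ereal (wr l)"
  using ereal_rpart ccp w_facts(1,2) dom X_dom_f by blast+

lemma SS_eq: "x \<in> XX P \<Longrightarrow> l \<in> LL P \<Longrightarrow> SS P x l = ereal (Sr x l)"
  using ereal_values(1,2)[of x] ereal_values(3)[of l]
  by (metis SS_def Sr_def plus_ereal.simps(1) minus_ereal_def ereal_minus(1))

lemma SS_rho_eq: "x \<in> XX P \<Longrightarrow> l \<in> LL P \<Longrightarrow> SS_rho P \<rho> x l = ereal (Sr x l - \<rho> * wr l)"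
  unfolding SS_rho_def SS_eq by (subst ereal_values(4)) auto

lemma continuous_f: "continuous_on (XX P) fr"
  by (rule continuous_at_imp_continuous_on, rule ballI, rule differentiable_imp_continuous_within, rule f_diff)

lemma continuous_Phi_x: "l \<in> LL P \<Longrightarrow> continuous_on (XX P) (\<lambda>x. Phi P x l)"
  by (rule continuous_at_imp_continuous_on, rule ballI, rule differentiable_imp_continuous_within, rule Phi_facts(3))

lemma continuous_Phi_l: "x \<in> XX P \<Longrightarrow> continuous_on (LL P) (Phi P x)"
  by (rule continuous_at_imp_continuous_on, rule ballI, rule differentiable_imp_continuous_within, rule Phi_facts(4))

lemma dual_maximizer:
  assumes "x \<in> XX P"
  shows "\<exists>u\<in>LL P. \<forall>l\<in>LL P. Sr x l - \<rho> * wr l \<le> Sr x u - \<rho> * wr u"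
proof -
  have "continuous_on (LL P) (\<lambda>l. \<rho> * wr l - Phi P x l)"
    by (intro continuous_intros w_facts continuous_Phi_l assms)
  from attains_minimum[OF ccp(3) compact_L L_facts(1) dom(2) this]
  obtain u where u: "u \<in> LL P" "\<And>l. l \<in> LL P \<Longrightarrow> \<rho> * wr u - Phi P x u + hr u \<le> \<rho> * wr l - Phi P x l + hr l" by blast
  have "Sr x l - \<rho> * wr l \<le> Sr x u - \<rho> * wr u" if "l \<in> LL P" for l
    using u(2)[OF that] by (simp add: Sr_def)
  then show ?thesis using u(1) by blast
qed

lemma primal_minimizer:
  assumes "l \<in> LL P"
  shows "\<exists>v\<in>XX P. \<forall>x\<in>XX P. Sr v l \<le> Sr x l"
proof -
  have "continuous_on (XX P) (\<lambda>x. fr x + Phi P x l)"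
    by (intro continuous_intros continuous_f continuous_Phi_x assms)
  from attains_minimum[OF ccp(2) compact_X X_facts(1) dom(1) this]
  obtain v where v: "v \<in> XX P" "\<And>x. x \<in> XX P \<Longrightarrow> fr v + Phi P v l + gr v \<le> fr x + Phi P x l + gr x" by blast
  have "Sr v l \<le> Sr x l" if "x \<in> XX P" for x using v(2)[OF that] by (simp add: Sr_def)
  then show ?thesis using v(1) by blast
qed

text \<open>Real-valued forms of the smoothed primal value function and of the dual value function; they are
  meaningful because both optima are attained at feasible points.\<close>

definition pval :: "real \<Rightarrow> 'a \<Rightarrow> real" where
  "pval \<rho> x = real_of_ereal (psi_P_rho P \<rho> x)"

definition dval :: "'b \<Rightarrow> real" where
  "dval l = real_of_ereal (psi_D P l)"

lemma psi_P_rho_attained: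
  assumes "x \<in> XX P"
  obtains u where "u \<in> LL P" "psi_P_rho P \<rho> x = ereal (pval \<rho> x)" "pval \<rho> x = Sr x u - \<rho> * wr u"
    "\<And>l. l \<in> LL P \<Longrightarrow> Sr x l - \<rho> * wr l \<le> pval \<rho> x"
proof -
  obtain u where u: "u \<in> LL P" "\<And>l. l \<in> LL P \<Longrightarrow> Sr x l - \<rho> * wr l \<le> Sr x u - \<rho> * wr u"
    using dual_maximizer[OF assms] by blast
  have "psi_P_rho P \<rho> x = ereal (Sr x u - \<rho> * wr u)"
    unfolding psi_P_rho_def
  proof (rule antisym)
    show "(SUP l\<in>LL P. SS_rho P \<rho> x l) \<le> ereal (Sr x u - \<rho> * wr u)"
      by (intro SUP_least) (simp add: SS_rho_eq assms u)
    show "ereal (Sr x u - \<rho> * wr u) \<le> (SUP l\<in>LL P. SS_rho P \<rho> x l)"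
      by (intro SUP_upper2[OF u(1)]) (simp add: SS_rho_eq assms u)
  qed
  then show ?thesis using u by (intro that[of u]) (simp_all add: pval_def)
qed

lemma psi_D_attained:
  assumes "l \<in> LL P"
  obtains v where "v \<in> XX P" "psi_D P l = ereal (dval l)" "dval l = Sr v l"
    "\<And>x. x \<in> XX P \<Longrightarrow> dval l \<le> Sr x l"
proof -
  obtain v where v: "v \<in> XX P" "\<And>x. x \<in> XX P \<Longrightarrow> Sr v l \<le> Sr x l"
    using primal_minimizer[OF assms] by blast
  have "psi_D P l = ereal (Sr v l)"
    unfolding psi_D_def
  proof (rule antisym)
    show "(INF x\<in>XX P. SS P x l) \<le> ereal (Sr v l)"
      by (intro INF_lower2[OF v(1)]) (simp add: SS_eq assms v)
    show "ereal (Sr v l) \<le> (INF x\<in>XX P. SS P x l)"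
      by (intro INF_greatest) (simp add: SS_eq assms v)
  qed
  then show ?thesis using v by (intro that[of v]) (simp_all add: dval_def)
qed

lemma psi_P_rho_eq: "x \<in> XX P \<Longrightarrow> psi_P_rho P \<rho> x = ereal (pval \<rho> x)"
  by (rule psi_P_rho_attained[of x \<rho>])

lemma psi_D_eq: "l \<in> LL P \<Longrightarrow> psi_D P l = ereal (dval l)"
  by (rule psi_D_attained[of l])

lemma psi_P_eq:
  assumes "x \<in> XX P"
  shows "psi_P P x = ereal (pval 0 x)"
proof -
  have "psi_P P x = psi_P_rho P 0 x" by (simp add: psi_P_def psi_P_rho_def SS_rho_def zero_ereal_def[symmetric])
  then show ?thesis using psi_P_rho_eq[OF assms, of 0] by simp
qed

lemma pval_upper: "x \<in> XX P \<Longrightarrow> l \<in> LL P \<Longrightarrow> Sr x l - \<rho> * wr l \<le> pval \<rho> x"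
  by (rule psi_P_rho_attained[of x \<rho>])

lemma dval_lower: "x \<in> XX P \<Longrightarrow> l \<in> LL P \<Longrightarrow> dval l \<le> Sr x l"
  by (rule psi_D_attained[of l])

lemma gap_eq:
  assumes "x \<in> XX P" "l \<in> LL P"
  shows "gap P x l = ereal (pval 0 x - dval l)"
  by (simp add: gap_def psi_P_eq[OF assms(1)] psi_D_eq[OF assms(2)])

lemma dval_le_pval:
  assumes "x \<in> XX P" "l \<in> LL P"
  shows "dval l \<le> pval 0 x"
  using dval_lower[OF assms] pval_upper[OF assms, of 0] by simp

section \<open>The excessive gap inequality\<close>

lemma Phi_grad_bounded:
  "\<exists>G. \<forall>x\<in>XX P. \<forall>l\<in>LL P. norm (grad_x (Phi P) x l) \<le> G \<and> norm (grad_l (Phi P) x l) \<le> G"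
proof -
  obtain x0 l0 where x0: "x0 \<in> XX P" and l0: "l0 \<in> LL P" using X_facts(1) L_facts(1) by blast
  obtain R where R: "\<And>x. x \<in> XX P \<Longrightarrow> norm x \<le> R" using X_facts(4) by (auto simp: bounded_iff)
  obtain Q where Q: "\<And>l. l \<in> LL P \<Longrightarrow> norm l \<le> Q" using dual_bounded by (auto simp: bounded_iff)
  have nx: "norm (x - x0) \<le> 2 * R" if "x \<in> XX P" for x
    using norm_triangle_ineq4[of x x0] R[OF that] R[OF x0] by simp
  have nl: "norm (l - l0) \<le> 2 * Q" if "l \<in> LL P" for l
    using norm_triangle_ineq4[of l l0] Q[OF that] Q[OF l0] by simp
  have bound: "norm (g x l) \<le> norm (g x0 l0) + A * (2 * R) + B * (2 * Q)"
    if "norm (g x l - g x0 l) \<le> A * norm (x - x0)" "norm (g x0 l - g x0 l0) \<le> B * norm (l - l0)"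
      "0 \<le> A" "0 \<le> B" "x \<in> XX P" "l \<in> LL P" for g :: "'a \<Rightarrow> 'b \<Rightarrow> 'c::real_normed_vector" and A B x l
  proof -
    have "A * norm (x - x0) \<le> A * (2 * R)" "B * norm (l - l0) \<le> B * (2 * Q)"
      using nx nl that by (auto intro!: mult_left_mono)
    moreover have "norm (g x l) \<le> norm (g x0 l0) + norm (g x l - g x0 l) + norm (g x0 l - g x0 l0)"
      using norm_triangle_ineq[of "g x l - g x0 l" "g x0 l"] norm_triangle_ineq[of "g x0 l - g x0 l0" "g x0 l0"] by simp
    ultimately show ?thesis using that(1,2) by linarith
  qed
  show ?thesis
  proof (intro exI ballI conjI)
    fix x l assume xl: "x \<in> XX P" "l \<in> LL P"
    show "norm (grad_x (Phi P) x l) \<le> max (norm (grad_x (Phi P) x0 l0) + L_xx P * (2 * R) + L_lx P * (2 * Q))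
       (norm (grad_l (Phi P) x0 l0) + L_lx P * (2 * R) + L_ll P * (2 * Q))"
      by (rule max.coboundedI1, rule bound[OF Phi_grad_lipschitz(1)[OF xl(1) x0 xl(2) xl(2)]
          Phi_grad_lipschitz(2)[OF x0 x0 xl(2) l0] const_facts(4,5) xl])
    show "norm (grad_l (Phi P) x l) \<le> max (norm (grad_x (Phi P) x0 l0) + L_xx P * (2 * R) + L_lx P * (2 * Q))
       (norm (grad_l (Phi P) x0 l0) + L_lx P * (2 * R) + L_ll P * (2 * Q))"
      by (rule max.coboundedI2, rule bound[OF Phi_grad_lipschitz(3)[OF xl(1) x0 xl(2) xl(2)]
          Phi_grad_lipschitz(4)[OF x0 x0 xl(2) l0] const_facts(5,6) xl])
  qed
qed

text \<open>The partial gradients are Lipschitz on the bounded feasible sets, hence bounded, and convexity or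
  concavity turns this bound into a Lipschitz constant.\<close>

lemma Phi_lipschitz:
  "\<exists>G\<ge>0. (\<forall>x\<in>XX P. \<forall>x'\<in>XX P. \<forall>l\<in>LL P. \<bar>Phi P x l - Phi P x' l\<bar> \<le> G * norm (x - x')) \<and>
    (\<forall>x\<in>XX P. \<forall>l\<in>LL P. \<forall>l'\<in>LL P. \<bar>Phi P x l - Phi P x l'\<bar> \<le> G * norm (l - l'))"
proof -
  obtain G where G: "\<And>x l. x \<in> XX P \<Longrightarrow> l \<in> LL P \<Longrightarrow> norm (grad_x (Phi P) x l) \<le> G"
    "\<And>x l. x \<in> XX P \<Longrightarrow> l \<in> LL P \<Longrightarrow> norm (grad_l (Phi P) x l) \<le> G"
    using Phi_grad_bounded by blast
  show ?thesis
  proof (intro exI[of _ G] conjI ballI)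
    obtain x0 l0 where "x0 \<in> XX P" "l0 \<in> LL P" using X_facts(1) L_facts(1) by blast
    from G(1)[OF this] show "0 \<le> G" using norm_ge_zero order_trans by blast
  next
    fix x x' l assume *: "x \<in> XX P" "x' \<in> XX P" "l \<in> LL P"
    show "\<bar>Phi P x l - Phi P x' l\<bar> \<le> G * norm (x - x')"
      by (rule convex_on_lipschitz_if_grad_bounded[where U = "XX P"])
        (use * in \<open>auto intro: G Phi_facts convex_on_subset[OF Phi_facts(1)] X_facts\<close>)
  next
    fix x l l' assume *: "x \<in> XX P" "l \<in> LL P" "l' \<in> LL P"
    have "\<bar>- Phi P x l - - Phi P x l'\<bar> \<le> G * norm (l - l')"
    proof (rule convex_on_lipschitz_if_grad_bounded[where U = "LL P"])
      show "convex_on (LL P) (\<lambda>l. - Phi P x l)" by (rule convex_on_subset[OF Phi_facts(2)]) (auto intro: L_facts)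
      fix w assume w: "w \<in> LL P"
      note d = Phi_facts(4)[OF *(1) w]
      show "(\<lambda>l. - Phi P x l) differentiable (at w)" by (rule differentiable_minus[OF d])
      show "norm (grad (\<lambda>l. - Phi P x l) w) \<le> G" unfolding grad_uminus[OF d] norm_minus_cancel by (rule G(2)[OF *(1) w])
    qed (use * in auto)
    then show "\<bar>Phi P x l - Phi P x l'\<bar> \<le> G * norm (l - l')" by simp
  qed
qed

lemma continuous_Phi: "continuous_on (XX P \<times> LL P) (\<lambda>(x, l). Phi P x l)"
proof -
  obtain G where G: "0 \<le> G"
    "\<And>x x' l. x \<in> XX P \<Longrightarrow> x' \<in> XX P \<Longrightarrow> l \<in> LL P \<Longrightarrow> \<bar>Phi P x l - Phi P x' l\<bar> \<le> G * norm (x - x')"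
    "\<And>x l l'. x \<in> XX P \<Longrightarrow> l \<in> LL P \<Longrightarrow> l' \<in> LL P \<Longrightarrow> \<bar>Phi P x l - Phi P x l'\<bar> \<le> G * norm (l - l')"
    using Phi_lipschitz by blast
  have "(2 * G)-lipschitz_on (XX P \<times> LL P) (\<lambda>(x, l). Phi P x l)"
  proof (rule lipschitz_onI)
    fix p q assume p: "p \<in> XX P \<times> LL P" and q: "q \<in> XX P \<times> LL P"
    obtain x l x' l' where pq: "p = (x, l)" "q = (x', l')" by fastforce
    have "dist x x' \<le> dist p q" "dist l l' \<le> dist p q"
      using dist_fst_le[of p q] dist_snd_le[of p q] by (simp_all add: pq)
    then have "G * norm (x - x') \<le> G * dist p q" "G * norm (l - l') \<le> G * dist p q"
      using G(1) by (auto simp: dist_norm intro!: mult_left_mono)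
    moreover have "\<bar>Phi P x l - Phi P x' l\<bar> \<le> G * norm (x - x')" "\<bar>Phi P x' l - Phi P x' l'\<bar> \<le> G * norm (l - l')"
      using p q by (auto simp: pq intro!: G)
    ultimately show "dist (case p of (x, l) \<Rightarrow> Phi P x l) (case q of (x, l) \<Rightarrow> Phi P x l) \<le> 2 * G * dist p q"
      by (simp add: pq dist_real_def)
  qed (use G(1) in simp)
  then show ?thesis by (rule lipschitz_on_continuous_on)
qed

lemma convex_g: "convex_on (XX P) gr" and convex_h: "convex_on (LL P) hr"
  by (rule closed_convex_proper_convex_on[OF ccp(2) dom(1) X_facts(3)],
      rule closed_convex_proper_convex_on[OF ccp(3) dom(2) L_facts(3)])

lemma convex_Phi_on: "convex_on (XX P) (\<lambda>x. Phi P x l)" "convex_on (LL P) (\<lambda>l. - Phi P x l)"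
  by (rule convex_on_subset[OF Phi_facts(1)], simp, rule X_facts(3),
      rule convex_on_subset[OF Phi_facts(2)], simp, rule L_facts(3))

lemma strongly_convex_f: "strongly_convex_on (XX P) (mu P) fr"
  by (rule strongly_convex_on_if_bregman[OF X_facts(3) f_bregman(1)])

lemma primal_strongly_convex: "strongly_convex_on (XX P) (mu P) (\<lambda>x. Sr x l)"
proof -
  have "convex_on (XX P) (\<lambda>x. gr x + Phi P x l + (- hr l))"
    by (intro convex_on_add convex_g convex_Phi_on) (simp add: convex_on_const X_facts)
  from strongly_convex_on_add[OF strongly_convex_f this] show ?thesis
    by (simp add: Sr_def algebra_simps)
qed

lemma dual_strongly_concave:
  assumes "0 \<le> \<rho>"
  shows "strongly_convex_on (LL P) \<rho> (\<lambda>l. \<rho> * wr l - Sr x l)"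
proof -
  have "convex_on (LL P) (\<lambda>l. (- Phi P x l) + hr l + (- fr x - gr x))"
    by (intro convex_on_add convex_h convex_Phi_on) (simp add: convex_on_const L_facts)
  from strongly_convex_on_add[OF strongly_convex_on_scale[OF w_facts(3) assms] this] show ?thesis
    by (simp add: Sr_def algebra_simps)
qed

text \<open>Inexactness costs half of the curvature of the smoothing term and the error itself; what remains is a
  quadratic decrease away from the approximate maximizer \<open>u\<close>.\<close>

lemma dual_near_maximizer:
  assumes "x \<in> XX P" "u \<in> LL P" "v \<in> LL P" "0 \<le> \<rho>"
  defines "e \<equiv> pval \<rho> x - (Sr x u - \<rho> * wr u)"
  shows "Sr x v - \<rho> * wr v \<le> pval \<rho> x - \<rho> / 4 * (norm (v - u))\<^sup>2 + e"
proof -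
  obtain us where us: "us \<in> LL P" "pval \<rho> x = Sr x us - \<rho> * wr us"
    using psi_P_rho_attained[OF assms(1), of \<rho>] by metis
  have "\<rho> * wr us - Sr x us + \<rho> / 4 * (norm (v - u))\<^sup>2 - e \<le> \<rho> * wr v - Sr x v"
  proof (rule strongly_convex_on_near_minimizer[OF dual_strongly_concave[OF assms(4)] L_facts(3) us(1)])
    fix l assume "l \<in> LL P"
    then show "\<rho> * wr us - Sr x us \<le> \<rho> * wr l - Sr x l"
      using pval_upper[OF assms(1), of l \<rho>] us(2) by simp
  qed (use assms us in auto)
  then show ?thesis using us(2) by simp
qed

lemma primal_near_minimizer:
  assumes "l \<in> LL P" "w \<in> XX P" "v \<in> XX P"
  defines "e \<equiv> Sr w l - dval l"
  shows "dval l + mu P / 4 * (norm (v - w))\<^sup>2 - e \<le> Sr v l"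
proof -
  obtain vs where vs: "vs \<in> XX P" "dval l = Sr vs l"
    using psi_D_attained[OF assms(1)] by metis
  have "Sr vs l + mu P / 4 * (norm (v - w))\<^sup>2 - e \<le> Sr v l"
  proof (rule strongly_convex_on_near_minimizer[OF primal_strongly_convex X_facts(3) vs(1)])
    fix x assume "x \<in> XX P"
    then show "Sr vs l \<le> Sr x l" using dval_lower[OF _ assms(1), of x] vs(2) by simp
  qed (use assms vs const_facts(2) in auto)
  then show ?thesis using vs(2) by simp
qed

lemma Phi_dual_descent:
  assumes "x \<in> XX P" "l \<in> LL P" "l' \<in> LL P"
  shows "Phi P x l + grad_l (Phi P) x l (l' - l) - L_ll P / 2 * (norm (l' - l))\<^sup>2 \<le> Phi P x l'"
proof -
  have "bregman (\<lambda>l. - Phi P x l) l' l \<le> L_ll P / 2 * (norm (l' - l))\<^sup>2"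
  proof (rule lipschitz_grad_imp_bregman_le[OF L_facts(3)])
    fix w assume w: "w \<in> LL P"
    note d = Phi_facts(4)[OF assms(1) w]
    show "(\<lambda>l. - Phi P x l) differentiable (at w)" by (rule differentiable_minus[OF d])
    have "norm (grad (Phi P x) w - grad (Phi P x) l) \<le> L_ll P * norm (w - l)"
      by (rule Phi_grad_lipschitz(4)[OF assms(1,1) w assms(2)])
    then show "norm (grad (\<lambda>l. - Phi P x l) w - grad (\<lambda>l. - Phi P x l) l) \<le> L_ll P * norm (w - l)"
      unfolding grad_uminus[OF d] grad_uminus[OF Phi_facts(4)[OF assms(1,2)]] by (simp add: norm_minus_commute)
  qed (use assms in auto)
  then show ?thesis
    unfolding bregman_uminus[OF Phi_facts(4)[OF assms(1,2)]] by (simp add: bregman_def)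
qed

lemma Phi_dual_concave:
  assumes "x \<in> XX P" "l \<in> LL P" "l' \<in> LL P"
  shows "Phi P x l' \<le> Phi P x l + grad_l (Phi P) x l (l' - l)"
proof -
  note d = Phi_facts(4)[OF assms(1,2)]
  have "0 \<le> bregman (\<lambda>l. - Phi P x l) l' l"
    by (rule convex_on_imp_bregman_nonneg[OF convex_Phi_on(2) assms(3,2) differentiable_minus[OF d]])
  then show ?thesis unfolding bregman_uminus[OF d] by (simp add: bregman_def)
qed

text \<open>For a primal point \<open>v\<close>, moving from \<open>l\<close> to \<open>l'\<close> changes the coupling by its linearization at \<open>v\<close>, up to
  curvature \<open>L_ll\<close>. Replacing the gradient at \<open>v\<close> by the one at the approximate minimizer \<open>w\<close> costs
  \<open>L_lx\<close> times the distance from \<open>v\<close> to \<open>w\<close>, and this is absorbed by the strong convexity of the primal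
  sub-problem, by completing the square. The two contributions add up to \<open>L_D\<close>.\<close>

lemma dval_lower_model:
  assumes w: "w \<in> XX P" and l: "l \<in> LL P" and l': "l' \<in> LL P"
  defines "e \<equiv> Sr w l - dval l"
  shows "fr w + gr w + Phi P w l + grad_l (Phi P) w l (l' - l) - hr l'
      - L_D P * (norm (l' - l))\<^sup>2 - 2 * e \<le> dval l'"
proof -
  obtain v where v: "v \<in> XX P" "dval l' = Sr v l'" using psi_D_attained[OF l'] by metis
  define a where "a = norm (v - w)"
  define b where "b = norm (l' - l)"
  have "grad_l (Phi P) w l (l' - l) - grad_l (Phi P) v l (l' - l) = (grad_l (Phi P) w l - grad_l (Phi P) v l) (l' - l)"
    by (simp add: minus_blinfun.rep_eq)
  also have "\<dots> \<le> norm (grad_l (Phi P) w l - grad_l (Phi P) v l) * b"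
    unfolding b_def by (rule order_trans[OF abs_ge_self]) (metis norm_blinfun real_norm_def)
  also have "\<dots> \<le> (L_lx P * norm (w - v)) * b"
    by (intro mult_right_mono Phi_grad_lipschitz(3)[OF w v(1) l l]) (simp add: b_def)
  finally have g: "grad_l (Phi P) w l (l' - l) - L_lx P * a * b \<le> grad_l (Phi P) v l (l' - l)"
    by (simp add: a_def norm_minus_commute)
  have d: "Phi P v l + grad_l (Phi P) v l (l' - l) - L_ll P / 2 * b\<^sup>2 \<le> Phi P v l'"
    unfolding b_def by (rule Phi_dual_descent[OF v(1) l l'])
  have n: "dval l + mu P / 4 * a\<^sup>2 - e \<le> Sr v l"
    unfolding a_def e_def by (rule primal_near_minimizer[OF l w v(1)])
  \<comment> \<open>the square is completed so that the cross term \<open>L_lx P * a * b\<close> is absorbed\<close>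
  have "0 \<le> (mu P * a / 2 - L_lx P * b)\<^sup>2 / mu P" using const_facts(2) by simp
  also have "\<dots> = mu P / 4 * a\<^sup>2 - L_lx P * a * b + (L_lx P)\<^sup>2 / mu P * b\<^sup>2"
    using const_facts(2) by (simp add: power2_eq_square field_simps)
  finally have y: "L_lx P * a * b - mu P / 4 * a\<^sup>2 \<le> (L_lx P)\<^sup>2 / mu P * b\<^sup>2" by simp
  have "L_ll P / 2 * b\<^sup>2 \<le> L_ll P * b\<^sup>2" using const_facts(6) by (intro mult_right_mono) auto
  then have "L_ll P / 2 * b\<^sup>2 + (L_lx P)\<^sup>2 / mu P * b\<^sup>2 \<le> L_D P * b\<^sup>2"
    by (simp add: L_D_def distrib_right)
  moreover define p q r where "p = L_lx P * a * b" "q = (L_lx P)\<^sup>2 / mu P * b\<^sup>2" "r = L_D P * b\<^sup>2"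
  moreover define m' L' where "m' = mu P / 4 * a\<^sup>2" "L' = L_ll P / 2 * b\<^sup>2"
  ultimately show ?thesis using g d n y v(2)
    unfolding b_def[symmetric] p_q_r_def[symmetric] m'_L'_def[symmetric] e_def Sr_def by argo
qed

text \<open>The primal side produces \<open>- t * \<rho> / 4\<close> and the dual side \<open>L_D * (1 - t)\<^sup>2\<close> times the squared distance of the
  two dual solutions \<open>u\<close> and \<open>u'\<close>; the hypothesis on \<open>t\<close> and \<open>\<rho>\<close> makes their sum nonpositive. The linear
  parts match because \<open>l'\<close> and \<open>lh\<close> are averages with the same weights.\<close>

lemma excessive_gap_step:
  assumes x: "x \<in> XX P" and l: "l \<in> LL P" and u: "u \<in> LL P" and w: "w \<in> XX P" and u': "u' \<in> LL P"
    and t: "0 < t" "t < 1" and \<rho>: "0 < \<rho>" and cond: "4 * L_D P * (1 - t)\<^sup>2 \<le> t * \<rho>"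
  defines "lh \<equiv> t *\<^sub>R l + (1 - t) *\<^sub>R u"
    and "x' \<equiv> t *\<^sub>R x + (1 - t) *\<^sub>R w"
    and "l' \<equiv> t *\<^sub>R l + (1 - t) *\<^sub>R u'"
  shows "pval (t * \<rho>) x' - dval l' \<le> t * (pval \<rho> x - dval l)
    + t * (pval \<rho> x - (Sr x u - \<rho> * wr u)) + 2 * (Sr w lh - dval lh)
    + (pval (t * \<rho>) x' - (Sr x' u' - t * \<rho> * wr u'))"
proof -
  have conv: "t *\<^sub>R a + (1 - t) *\<^sub>R b \<in> S" if "convex S" "a \<in> S" "b \<in> S" for a b and S :: "'z::real_vector set"
    using that t by (intro convexD) auto
  have lh: "lh \<in> LL P" and l': "l' \<in> LL P" and x': "x' \<in> XX P"
    unfolding lh_def l'_def x'_def by (intro conv L_facts X_facts assms)+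
  define N where "N = (norm (u' - u))\<^sup>2"
  define D where "D = grad_l (Phi P) w lh"
  have dl: "l' - lh = (1 - t) *\<^sub>R (u' - u)" by (simp add: lh_def l'_def algebra_simps)
  have nd: "(norm (l' - lh))\<^sup>2 = (1 - t)\<^sup>2 * N"
    unfolding dl N_def norm_scaleR power_mult_distrib by simp
  \<comment> \<open>the smoothed primal value at \<open>x'\<close>, bounded by the convexity of the saddle function in \<open>x\<close>\<close>
  have "Sr (t *\<^sub>R x + (1 - t) *\<^sub>R w) u' \<le> t * Sr x u' + (1 - t) * Sr w u'"
  proof -
    have "Sr ((1 - (1 - t)) *\<^sub>R x + (1 - t) *\<^sub>R w) u' \<le> (1 - (1 - t)) * Sr x u' + (1 - t) * Sr w u'
       - mu P / 2 * (1 - t) * (1 - (1 - t)) * (norm (x - w))\<^sup>2"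
      using primal_strongly_convex[of u'] x w t unfolding strongly_convex_on_def by fastforce
    moreover have "0 \<le> mu P / 2 * (1 - t) * (1 - (1 - t)) * (norm (x - w))\<^sup>2"
      using const_facts(2) t by simp
    ultimately show ?thesis by simp
  qed
  then have p1: "Sr x' u' \<le> t * Sr x u' + (1 - t) * Sr w u'" by (simp add: x'_def)
  have "t * (Sr x u' - \<rho> * wr u') \<le> t * (pval \<rho> x - \<rho> / 4 * N + (pval \<rho> x - (Sr x u - \<rho> * wr u)))"
    unfolding N_def using t dual_near_maximizer[OF x u u', of \<rho>] \<rho> by (intro mult_left_mono) auto
  then have p2: "t * Sr x u' - t * \<rho> * wr u' \<le> t * pval \<rho> x - t * \<rho> / 4 * N + t * (pval \<rho> x - (Sr x u - \<rho> * wr u))"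
    by (simp add: algebra_simps)
  \<comment> \<open>the lower model at \<open>l'\<close>, bounded below through the concavity of the coupling in the dual variable\<close>
  have "D (l' - lh) = t * D (l - lh) + (1 - t) * D (u' - lh)"
  proof -
    have "l' - lh = t *\<^sub>R (l - lh) + (1 - t) *\<^sub>R (u' - lh)" by (simp add: l'_def algebra_simps)
    then show ?thesis by (simp only: blinfun.add_right blinfun.scaleR_right real_scaleR_def)
  qed
  moreover have "t * Phi P w l \<le> t * (Phi P w lh + D (l - lh))"
    unfolding D_def using t by (intro mult_left_mono Phi_dual_concave w lh l) auto
  moreover have "(1 - t) * Phi P w u' \<le> (1 - t) * (Phi P w lh + D (u' - lh))"
    unfolding D_def using t by (intro mult_left_mono Phi_dual_concave w lh u') auto
  moreover have "t * (Phi P w lh + D (l - lh)) + (1 - t) * (Phi P w lh + D (u' - lh))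
      = Phi P w lh + (t * D (l - lh) + (1 - t) * D (u' - lh))" by (simp add: algebra_simps)
  ultimately have d1: "t * Phi P w l + (1 - t) * Phi P w u' \<le> Phi P w lh + D (l' - lh)" by linarith
  have "hr ((1 - (1 - t)) *\<^sub>R l + (1 - t) *\<^sub>R u') \<le> (1 - (1 - t)) * hr l + (1 - t) * hr u'"
    by (rule convex_onD[OF convex_h]) (use t l u' in auto)
  then have d2: "hr l' \<le> t * hr l + (1 - t) * hr u'" by (simp add: l'_def)
  have d3: "fr w + gr w + Phi P w lh + D (l' - lh) - hr l' - L_D P * ((1 - t)\<^sup>2 * N) - 2 * (Sr w lh - dval lh) \<le> dval l'"
    unfolding D_def nd[symmetric] by (rule dval_lower_model[OF w lh l'])
  have "t * dval l \<le> t * Sr w l" using t by (intro mult_left_mono dval_lower w l) auto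
  moreover have "t * Sr w l + (1 - t) * Sr w u'
      = fr w + gr w + (t * Phi P w l + (1 - t) * Phi P w u') - (t * hr l + (1 - t) * hr u')"
    by (simp add: Sr_def algebra_simps)
  ultimately have d4: "t * dval l + (1 - t) * Sr w u' - L_D P * ((1 - t)\<^sup>2 * N) - 2 * (Sr w lh - dval lh) \<le> dval l'"
    using d1 d2 d3 by linarith
  have "4 * L_D P * (1 - t)\<^sup>2 * N \<le> t * \<rho> * N" using cond by (rule mult_right_mono) (simp add: N_def)
  then have "L_D P * ((1 - t)\<^sup>2 * N) \<le> t * \<rho> / 4 * N" by simp
  then show ?thesis using p1 p2 d4 unfolding right_diff_distrib by linarith
qed

section \<open>The sub-problems and their solution\<close>

lemma convex_f: "convex_on (XX P) fr"
  by (rule closed_convex_proper_convex_on[OF ccp(1) X_dom_f X_facts(3)])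

lemma mean_comp_dual_sub: "mean_comp (dual_sub P ls \<rho> x) = (\<lambda>l. - Phi P x l)"
  by (rule ext) (simp add: mean_comp_def dual_sub_def Phi_def sum_negf)

lemma mean_comp_primal_sub: "mean_comp (primal_sub P xs l) = (\<lambda>x. fr x + Phi P x l)"
proof
  fix x
  have "mean_comp (primal_sub P xs l) x
      = 1 / real (nn P) * (real (nn P) * fr x + (\<Sum>i=1..nn P. Phi_i P i x l))"
    by (simp add: mean_comp_def primal_sub_def sum.distrib)
  also have "\<dots> = fr x + Phi P x l" using const_facts(3) by (simp add: Phi_def distrib_left)
  finally show "mean_comp (primal_sub P xs l) x = fr x + Phi P x l" .
qed

text \<open>The dropped terms are constant in the dual variable, so they cancel in the error of an approximate
  solution.\<close>

lemma objective_dual_sub: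
  assumes "l \<in> LL P"
  shows "objective (dual_sub P ls \<rho> x) l = \<rho> * wr l - Sr x l + (fr x + gr x)"
proof -
  have "real_of_ereal (hh P l + ereal \<rho> * om P l) = hr l + \<rho> * wr l"
    using ereal_values(3,4)[OF assms] by (metis plus_ereal.simps(1) times_ereal.simps(1) real_of_ereal.simps(1))
  then have "real_of_ereal (reg (dual_sub P ls \<rho> x) l) = hr l + \<rho> * wr l" by (simp add: dual_sub_def)
  then show ?thesis by (simp add: objective_def mean_comp_dual_sub Sr_def)
qed

lemma objective_primal_sub: "objective (primal_sub P xs l) x = Sr x l + hr l"
proof -
  have "reg (primal_sub P xs l) x = gg P x" by (simp add: primal_sub_def)
  then show ?thesis by (simp add: objective_def mean_comp_primal_sub Sr_def)
qed

lemma composite_ok_dual_sub: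
  assumes x: "x \<in> XX P" and \<rho>: "0 < \<rho>" and ls: "ls \<in> LL P \<inter> interior (edom (om P))"
  shows "composite_ok (dual_sub P ls \<rho> x)"
proof -
  let ?Q = "dual_sub P ls \<rho> x"
  have sel: "feas ?Q = LL P" "ncomp ?Q = nn P" "\<And>i. comps ?Q i = (\<lambda>l. - Phi_i P i x l)"
    "reg ?Q = (\<lambda>l. hh P l + ereal \<rho> * om P l)" "kernel ?Q = om P" "smoothness ?Q = L_ll P"
    "convexity ?Q = \<rho>" "start ?Q = ls" by (simp_all add: dual_sub_def)
  have comp: "convex_on (LL P) (\<lambda>l. - Phi_i P i x l) \<and> (\<exists>k. smooth_on (LL P) k (\<lambda>l. - Phi_i P i x l))"
    if i: "i \<in> {1..nn P}" for i
  proof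
    show "convex_on (LL P) (\<lambda>l. - Phi_i P i x l)"
      by (rule convex_on_subset[OF Phi_i_facts(2)[OF i] subset_UNIV L_facts(3)])
    obtain C where C: "C-lipschitz_on (XX P \<times> LL P) (\<lambda>(x, l). grad_l (Phi_i P i) x l)"
      using Phi_i_facts(6)[OF i] by (rule exE)
    have "smooth_on (LL P) C (\<lambda>l. - Phi_i P i x l)"
    proof (rule lipschitz_grad_imp_smooth_on(2)[OF L_facts(3) Phi_i_facts(4)[OF i x]])
      fix u v assume uv: "u \<in> LL P" "v \<in> LL P"
      show "norm (grad (Phi_i P i x) u - grad (Phi_i P i x) v) \<le> C * norm (u - v)"
        using lipschitz_onD[OF C, of "(x, u)" "(x, v)"] x uv by (simp add: dist_Pair_Pair dist_norm)
    qed
    then show "\<exists>k. smooth_on (LL P) k (\<lambda>l. - Phi_i P i x l)" by (rule exI)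
  qed
  have smooth: "smooth_on (LL P) (L_ll P) (\<lambda>l. - Phi P x l)"
    by (rule lipschitz_grad_imp_smooth_on(2)[OF L_facts(3) Phi_facts(4)[OF x]])
       (assumption, rule Phi_grad_lipschitz(4)[OF x x])
  have sub: "LL P \<subseteq> edom (\<lambda>l. hh P l + ereal \<rho> * om P l)"
  proof
    fix l assume l: "l \<in> LL P"
    show "l \<in> edom (\<lambda>l. hh P l + ereal \<rho> * om P l)"
    proof -
      obtain a where a: "hh P l = ereal a" using ereal_values(3)[OF l] by (rule that)
      obtain b where b: "om P l = ereal b" using ereal_values(4)[OF l] by (rule that)
      show ?thesis unfolding edom_def mem_Collect_eq a b by simp
    qed
  qed
  have wd: "LL P \<subseteq> edom (\<lambda>l. ereal \<rho> * om P l)"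
  proof
    fix l assume l: "l \<in> LL P"
    show "l \<in> edom (\<lambda>l. ereal \<rho> * om P l)"
    proof -
      obtain b where b: "om P l = ereal b" using ereal_values(4)[OF l] by (rule that)
      show ?thesis unfolding edom_def mem_Collect_eq b by simp
    qed
  qed
  have reg: "closed_convex_proper (\<lambda>l. hh P l + ereal \<rho> * om P l)"
    by (rule closed_convex_proper_add[OF ccp(3) closed_convex_proper_scale[OF w_facts(1) \<rho>]])
       (metis Int_greatest L_facts(1) dom(2) wd subset_empty)
  have sc: "strongly_convex_on (LL P) \<rho> (objective ?Q)"
  proof (rule strongly_convex_on_cong[OF _ L_facts(3) objective_dual_sub])
    show "strongly_convex_on (LL P) \<rho> (\<lambda>l. \<rho> * wr l - Sr x l + (fr x + gr x))"
      by (rule strongly_convex_on_add[OF dual_strongly_concave]) (use \<rho> in \<open>simp_all add: convex_on_const L_facts(3)\<close>)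
  qed
  have dgfr: "dgf (om P) (\<lambda>l. hh P l + ereal \<rho> * om P l) (LL P)"
  proof (rule dgf_absorb_multiple[OF dgfs(1) _ \<rho>])
    fix l assume "l \<in> LL P"
    from ereal_values(3)[OF this] show "\<bar>hh P l\<bar> \<noteq> \<infinity>" by (cases "hh P l") auto
  qed
  have compb: "\<forall>i\<in>{1..nn P}. convex_on (LL P) (\<lambda>l. - Phi_i P i x l) \<and>
      (\<exists>k. smooth_on (LL P) k (\<lambda>l. - Phi_i P i x l))" using comp by (intro ballI)
  show ?thesis
    unfolding composite_ok_def sel mean_comp_dual_sub
    by (intro conjI; rule L_facts compact_L const_facts compb smooth sub reg \<rho> sc ls dgfr)
qed

lemma composite_ok_primal_sub:
  assumes l: "l \<in> LL P" and xs: "xs \<in> XX P \<inter> interior (edom (om_bar P))"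
  shows "composite_ok (primal_sub P xs l)"
proof -
  let ?Q = "primal_sub P xs l"
  have sel: "feas ?Q = XX P" "ncomp ?Q = nn P" "\<And>i. comps ?Q i = (\<lambda>x. fr x + Phi_i P i x l)"
    "reg ?Q = gg P" "kernel ?Q = om_bar P" "smoothness ?Q = L_f P + L_xx P"
    "convexity ?Q = mu P" "start ?Q = xs" by (simp_all add: primal_sub_def)
  have sf: "smooth_on (XX P) (L_f P) fr"
    unfolding smooth_on_def using f_diff f_bregman(2) by blast
  have comp: "convex_on (XX P) (\<lambda>x. fr x + Phi_i P i x l) \<and> (\<exists>k. smooth_on (XX P) k (\<lambda>x. fr x + Phi_i P i x l))"
    if i: "i \<in> {1..nn P}" for i
  proof
    show "convex_on (XX P) (\<lambda>x. fr x + Phi_i P i x l)"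
      by (rule convex_on_add[OF convex_f convex_on_subset[OF Phi_i_facts(1)[OF i] subset_UNIV X_facts(3)]])
    obtain C where C: "C-lipschitz_on (XX P \<times> LL P) (\<lambda>(x, l). grad_x (Phi_i P i) x l)"
      using Phi_i_facts(5)[OF i] by (rule exE)
    have "smooth_on (XX P) C (\<lambda>x. Phi_i P i x l)"
    proof (rule lipschitz_grad_imp_smooth_on(1)[OF X_facts(3) Phi_i_facts(3)[OF i _ l]])
      fix u v assume uv: "u \<in> XX P" "v \<in> XX P"
      show "norm (grad_x (Phi_i P i) u l - grad_x (Phi_i P i) v l) \<le> C * norm (u - v)"
        using lipschitz_onD[OF C, of "(u, l)" "(v, l)"] l uv by (simp add: dist_Pair_Pair dist_norm)
    qed
    from smooth_on_add[OF sf this] show "\<exists>k. smooth_on (XX P) k (\<lambda>x. fr x + Phi_i P i x l)" by (rule exI)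
  qed
  have smooth: "smooth_on (XX P) (L_f P + L_xx P) (\<lambda>x. fr x + Phi P x l)"
    by (rule smooth_on_add[OF sf], rule lipschitz_grad_imp_smooth_on(1)[OF X_facts(3) Phi_facts(3)[OF _ l]])
       (assumption, rule Phi_grad_lipschitz(1)[OF _ _ l l])
  have sc: "strongly_convex_on (XX P) (mu P) (objective ?Q)"
  proof (rule strongly_convex_on_cong[OF _ X_facts(3) objective_primal_sub])
    show "strongly_convex_on (XX P) (mu P) (\<lambda>x. Sr x l + hr l)"
      by (rule strongly_convex_on_add[OF primal_strongly_convex]) (simp add: convex_on_const X_facts(3))
  qed
  have L0: "0 \<le> L_f P + L_xx P" using const_facts by linarith
  have compb: "\<forall>i\<in>{1..nn P}. convex_on (XX P) (\<lambda>x. fr x + Phi_i P i x l) \<and>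
      (\<exists>k. smooth_on (XX P) k (\<lambda>x. fr x + Phi_i P i x l))" using comp by (intro ballI)
  show ?thesis
    unfolding composite_ok_def sel mean_comp_primal_sub
    by (intro conjI; rule X_facts compact_X const_facts L0 compb smooth ccp(2) dom(1) sc xs dgfs(2))
qed

lemma borel_sets: "XX P \<in> sets borel" "LL P \<in> sets borel" "XX P \<times> LL P \<in> sets borel"
  using X_facts(2) L_facts(2) by (auto intro!: borel_closed closed_Times)

lemma measurable_rparts [measurable]:
  "fr \<in> borel_measurable borel" "gr \<in> borel_measurable borel" "hr \<in> borel_measurable borel" "wr \<in> borel_measurable borel"
  using closed_convex_proper_measurable[OF ccp(1)] closed_convex_proper_measurable[OF ccp(2)]
    closed_convex_proper_measurable[OF ccp(3)] closed_convex_proper_measurable[OF w_facts(1)]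
  by (simp_all add: borel_measurable_real_of_ereal)

lemma measurable_Phi:
  assumes "X \<in> borel_measurable M" "Y \<in> borel_measurable M" "\<And>w. w \<in> space M \<Longrightarrow> X w \<in> XX P" "\<And>w. w \<in> space M \<Longrightarrow> Y w \<in> LL P"
  shows "(\<lambda>w. Phi P (X w) (Y w)) \<in> borel_measurable M"
proof -
  have "(\<lambda>w. (X w, Y w)) \<in> borel_measurable M" using assms(1,2) by (rule borel_measurable_Pair)
  from measurable_continuous_on_comp[OF continuous_Phi borel_sets(3) this] assms(3,4)
  show ?thesis by simp
qed

text \<open>Subtracting the terms that do not depend on the dual variable leaves a maximum of functions that share
  the Lipschitz constant of the coupling; in particular \<open>g\<close>, which is only lower semicontinuous, drops out.\<close>

lemma pval_part_lipschitz:
  assumes "\<And>x x' l. x \<in> XX P \<Longrightarrow> x' \<in> XX P \<Longrightarrow> l \<in> LL P \<Longrightarrow> \<bar>Phi P x l - Phi P x' l\<bar> \<le> G * norm (x - x')"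
    and x: "x \<in> XX P" "x' \<in> XX P"
  shows "pval \<rho> x - fr x - gr x \<le> pval \<rho> x' - fr x' - gr x' + G * norm (x - x')"
proof -
  obtain u where u: "u \<in> LL P" "pval \<rho> x = Sr x u - \<rho> * wr u"
    by (rule psi_P_rho_attained[OF x(1), of \<rho>]) (rule that)
  have "Sr x' u - \<rho> * wr u \<le> pval \<rho> x'" by (rule pval_upper[OF x(2) u(1)])
  moreover have "\<bar>Phi P x u - Phi P x' u\<bar> \<le> G * norm (x - x')" by (rule assms(1)[OF x u(1)])
  ultimately show ?thesis unfolding u(2) Sr_def by argo
qed

lemma dval_part_lipschitz:
  assumes "\<And>x l l'. x \<in> XX P \<Longrightarrow> l \<in> LL P \<Longrightarrow> l' \<in> LL P \<Longrightarrow> \<bar>Phi P x l - Phi P x l'\<bar> \<le> G * norm (l - l')"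
    and l: "l \<in> LL P" "l' \<in> LL P"
  shows "dval l + hr l \<le> dval l' + hr l' + G * norm (l - l')"
proof -
  obtain v where v: "v \<in> XX P" "dval l' = Sr v l'"
    by (rule psi_D_attained[OF l(2)]) (rule that)
  have "dval l \<le> Sr v l" by (rule dval_lower[OF v(1) l(1)])
  moreover have "\<bar>Phi P v l - Phi P v l'\<bar> \<le> G * norm (l - l')" by (rule assms(1)[OF v(1) l])
  ultimately show ?thesis unfolding v(2) Sr_def by argo
qed

text \<open>The objective of the sub-problem is, up to a constant, the negative of the smoothed saddle function, so the
  promise of the solver is a bound on the error in the smoothed primal value.\<close>

lemma rpd_dual_step:
  assumes g: "rpd_guarantee rpdL calls c" and x: "x \<in> XX P" and \<rho>: "0 < \<rho>" and e: "0 < e"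
    and ls: "ls \<in> LL P \<inter> interior (edom (om P))"
  defines "N \<equiv> dual_iters P ls \<rho> e"
  shows "prob_space (rpdL (dual_sub P ls \<rho> x) N) \<and> sets (rpdL (dual_sub P ls \<rho> x) N) = sets borel \<and>
      emeasure (rpdL (dual_sub P ls \<rho> x) N) (LL P) = 1"
    "(\<integral>\<^sup>+u. ennreal (pval \<rho> x - (Sr x u - \<rho> * wr u)) \<partial>rpdL (dual_sub P ls \<rho> x) N) \<le> ennreal e"
    "real (calls (nn P) N) \<le> c * real N"
proof -
  let ?Q = "dual_sub P ls \<rho> x"
  let ?m = "rpdL ?Q N"
  have sel: "feas ?Q = LL P" "ncomp ?Q = nn P" "kernel ?Q = om P" "smoothness ?Q = L_ll P"
    "convexity ?Q = \<rho>" "start ?Q = ls" by (simp_all add: dual_sub_def)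
  note G = g[unfolded rpd_guarantee_def Let_def, THEN spec, THEN spec, THEN mp, OF conjI[OF composite_ok_dual_sub[OF x \<rho> ls] e],
      unfolded sel, folded dual_iters_def, folded N_def]
  show *: "prob_space ?m \<and> sets ?m = sets borel \<and> emeasure ?m (LL P) = 1" using G by argo
  show "real (calls (nn P) N) \<le> c * real N" using G by argo
  obtain us where us: "us \<in> LL P" "pval \<rho> x = Sr x us - \<rho> * wr us"
    by (rule psi_P_rho_attained[OF x, of \<rho>]) (rule that)
  have min: "\<forall>u\<in>LL P. objective ?Q us \<le> objective ?Q u"
  proof
    fix u assume u: "u \<in> LL P"
    show "objective ?Q us \<le> objective ?Q u"
      using pval_upper[OF x u, of \<rho>] us(2) by (simp add: objective_dual_sub u us(1))
  qed
  interpret prob_space ?m using * by argo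
  have ev: "LL P \<in> events" using * borel_sets(2) by argo
  have "prob (LL P) = 1" using * by (simp add: measure_def)
  then have AE: "AE u in ?m. u \<in> LL P" unfolding prob_eq_1[OF ev] .
  have "(\<integral>\<^sup>+u. ennreal (pval \<rho> x - (Sr x u - \<rho> * wr u)) \<partial>?m) = (\<integral>\<^sup>+u. ennreal (objective ?Q u - objective ?Q us) \<partial>?m)"
  proof (rule nn_integral_cong_AE, use AE in eventually_elim)
    case (elim u)
    show ?case by (simp add: objective_dual_sub[OF elim] objective_dual_sub[OF us(1)] us(2) algebra_simps)
  qed
  also have "\<dots> \<le> ennreal e"
    using G[THEN conjunct2, THEN conjunct2, THEN conjunct2, THEN conjunct1, THEN bspec, OF us(1), THEN mp, OF min] .
  finally show "(\<integral>\<^sup>+u. ennreal (pval \<rho> x - (Sr x u - \<rho> * wr u)) \<partial>?m) \<le> ennreal e" .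
qed

lemma rpd_primal_step:
  assumes g: "rpd_guarantee rpdX calls c" and l: "l \<in> LL P" and e: "0 < e"
    and xs: "xs \<in> XX P \<inter> interior (edom (om_bar P))"
  defines "N \<equiv> primal_iters P xs e"
  shows "prob_space (rpdX (primal_sub P xs l) N) \<and> sets (rpdX (primal_sub P xs l) N) = sets borel \<and>
      emeasure (rpdX (primal_sub P xs l) N) (XX P) = 1"
    "(\<integral>\<^sup>+x. ennreal (Sr x l - dval l) \<partial>rpdX (primal_sub P xs l) N) \<le> ennreal e"
    "real (calls (nn P) N) \<le> c * real N"
proof -
  let ?Q = "primal_sub P xs l"
  let ?m = "rpdX ?Q N"
  have sel: "feas ?Q = XX P" "ncomp ?Q = nn P" "kernel ?Q = om_bar P" "smoothness ?Q = L_f P + L_xx P"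
    "convexity ?Q = mu P" "start ?Q = xs" by (simp_all add: primal_sub_def)
  note G = g[unfolded rpd_guarantee_def Let_def, THEN spec, THEN spec, THEN mp, OF conjI[OF composite_ok_primal_sub[OF l xs] e],
      unfolded sel, folded primal_iters_def, folded N_def]
  show *: "prob_space ?m \<and> sets ?m = sets borel \<and> emeasure ?m (XX P) = 1" using G by argo
  show "real (calls (nn P) N) \<le> c * real N" using G by argo
  obtain v where v: "v \<in> XX P" "dval l = Sr v l"
    by (rule psi_D_attained[OF l]) (rule that)
  have min: "\<forall>u\<in>XX P. objective ?Q v \<le> objective ?Q u"
  proof
    fix u assume u: "u \<in> XX P"
    show "objective ?Q v \<le> objective ?Q u"
      using dval_lower[OF u l] v(2) by (simp add: objective_primal_sub)
  qed
  have "(\<integral>\<^sup>+x. ennreal (Sr x l - dval l) \<partial>?m) = (\<integral>\<^sup>+u. ennreal (objective ?Q u - objective ?Q v) \<partial>?m)"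
    by (simp add: objective_primal_sub v(2))
  also have "\<dots> \<le> ennreal e"
    using G[THEN conjunct2, THEN conjunct2, THEN conjunct2, THEN conjunct1, THEN bspec, OF v(1), THEN mp, OF min] .
  finally show "(\<integral>\<^sup>+x. ennreal (Sr x l - dval l) \<partial>?m) \<le> ennreal e" .
qed

text \<open>The error splits into a Lipschitz function of \<open>x\<close>, the jointly continuous coupling, and Borel functions of
  the dual variable, which gives both the measurability and the Lipschitz property in \<open>x\<close> that the
  argument about random sub-problems asks for.\<close>

lemma dual_draw_accuracy:
  assumes g: "rpd_guarantee rpdL calls c" and \<rho>: "0 < \<rho>" and e: "0 < e"
    and ls: "ls \<in> LL P \<inter> interior (edom (om P))"
    and M: "prob_space M" and F: "subalgebra M F"
    and dr: "draws M F (\<lambda>w. rpdL (dual_sub P ls \<rho> (X w)) (dual_iters P ls \<rho> e)) Y"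
    and X: "X \<in> borel_measurable F" "\<And>w. w \<in> space M \<Longrightarrow> X w \<in> XX P"
    and Y: "\<And>w. w \<in> space M \<Longrightarrow> Y w \<in> LL P"
    and f: "\<And>w. w \<in> space M \<Longrightarrow> f w = ennreal (pval \<rho> (X w) - (Sr (X w) (Y w) - \<rho> * wr (Y w)))"
  shows "f \<in> borel_measurable M" "AE w in M. nn_cond_exp M F f w \<le> ennreal e" "(\<integral>\<^sup>+w. f w \<partial>M) \<le> ennreal e"
proof -
  obtain G where G: "0 \<le> G"
    "\<And>x x' l. x \<in> XX P \<Longrightarrow> x' \<in> XX P \<Longrightarrow> l \<in> LL P \<Longrightarrow> \<bar>Phi P x l - Phi P x' l\<bar> \<le> G * norm (x - x')"
    using Phi_lipschitz by blast
  define H where "H x u = pval \<rho> x - (Sr x u - \<rho> * wr u)" for x u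
  have Heq: "H x u = (pval \<rho> x - fr x - gr x) - Phi P x u + hr u + \<rho> * wr u" for x u
    by (simp add: H_def Sr_def)
  have pl: "pval \<rho> x - fr x - gr x \<le> pval \<rho> x' - fr x' - gr x' + G * norm (x - x')" if "x \<in> XX P" "x' \<in> XX P" for x x'
    by (rule pval_part_lipschitz[OF G(2) that])
  have Ym: "Y \<in> borel_measurable M" using dr by (simp add: draws_def)
  have Xm: "X \<in> borel_measurable M" by (rule measurable_from_subalg[OF F X(1)])
  have [measurable]: "(\<lambda>w. pval \<rho> (X w) - fr (X w) - gr (X w)) \<in> borel_measurable M"
    by (rule measurable_continuous_on_comp[OF continuous_on_of_one_sided_lipschitz[OF G(1) pl] borel_sets(1) Xm X(2)])
  note [measurable] = measurable_Phi[OF Xm Ym X(2) Y] Ym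
  have meas: "(\<lambda>w. H (X w) (Y w)) \<in> borel_measurable M" unfolding Heq by measurable
  have Hm: "(\<lambda>u. indicator (LL P) u * H x u) \<in> borel_measurable borel" if x: "x \<in> XX P" for x
  proof -
    have "(\<lambda>u. indicator (LL P) u *\<^sub>R Phi P x u) \<in> borel_measurable borel"
      by (rule borel_measurable_continuous_on_indicator[OF borel_sets(2) continuous_Phi_l[OF x]])
    then have [measurable]: "(\<lambda>u. indicator (LL P) u * Phi P x u) \<in> borel_measurable borel" by simp
    have [measurable]: "LL P \<in> sets borel" by (rule borel_sets)
    have "indicator (LL P) u * H x u = indicator (LL P) u * (pval \<rho> x - fr x - gr x) - indicator (LL P) u * Phi P x u
        + indicator (LL P) u * (hr u + \<rho> * wr u)" for u by (simp add: Heq algebra_simps)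
    then show ?thesis by (simp only:) measurable
  qed
  have Hl: "H x u \<le> H x' u + (2 * G) * dist x x'" if "x \<in> XX P" "x' \<in> XX P" "u \<in> LL P" for x x' u
    using pl[OF that(1,2)] G(2)[OF that] unfolding Heq dist_norm by argo
  have H0: "0 \<le> H x u" if "x \<in> XX P" "u \<in> LL P" for x u
    using pval_upper[OF that, of \<rho>] by (simp add: H_def)
  note rs = rpd_dual_step[OF g X(2) \<rho> e ls]
  have le: "(\<integral>\<^sup>+u. ennreal (H (X w) u) \<partial>rpdL (dual_sub P ls \<rho> (X w)) (dual_iters P ls \<rho> e)) \<le> ennreal e"
    if "w \<in> space M" for w unfolding H_def by (rule rs(2)[OF that])
  have f': "f w = ennreal (H (X w) (Y w))" if "w \<in> space M" for w using f[OF that] by (simp only: H_def)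
  have G2: "0 \<le> 2 * G" using G(1) by simp
  note concl = draws_expected_error[where H = H and f = f and C = "2 * G", OF M F dr X compact_X borel_sets(2) Y rs(1) Hm H0 Hl G2 le less_imp_le[OF e] meas f']
  show "f \<in> borel_measurable M" by (rule concl(1))
  show "AE w in M. nn_cond_exp M F f w \<le> ennreal e" by (rule concl(2))
  show "(\<integral>\<^sup>+w. f w \<partial>M) \<le> ennreal e" by (rule concl(3))
qed

lemma primal_draw_accuracy:
  assumes g: "rpd_guarantee rpdX calls c" and e: "0 < e"
    and xs: "xs \<in> XX P \<inter> interior (edom (om_bar P))"
    and M: "prob_space M" and F: "subalgebra M F"
    and dr: "draws M F (\<lambda>w. rpdX (primal_sub P xs (Z w)) (primal_iters P xs e)) Y"
    and Z: "Z \<in> borel_measurable F" "\<And>w. w \<in> space M \<Longrightarrow> Z w \<in> LL P"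
    and Y: "\<And>w. w \<in> space M \<Longrightarrow> Y w \<in> XX P"
    and f: "\<And>w. w \<in> space M \<Longrightarrow> f w = ennreal (Sr (Y w) (Z w) - dval (Z w))"
  shows "f \<in> borel_measurable M" "AE w in M. nn_cond_exp M F f w \<le> ennreal e" "(\<integral>\<^sup>+w. f w \<partial>M) \<le> ennreal e"
proof -
  obtain G where G: "0 \<le> G"
    "\<And>x l l'. x \<in> XX P \<Longrightarrow> l \<in> LL P \<Longrightarrow> l' \<in> LL P \<Longrightarrow> \<bar>Phi P x l - Phi P x l'\<bar> \<le> G * norm (l - l')"
    using Phi_lipschitz by blast
  define H where "H l x = Sr x l - dval l" for l x
  have Heq: "H l x = fr x + gr x + Phi P x l - (dval l + hr l)" for x l
    by (simp add: H_def Sr_def)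
  have pl: "dval l + hr l \<le> dval l' + hr l' + G * norm (l - l')" if "l \<in> LL P" "l' \<in> LL P" for l l'
    by (rule dval_part_lipschitz[OF G(2) that])
  have Ym: "Y \<in> borel_measurable M" using dr by (simp add: draws_def)
  have Zm: "Z \<in> borel_measurable M" by (rule measurable_from_subalg[OF F Z(1)])
  have [measurable]: "(\<lambda>w. dval (Z w) + hr (Z w)) \<in> borel_measurable M"
    by (rule measurable_continuous_on_comp[OF continuous_on_of_one_sided_lipschitz[OF G(1) pl] borel_sets(2) Zm Z(2)])
  note [measurable] = measurable_Phi[OF Ym Zm Y Z(2)] Ym
  have meas: "(\<lambda>w. H (Z w) (Y w)) \<in> borel_measurable M" unfolding Heq by measurable
  have Hm: "(\<lambda>x. indicator (XX P) x * H l x) \<in> borel_measurable borel" if l: "l \<in> LL P" for l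
  proof -
    have "(\<lambda>x. indicator (XX P) x *\<^sub>R Phi P x l) \<in> borel_measurable borel"
      by (rule borel_measurable_continuous_on_indicator[OF borel_sets(1) continuous_Phi_x[OF l]])
    then have [measurable]: "(\<lambda>x. indicator (XX P) x * Phi P x l) \<in> borel_measurable borel" by simp
    have [measurable]: "XX P \<in> sets borel" by (rule borel_sets)
    have "indicator (XX P) x * H l x = indicator (XX P) x * (fr x + gr x) + indicator (XX P) x * Phi P x l
        - indicator (XX P) x * (dval l + hr l)" for x by (simp add: Heq algebra_simps)
    then show ?thesis by (simp only:) measurable
  qed
  have Hl: "H l x \<le> H l' x + (2 * G) * dist l l'" if "l \<in> LL P" "l' \<in> LL P" "x \<in> XX P" for x l l'
    using pl[OF that(2,1)] G(2)[OF that(3,1,2)] unfolding Heq dist_norm norm_minus_commute[of l' l] by argo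
  have H0: "0 \<le> H l x" if "l \<in> LL P" "x \<in> XX P" for x l
    using dval_lower[OF that(2,1)] by (simp add: H_def)
  note rs = rpd_primal_step[OF g Z(2) e xs]
  have le: "(\<integral>\<^sup>+u. ennreal (H (Z w) u) \<partial>rpdX (primal_sub P xs (Z w)) (primal_iters P xs e)) \<le> ennreal e"
    if "w \<in> space M" for w unfolding H_def by (rule rs(2)[OF that])
  have f': "f w = ennreal (H (Z w) (Y w))" if "w \<in> space M" for w using f[OF that] by (simp only: H_def)
  have G2: "0 \<le> 2 * G" using G(1) by simp
  note concl = draws_expected_error[where H = H and f = f and C = "2 * G", OF M F dr Z compact_L borel_sets(1) Y rs(1) Hm H0 Hl G2 le less_imp_le[OF e] meas f']
  show "f \<in> borel_measurable M" by (rule concl(1))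
  show "AE w in M. nn_cond_exp M F f w \<le> ennreal e" by (rule concl(2))
  show "(\<integral>\<^sup>+w. f w \<partial>M) \<le> ennreal e" by (rule concl(3))
qed

end

section \<open>Runs of the algorithm\<close>

lemma tau_bounds: "0 < tau k" "tau k < 1"
  by (simp_all add: tau_def)

lemma averaged_mem:
  assumes "convex S" "z0 \<in> S" "\<And>k. z k w \<in> S"
  shows "averaged z0 z k w \<in> S"
proof (induction k)
  case (Suc k)
  then show ?case using assms tau_bounds[of k] by (auto intro!: convexD)
qed (use assms in simp)

lemma frac_cancel: "(a :: real) \<noteq> 0 \<Longrightarrow> a / c * (x / (a * b)) = x / (c * b)"
  by simp

lemma rho_eq: "rho P k = 16 * L_D P / ((real k + 1) * (real k + 2))"
proof (induction k)
  case (Suc k)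
  have "rho P (Suc k) = (real k + 1) / (real k + 3) * (16 * L_D P / ((real k + 1) * (real k + 2)))"
    by (simp add: Suc tau_def)
  also have "\<dots> = 16 * L_D P / ((real k + 3) * (real k + 2))" by (rule frac_cancel) simp
  also have "(real k + 3) * (real k + 2) = (real (Suc k) + 1) * (real (Suc k) + 2)" by (simp add: algebra_simps)
  finally show ?case .
qed simp

text \<open>The conditional expectations of the algorithm are meaningful: the information available at each
  stage is part of the ambient sigma-algebra.\<close>

lemma subalgebra_filt0:
  assumes "\<And>k. lt k \<in> borel_measurable M" "\<And>k. xt k \<in> borel_measurable M" "\<And>k. lt' k \<in> borel_measurable M"
  shows "subalgebra M (filt0 M lt xt lt' k)"
proof (induction k)
  case 0
  have "sigma_sets (space M) {} \<subseteq> sets M" by (rule sets.sigma_sets_subset) simp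
  then show ?case by (simp add: subalgebra_def space_measure_of_conv sets_measure_of)
next
  case (Suc k)
  then show ?case by (auto intro!: subalgebra_adjoin_ambient assms)
qed

lemma measurable_adjoin_mono:
  "f \<in> borel_measurable F \<Longrightarrow> f \<in> borel_measurable (adjoin F Y)"
  by (rule measurable_from_subalg[OF subalgebra_adjoin])

lemma measurable_averaged:
  fixes x0 :: "'a::fin_dim_normed" and l0 :: "'b::fin_dim_normed"
  shows "averaged x0 xt k \<in> borel_measurable (filt0 M lt xt lt' k)"
    and "averaged l0 lt' k \<in> borel_measurable (filt0 M lt xt lt' k)"
proof (induction k)
  case (Suc k)
  let ?F1 = "adjoin (filt0 M lt xt lt' k) (lt k)"
  let ?F2 = "adjoin ?F1 (xt k)"
  let ?F3 = "adjoin ?F2 (lt' k)"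
  have 1: "averaged x0 xt k \<in> borel_measurable ?F3" "averaged l0 lt' k \<in> borel_measurable ?F3"
    by (intro measurable_adjoin_mono Suc)+
  have 2: "xt k \<in> borel_measurable ?F3" by (intro measurable_adjoin_mono measurable_adjoin)
  have 3: "lt' k \<in> borel_measurable ?F3" by (rule measurable_adjoin)
  {
    case 1
    show ?case using \<open>averaged x0 xt k \<in> borel_measurable ?F3\<close> 2
      unfolding averaged.simps filt0.simps by measurable
  next
    case 2
    show ?case using \<open>averaged l0 lt' k \<in> borel_measurable ?F3\<close> 3
      unfolding averaged.simps filt0.simps by measurable
  }
qed simp_all

context saddle_problem
begin

lemma rho_pos: "0 < rho P k"
  using L_D_pos by (simp add: rho_eq)

lemma B_om_bounds: "l \<in> LL P \<Longrightarrow> \<bar>wr l\<bar> \<le> B_om P" "0 \<le> B_om P"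
proof -
  have "compact ((\<lambda>l. \<bar>wr l\<bar>) ` LL P)"
    by (intro compact_continuous_image compact_L continuous_on_rabs w_facts)
  then have bdd: "bdd_above ((\<lambda>l. \<bar>wr l\<bar>) ` LL P)" by (intro bounded_imp_bdd_above compact_imp_bounded)
  show *: "\<bar>wr l\<bar> \<le> B_om P" if "l \<in> LL P" for l
    unfolding B_om_def by (rule cSUP_upper[OF that bdd])
  obtain l where "l \<in> LL P" using L_facts(1) by blast
  from *[OF this] show "0 \<le> B_om P" by (rule order_trans[OF abs_ge_zero])
qed

text \<open>Both suprema are attained, so it suffices to compare the objectives at a maximizer of one of them, where
  they differ by \<open>\<rho> * wr\<close>.\<close>

lemma pval_smoothing:
  assumes x: "x \<in> XX P" and "0 \<le> \<rho>"
  shows "pval 0 x \<le> pval \<rho> x + \<rho> * B_om P" "pval \<rho> x \<le> pval 0 x + \<rho> * B_om P"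
proof -
  have w: "\<bar>\<rho> * wr l\<bar> \<le> \<rho> * B_om P" if "l \<in> LL P" for l
    using B_om_bounds(1)[OF that] assms(2) by (simp add: abs_mult mult_left_mono)
  obtain u where u: "u \<in> LL P" "pval 0 x = Sr x u - 0 * wr u"
    by (rule psi_P_rho_attained[OF x, of 0]) (rule that)
  show "pval 0 x \<le> pval \<rho> x + \<rho> * B_om P"
    using pval_upper[OF x u(1), of \<rho>] w[OF u(1)] u(2) by (simp add: abs_le_iff)
  obtain v where v: "v \<in> LL P" "pval \<rho> x = Sr x v - \<rho> * wr v"
    by (rule psi_P_rho_attained[OF x, of \<rho>]) (rule that)
  show "pval \<rho> x \<le> pval 0 x + \<rho> * B_om P"
    using pval_upper[OF x v(1), of 0] w[OF v(1)] v(2) by (simp add: abs_le_iff)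
qed

text \<open>The condition under which the two quadratic terms of one iteration cancel.\<close>

lemma step_condition: "4 * L_D P * (1 - tau k)\<^sup>2 \<le> tau k * rho P k"
proof -
  have "4 * L_D P * (1 - tau k)\<^sup>2 = 16 * L_D P / ((real k + 3) * (real k + 3))"
    by (simp add: tau_def power2_eq_square field_simps)
  also have "\<dots> \<le> 16 * L_D P / ((real k + 3) * (real k + 2))"
    using L_D_pos by (intro divide_left_mono mult_left_mono mult_pos_pos) auto
  also have "\<dots> = tau k * rho P k" unfolding rho_eq tau_def by (rule frac_cancel[symmetric]) simp
  finally show ?thesis .
qed

text \<open>The errors of the three sub-problem solutions of one iteration.\<close>

definition err1 :: "'a \<Rightarrow> (nat \<Rightarrow> 'w \<Rightarrow> 'a) \<Rightarrow> (nat \<Rightarrow> 'w \<Rightarrow> 'b) \<Rightarrow> nat \<Rightarrow> 'w \<Rightarrow> real" where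
  "err1 x0 xt lt k w = pval (rho P k) (averaged x0 xt k w)
     - (Sr (averaged x0 xt k w) (lt k w) - rho P k * wr (lt k w))"

definition err2 :: "'b \<Rightarrow> (nat \<Rightarrow> 'w \<Rightarrow> 'b) \<Rightarrow> (nat \<Rightarrow> 'w \<Rightarrow> 'a) \<Rightarrow> (nat \<Rightarrow> 'w \<Rightarrow> 'b) \<Rightarrow> nat \<Rightarrow> 'w \<Rightarrow> real" where
  "err2 l0 lt xt lt' k w = Sr (xt k w) (l_hat l0 lt lt' k w) - dval (l_hat l0 lt lt' k w)"

definition err3 :: "'a \<Rightarrow> (nat \<Rightarrow> 'w \<Rightarrow> 'a) \<Rightarrow> (nat \<Rightarrow> 'w \<Rightarrow> 'b) \<Rightarrow> nat \<Rightarrow> 'w \<Rightarrow> real" where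
  "err3 x0 xt lt' k w = pval (rho P (Suc k)) (averaged x0 xt (Suc k) w)
     - (Sr (averaged x0 xt (Suc k) w) (lt' k w) - rho P (Suc k) * wr (lt' k w))"

text \<open>The weights \<open>(k + 1) * (k + 2)\<close> turn the factors \<open>tau k\<close> into a telescoping product. Passing from the true
  gap to the smoothed one and back costs \<open>rho P 0 * B_om P\<close> at the start and \<open>rho P K * B_om P\<close> at the end;
  after multiplication with the weights each amounts to \<open>16 * L_D P * B_om P\<close>.\<close>

lemma gap_le_accumulated_errors:
  assumes x0: "x0 \<in> XX P" and l0: "l0 \<in> LL P"
    and mem: "\<And>k. lt k w \<in> LL P" "\<And>k. xt k w \<in> XX P" "\<And>k. lt' k w \<in> LL P"
  defines "x \<equiv> \<lambda>k. averaged x0 xt k w" and "l \<equiv> \<lambda>k. averaged l0 lt' k w"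
  shows "(real K + 1) * (real K + 2) * (pval 0 (x K) - dval (l K))
     \<le> 2 * (pval 0 x0 - dval l0) + 32 * L_D P * B_om P
       + (\<Sum>k<K. (real k + 2) * (real k + 3) * (err1 x0 xt lt k w + 2 * err2 l0 lt xt lt' k w + err3 x0 xt lt' k w))"
proof -
  have x: "x k \<in> XX P" and l: "l k \<in> LL P" for k
    unfolding x_def l_def by (rule averaged_mem[where S = "XX P"], rule X_facts, rule x0, rule mem,
      rule averaged_mem[where S = "LL P"], rule L_facts, rule l0, rule mem)
  have lh: "l_hat l0 lt lt' k w \<in> LL P" for k
    unfolding l_hat_def using l[of k] mem tau_bounds[of k] L_facts(3) unfolding l_def by (auto intro!: convexD)
  define G where "G k = pval (rho P k) (x k) - dval (l k)" for k
  let ?E = "\<lambda>k. err1 x0 xt lt k w + 2 * err2 l0 lt xt lt' k w + err3 x0 xt lt' k w"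
  have step: "G (Suc k) \<le> tau k * G k + ?E k" for k
  proof -
    have "G (Suc k) \<le> tau k * G k + tau k * err1 x0 xt lt k w + 2 * err2 l0 lt xt lt' k w + err3 x0 xt lt' k w"
      using excessive_gap_step[OF x[of k] l[of k] mem(1)[of k] mem(2)[of k] mem(3)[of k] tau_bounds[of k] rho_pos[of k] step_condition[of k]]
      unfolding G_def err1_def err2_def err3_def l_hat_def x_def l_def by simp
    moreover have "0 \<le> err1 x0 xt lt k w"
      using pval_upper[OF x[of k] mem(1)[of k], of "rho P k"] by (simp add: err1_def x_def)
    then have "tau k * err1 x0 xt lt k w \<le> err1 x0 xt lt k w"
      using tau_bounds[of k] by (simp add: mult_left_le_one_le)
    ultimately show ?thesis by linarith
  qed
  have rec: "(real K + 1) * (real K + 2) * G K \<le> 2 * G 0 + (\<Sum>k<K. (real k + 2) * (real k + 3) * ?E k)" for K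
  proof (induction K)
    case (Suc K)
    have e: "(real (Suc K) + 1) * (real (Suc K) + 2) = (real K + 2) * (real K + 3)" by (simp add: algebra_simps)
    have "(real (Suc K) + 1) * (real (Suc K) + 2) * G (Suc K) \<le> (real (Suc K) + 1) * (real (Suc K) + 2) * (tau K * G K + ?E K)"
      by (rule mult_left_mono[OF step]) simp
    also have "\<dots> = (real (Suc K) + 1) * (real (Suc K) + 2) * tau K * G K + (real (Suc K) + 1) * (real (Suc K) + 2) * ?E K"
      by (simp only: distrib_left mult.assoc)
    also have "(real (Suc K) + 1) * (real (Suc K) + 2) * tau K = (real K + 1) * (real K + 2)"
      by (simp add: tau_def field_simps)
    finally show ?case unfolding e sum.lessThan_Suc using Suc.IH by linarith
  qed simp
  have "pval 0 (x K) - dval (l K) \<le> G K + rho P K * B_om P"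
    using pval_smoothing(1)[OF x[of K] less_imp_le[OF rho_pos[of K]]] by (simp add: G_def)
  then have "(real K + 1) * (real K + 2) * (pval 0 (x K) - dval (l K)) \<le> (real K + 1) * (real K + 2) * (G K + rho P K * B_om P)"
    by (rule mult_left_mono) simp
  also have "\<dots> = (real K + 1) * (real K + 2) * G K + ((real K + 1) * (real K + 2) * rho P K) * B_om P"
    by (simp only: distrib_left mult.assoc)
  also have "(real K + 1) * (real K + 2) * rho P K = 16 * L_D P"
    by (simp add: rho_eq)
  also have "(real K + 1) * (real K + 2) * G K \<le> 2 * G 0 + (\<Sum>k<K. (real k + 2) * (real k + 3) * ?E k)" by (rule rec)
  also have "2 * G 0 \<le> 2 * (pval 0 x0 - dval l0) + 16 * L_D P * B_om P"
    using pval_smoothing(2)[OF x0 less_imp_le[OF rho_pos[of 0]]] by (simp add: G_def x_def l_def)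
  finally show ?thesis by (simp add: algebra_simps)
qed

text \<open>Each of the three draws is an instance of the accuracy lemmas for random sub-problems, with the iterate
  that defines the sub-problem measurable with respect to the past.\<close>

lemma run_errors:
  fixes M :: "'w measure"
  assumes run: "ipds_run P rpdX rpdL xs ls x0 l0 \<epsilon> M lt xt lt'"
    and gX: "rpd_guarantee rpdX calls c" and gL: "rpd_guarantee rpdL calls c"
    and xs: "xs \<in> XX P \<inter> interior (edom (om_bar P))" and ls: "ls \<in> LL P \<inter> interior (edom (om P))"
    and x0: "x0 \<in> XX P" and l0: "l0 \<in> LL P" and \<epsilon>: "0 < \<epsilon>"
  shows "ipds_accuracy P x0 l0 \<epsilon> M lt xt lt'"
    and "(\<lambda>w. ennreal (err1 x0 xt lt k w)) \<in> borel_measurable M"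
      "(\<lambda>w. ennreal (err2 l0 lt xt lt' k w)) \<in> borel_measurable M"
      "(\<lambda>w. ennreal (err3 x0 xt lt' k w)) \<in> borel_measurable M"
    and "(\<integral>\<^sup>+w. ennreal (err1 x0 xt lt k w) \<partial>M) \<le> ennreal (acc \<epsilon> k)"
      "(\<integral>\<^sup>+w. ennreal (err2 l0 lt xt lt' k w) \<partial>M) \<le> ennreal (acc \<epsilon> k)"
      "(\<integral>\<^sup>+w. ennreal (err3 x0 xt lt' k w) \<partial>M) \<le> ennreal (acc \<epsilon> k)"
proof -
  have M: "prob_space M" by (rule run[unfolded ipds_run_def, THEN conjunct1])
  note r = run[unfolded ipds_run_def, THEN conjunct2, THEN spec]
  have mem: "lt k w \<in> LL P" "xt k w \<in> XX P" "lt' k w \<in> LL P" if "w \<in> space M" for k w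
    using bspec[OF conjunct1[OF r[of k]] that] by auto
  note dr1 = r[THEN conjunct2, THEN conjunct1]
  note dr2 = r[THEN conjunct2, THEN conjunct2, THEN conjunct1]
  note dr3 = r[THEN conjunct2, THEN conjunct2, THEN conjunct2]
  have meas: "lt k \<in> borel_measurable M" "xt k \<in> borel_measurable M" "lt' k \<in> borel_measurable M" for k
    using dr1[of k] dr2[of k] dr3[of k] unfolding draws_def by argo+
  have F0: "subalgebra M (filt0 M lt xt lt' k)" for k by (rule subalgebra_filt0[OF meas])
  have F1: "subalgebra M (filt1 M lt xt lt' k)" for k
    unfolding filt1_def by (rule subalgebra_adjoin_ambient[OF F0 meas(1)])
  have F2: "subalgebra M (filt2 M lt xt lt' k)" for k
    unfolding filt2_def by (rule subalgebra_adjoin_ambient[OF F1 meas(2)])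
  have acc: "0 < acc \<epsilon> k" for k using \<epsilon> by (simp add: acc_def)
  have x: "averaged x0 xt k w \<in> XX P" if "w \<in> space M" for k w
    by (rule averaged_mem[where z = xt and w = w, OF X_facts(3) x0 mem(2)[OF that]])
  have l: "averaged l0 lt' k w \<in> LL P" if "w \<in> space M" for k w
    by (rule averaged_mem[where z = lt' and w = w, OF L_facts(3) l0 mem(3)[OF that]])
  have lh: "l_hat l0 lt lt' k w \<in> LL P" if "w \<in> space M" for k w
    unfolding l_hat_def using l[OF that] mem(1)[OF that] tau_bounds[of k] L_facts(3) by (auto intro!: convexD)
  have lhm: "l_hat l0 lt lt' k \<in> borel_measurable (filt1 M lt xt lt' k)" for k
  proof -
    have a: "averaged l0 lt' k \<in> borel_measurable (filt1 M lt xt lt' k)"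
      unfolding filt1_def by (intro measurable_adjoin_mono measurable_averaged)
    have b: "lt k \<in> borel_measurable (filt1 M lt xt lt' k)" unfolding filt1_def by (rule measurable_adjoin)
    have "l_hat l0 lt lt' k = (\<lambda>w. tau k *\<^sub>R averaged l0 lt' k w + (1 - tau k) *\<^sub>R lt k w)"
      by (rule ext) (simp add: l_hat_def)
    then show ?thesis using a b by simp
  qed
  have xm: "averaged x0 xt (Suc k) \<in> borel_measurable (filt2 M lt xt lt' k)" for k
  proof -
    have a: "averaged x0 xt k \<in> borel_measurable (filt2 M lt xt lt' k)"
      unfolding filt1_def filt2_def by (intro measurable_adjoin_mono measurable_averaged)
    have b: "xt k \<in> borel_measurable (filt2 M lt xt lt' k)" unfolding filt2_def by (rule measurable_adjoin)
    show ?thesis unfolding averaged.simps using a b by simp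
  qed
  have f1: "(let x = averaged x0 xt k w in e2ennreal (psi_P_rho P (rho P k) x - SS_rho P (rho P k) x (lt k w)))
      = ennreal (err1 x0 xt lt k w)" if w: "w \<in> space M" for k w
    unfolding Let_def psi_P_rho_eq[OF x[OF w]] SS_rho_eq[OF x[OF w] mem(1)[OF w]] by (simp add: err1_def)
  have f2: "(let l = l_hat l0 lt lt' k w in e2ennreal (SS P (xt k w) l - psi_D P l))
      = ennreal (err2 l0 lt xt lt' k w)" if w: "w \<in> space M" for k w
    unfolding Let_def psi_D_eq[OF lh[OF w]] SS_eq[OF mem(2)[OF w] lh[OF w]] by (simp add: err2_def)
  have f3: "(let x = averaged x0 xt (Suc k) w in e2ennreal (psi_P_rho P (rho P (Suc k)) x - SS_rho P (rho P (Suc k)) x (lt' k w)))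
      = ennreal (err3 x0 xt lt' k w)" if w: "w \<in> space M" for k w
    unfolding Let_def psi_P_rho_eq[OF x[OF w]] SS_rho_eq[OF x[OF w] mem(3)[OF w]] by (simp add: err3_def)
  note d1 = dual_draw_accuracy[OF gL rho_pos acc ls M F0 dr1 measurable_averaged(1) x mem(1)]
  note d2 = primal_draw_accuracy[OF gX acc xs M F1 dr2 lhm lh mem(2)]
  note d3 = dual_draw_accuracy[OF gL rho_pos acc ls M F2 dr3 xm x mem(3)]
  show "ipds_accuracy P x0 l0 \<epsilon> M lt xt lt'"
    unfolding ipds_accuracy_def
  proof (intro allI conjI, goal_cases)
    case (1 k)
    show ?case by (rule d1(2)) (simp_all only: f1 err1_def)
  next
    case (2 k)
    show ?case by (rule d2(2)) (simp_all only: f2 err2_def)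
  next
    case (3 k)
    show ?case by (rule d3(2)) (simp_all only: f3 err3_def)
  qed
  show "(\<lambda>w. ennreal (err1 x0 xt lt k w)) \<in> borel_measurable M" by (rule d1(1)) (simp_all only: err1_def)
  show "(\<lambda>w. ennreal (err2 l0 lt xt lt' k w)) \<in> borel_measurable M" by (rule d2(1)) (simp_all only: err2_def)
  show "(\<lambda>w. ennreal (err3 x0 xt lt' k w)) \<in> borel_measurable M" by (rule d3(1)) (simp_all only: err3_def)
  show "(\<integral>\<^sup>+w. ennreal (err1 x0 xt lt k w) \<partial>M) \<le> ennreal (acc \<epsilon> k)" by (rule d1(3)) (simp_all only: err1_def)
  show "(\<integral>\<^sup>+w. ennreal (err2 l0 lt xt lt' k w) \<partial>M) \<le> ennreal (acc \<epsilon> k)" by (rule d2(3)) (simp_all only: err2_def)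
  show "(\<integral>\<^sup>+w. ennreal (err3 x0 xt lt' k w) \<partial>M) \<le> ennreal (acc \<epsilon> k)" by (rule d3(3)) (simp_all only: err3_def)
qed

lemma errors_nonneg:
  assumes x0: "x0 \<in> XX P" and l0: "l0 \<in> LL P"
    and mem: "\<And>k. lt k w \<in> LL P" "\<And>k. xt k w \<in> XX P" "\<And>k. lt' k w \<in> LL P"
  shows "0 \<le> err1 x0 xt lt k w" "0 \<le> err2 l0 lt xt lt' k w" "0 \<le> err3 x0 xt lt' k w"
proof -
  have x: "averaged x0 xt k w \<in> XX P" for k
    by (rule averaged_mem[where z = xt and w = w, OF X_facts(3) x0 mem(2)])
  have l: "averaged l0 lt' k w \<in> LL P" for k
    by (rule averaged_mem[where z = lt' and w = w, OF L_facts(3) l0 mem(3)])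
  have lh: "l_hat l0 lt lt' k w \<in> LL P" for k
    unfolding l_hat_def using l mem(1) tau_bounds[of k] L_facts(3) by (auto intro!: convexD)
  show "0 \<le> err1 x0 xt lt k w" using pval_upper[OF x[of k] mem(1)[of k]] by (simp add: err1_def)
  show "0 \<le> err2 l0 lt xt lt' k w" using dval_lower[OF mem(2)[of k] lh[of k]] by (simp add: err2_def)
  show "0 \<le> err3 x0 xt lt' k w"
    unfolding err3_def using pval_upper[OF x[of "Suc k"] mem(3)[of k], of "rho P (Suc k)"] by linarith
qed

text \<open>The gap is bounded pointwise by accumulated nonnegative errors, so only these have to be integrated.
  Their weighted expectations are \<open>(k + 2) * \<epsilon>\<close>, which sum up to less than half of
  \<open>(K + 1) * (K + 2) * \<epsilon>\<close>.\<close>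

lemma expected_gap_le:
  fixes M :: "'w measure"
  assumes run: "ipds_run P rpdX rpdL xs ls x0 l0 \<epsilon> M lt xt lt'"
    and gX: "rpd_guarantee rpdX calls c" and gL: "rpd_guarantee rpdL calls c"
    and xs: "xs \<in> XX P \<inter> interior (edom (om_bar P))" and ls: "ls \<in> LL P \<inter> interior (edom (om P))"
    and x0: "x0 \<in> XX P" and l0: "l0 \<in> LL P" and \<epsilon>: "0 < \<epsilon>"
  shows "expected_gap P x0 l0 M xt lt' K
    \<le> ennreal ((2 * (pval 0 x0 - dval l0) + 32 * L_D P * B_om P) / ((real K + 1) * (real K + 2)) + \<epsilon> / 2)"
proof -
  define A where "A = (real K + 1) * (real K + 2)"
  have A: "0 < A" by (simp add: A_def)
  define c0 where "c0 = (2 * (pval 0 x0 - dval l0) + 32 * L_D P * B_om P) / A"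
  define ck where "ck k = (real k + 2) * (real k + 3) / A" for k :: nat
  have c0: "0 \<le> c0"
    unfolding c0_def using dval_le_pval[OF x0 l0] L_D_pos B_om_bounds(2) A by (intro divide_nonneg_pos) auto
  have ck: "0 \<le> ck k" for k using A by (simp add: ck_def)
  note e = run_errors[OF run gX gL xs ls x0 l0 \<epsilon>]
  interpret prob_space M by (rule run[unfolded ipds_run_def, THEN conjunct1])
  note r = run[unfolded ipds_run_def, THEN conjunct2, THEN spec]
  have mem: "lt k w \<in> LL P" "xt k w \<in> XX P" "lt' k w \<in> LL P" if "w \<in> space M" for k w
    using bspec[OF conjunct1[OF r[of k]] that] by auto
  let ?E1 = "\<lambda>k w. ennreal (err1 x0 xt lt k w)" and ?E2 = "\<lambda>k w. ennreal (err2 l0 lt xt lt' k w)"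
    and ?E3 = "\<lambda>k w. ennreal (err3 x0 xt lt' k w)"
  let ?T = "\<lambda>k w. ennreal (ck k) * (?E1 k w + 2 * ?E2 k w + ?E3 k w)"
  have pointwise: "e2ennreal (gap P (averaged x0 xt K w) (averaged l0 lt' K w)) \<le> ennreal c0 + (\<Sum>k<K. ?T k w)"
    if w: "w \<in> space M" for w
  proof -
    note m = mem[OF w]
    have x: "averaged x0 xt K w \<in> XX P"
      by (rule averaged_mem[where z = xt and w = w, OF X_facts(3) x0 m(2)])
    have l: "averaged l0 lt' K w \<in> LL P"
      by (rule averaged_mem[where z = lt' and w = w, OF L_facts(3) l0 m(3)])
    let ?r = "\<lambda>k. err1 x0 xt lt k w + 2 * err2 l0 lt xt lt' k w + err3 x0 xt lt' k w"
    note nn = errors_nonneg[where lt = lt and xt = xt and lt' = lt' and w = w, OF x0 l0 m]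
    have r0: "0 \<le> ?r k" for k using nn[of k] by simp
    have T: "?T k w = ennreal (ck k * ?r k)" for k
    proof -
      have "?E1 k w + 2 * ?E2 k w + ?E3 k w = ennreal (?r k)"
        using nn[of k] by (simp add: ennreal_plus ennreal_mult)
      then show ?thesis using ck[of k] r0[of k] by (simp add: ennreal_mult)
    qed
    have "A * (pval 0 (averaged x0 xt K w) - dval (averaged l0 lt' K w))
      \<le> (2 * (pval 0 x0 - dval l0) + 32 * L_D P * B_om P) + (\<Sum>k<K. (real k + 2) * (real k + 3) * ?r k)"
      unfolding A_def
      using gap_le_accumulated_errors[where lt = lt and xt = xt and lt' = lt' and w = w, OF x0 l0 m] by simp
    then have "pval 0 (averaged x0 xt K w) - dval (averaged l0 lt' K w)
      \<le> ((2 * (pval 0 x0 - dval l0) + 32 * L_D P * B_om P) + (\<Sum>k<K. (real k + 2) * (real k + 3) * ?r k)) / A"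
      using A by (simp add: pos_le_divide_eq mult.commute)
    also have "\<dots> = c0 + (\<Sum>k<K. ck k * ?r k)"
      by (simp add: c0_def ck_def add_divide_distrib sum_divide_distrib)
    finally have "ennreal (pval 0 (averaged x0 xt K w) - dval (averaged l0 lt' K w)) \<le> ennreal (c0 + (\<Sum>k<K. ck k * ?r k))"
      by (rule ennreal_leI)
    also have "\<dots> = ennreal c0 + ennreal (\<Sum>k<K. ck k * ?r k)"
      using c0 ck r0 by (intro ennreal_plus sum_nonneg mult_nonneg_nonneg) auto
    also have "ennreal (\<Sum>k<K. ck k * ?r k) = (\<Sum>k<K. ?T k w)"
      unfolding T by (rule sum_ennreal[symmetric]) (intro mult_nonneg_nonneg ck r0)
    finally show ?thesis by (simp add: gap_eq[OF x l])
  qed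
  have "expected_gap P x0 l0 M xt lt' K \<le> (\<integral>\<^sup>+w. ennreal c0 + (\<Sum>k<K. ?T k w) \<partial>M)"
    unfolding expected_gap_def by (rule nn_integral_mono) (rule pointwise)
  also have "\<dots> = ennreal c0 + (\<Sum>k<K. \<integral>\<^sup>+w. ?T k w \<partial>M)"
    using e(2,3,4) by (simp add: nn_integral_add nn_integral_sum emeasure_space_1)
  also have "\<dots> \<le> ennreal c0 + (\<Sum>k<K. ennreal (ck k * (4 * acc \<epsilon> k)))"
  proof (intro add_left_mono sum_mono)
    fix k
    have a: "0 \<le> acc \<epsilon> k" using \<epsilon> by (simp add: acc_def)
    have "(\<integral>\<^sup>+w. ?T k w \<partial>M) = ennreal (ck k) * ((\<integral>\<^sup>+w. ?E1 k w \<partial>M) + 2 * (\<integral>\<^sup>+w. ?E2 k w \<partial>M) + (\<integral>\<^sup>+w. ?E3 k w \<partial>M))"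
      using e(2,3,4)[of k] by (simp add: nn_integral_cmult nn_integral_add)
    also have "\<dots> \<le> ennreal (ck k) * (ennreal (acc \<epsilon> k) + 2 * ennreal (acc \<epsilon> k) + ennreal (acc \<epsilon> k))"
      by (intro mult_left_mono add_mono e(5,6,7)) auto
    also have "ennreal (acc \<epsilon> k) + 2 * ennreal (acc \<epsilon> k) + ennreal (acc \<epsilon> k) = ennreal (4 * acc \<epsilon> k)"
    proof -
      have "ennreal (4 * acc \<epsilon> k) = ennreal (acc \<epsilon> k + 2 * acc \<epsilon> k + acc \<epsilon> k)" by simp
      also have "\<dots> = ennreal (acc \<epsilon> k) + ennreal (2 * acc \<epsilon> k) + ennreal (acc \<epsilon> k)"
        using a by (simp only: ennreal_plus add_nonneg_nonneg mult_nonneg_nonneg zero_le_numeral)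
      also have "ennreal (2 * acc \<epsilon> k) = 2 * ennreal (acc \<epsilon> k)" using a by (simp add: ennreal_mult)
      finally show ?thesis by simp
    qed
    also have "ennreal (ck k) * ennreal (4 * acc \<epsilon> k) = ennreal (ck k * (4 * acc \<epsilon> k))"
      using ck a by (simp add: ennreal_mult)
    finally show "(\<integral>\<^sup>+w. ?T k w \<partial>M) \<le> ennreal (ck k * (4 * acc \<epsilon> k))" .
  qed
  also have "(\<Sum>k<K. ennreal (ck k * (4 * acc \<epsilon> k))) = ennreal (\<Sum>k<K. ck k * (4 * acc \<epsilon> k))"
    using \<epsilon> by (intro sum_ennreal mult_nonneg_nonneg ck) (simp_all add: acc_def)
  also have "(\<Sum>k<K. ck k * (4 * acc \<epsilon> k)) = (\<Sum>k<K. (real k + 2)) * (\<epsilon> / A)"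
  proof -
    have "ck k * (4 * acc \<epsilon> k) = (real k + 2) * (\<epsilon> / A)" for k
    proof -
      have "x * y / A * (4 * (\<epsilon> / (4 * y))) = x * (\<epsilon> / A)" if "y \<noteq> 0" for x y :: real
        using that by simp
      from this[of "real k + 3" "real k + 2"] show ?thesis unfolding ck_def acc_def by linarith
    qed
    then show ?thesis by (simp only: sum_distrib_right)
  qed
  also have "ennreal c0 + ennreal ((\<Sum>k<K. (real k + 2)) * (\<epsilon> / A)) \<le> ennreal c0 + ennreal (A / 2 * (\<epsilon> / A))"
  proof (intro add_left_mono ennreal_leI mult_right_mono)
    have "2 * (\<Sum>k<K. (real k + 2)) = real K * (real K + 3)" by (induction K) (simp_all add: algebra_simps)
    then show "(\<Sum>k<K. (real k + 2)) \<le> A / 2" by (simp add: A_def algebra_simps)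
  qed (use \<epsilon> A in simp)
  also have "A / 2 * (\<epsilon> / A) = \<epsilon> / 2" using A by simp
  also have "ennreal c0 + ennreal (\<epsilon> / 2) = ennreal (c0 + \<epsilon> / 2)" using c0 \<epsilon> by (simp add: ennreal_plus)
  finally show ?thesis by (simp only: c0_def A_def)
qed

end

section \<open>Oracle complexity\<close>

lemma rpd_iters_le:
  defines "a m L \<mu> \<equiv> real m + sqrt (8 * real m * (L / \<mu>))"
  assumes "0 \<le> a m L \<mu>" "\<bar>ln (2 * (L / sqrt \<mu> + sqrt \<mu>)\<^sup>2 * a m L \<mu> * D / e)\<bar> \<le> lb"
  shows "real (rpd_iters m L \<mu> D e) \<le> 2 * a m L \<mu> * lb + 1"
proof -
  define y where "y = 2 * a m L \<mu> * ln (2 * (L / sqrt \<mu> + sqrt \<mu>)\<^sup>2 * a m L \<mu> * D / e)"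
  have lb: "0 \<le> lb" using assms(3) by (rule order_trans[OF abs_ge_zero])
  have "y \<le> 2 * a m L \<mu> * lb"
    unfolding y_def using assms(2,3) by (intro mult_left_mono) auto
  then have "real (nat \<lceil>y\<rceil>) \<le> 2 * a m L \<mu> * lb + 1"
    using assms(2) lb by (cases "0 \<le> \<lceil>y\<rceil>") (auto simp: of_nat_nat intro: order_trans[OF _ add_right_mono], linarith)
  moreover have "1 \<le> 2 * a m L \<mu> * lb + 1" using assms(2) lb by simp
  ultimately have "real (max 1 (nat \<lceil>y\<rceil>)) \<le> 2 * a m L \<mu> * lb + 1" by (simp add: max_def)
  then show ?thesis by (simp add: rpd_iters_def Let_def y_def a_def)
qed

lemma abs_ln_mult_le: "\<bar>ln (x * y)\<bar> \<le> \<bar>ln x\<bar> + \<bar>ln (y :: real)\<bar>"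
  by (simp add: ln_mult abs_triangle_ineq)

text \<open>Once \<open>\<epsilon>\<close> is small compared with \<open>Z\<close>, the logarithm of the claimed bounds is comparable with \<open>- ln \<epsilon>\<close>.\<close>

lemma half_log_le:
  fixes Z \<epsilon> :: real
  assumes "0 < Z" "0 < \<epsilon>" "2 * \<bar>ln Z\<bar> \<le> - ln \<epsilon>"
  shows "- ln \<epsilon> \<le> 2 * ln (Z / \<epsilon>)"
  using assms by (simp add: ln_divide_pos)

context saddle_problem
begin

text \<open>The product inside the logarithm of the iteration count is split into a factor that does not depend on
  \<open>\<epsilon>\<close> and the factors \<open>k + 3\<close> and \<open>1/\<epsilon>\<close>, each of which contributes at most \<open>- ln \<epsilon>\<close>. The total is at most
  \<open>3 * - ln \<epsilon>\<close>.\<close>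

lemma primal_iters_le:
  fixes \<epsilon> :: real and k :: nat and xs :: 'a
  defines "a \<equiv> real (nn P) + sqrt (8 * real (nn P) * kappa_X P)"
    and "Z \<equiv> kappa_X P * L_D P * (real (nn P) + sqrt (real (nn P) * kappa_X P))"
  defines "T \<equiv> 8 * ((L_f P + L_xx P) / sqrt (mu P) + sqrt (mu P))\<^sup>2 * a * bregman_radius (XX P) (om_bar P) xs"
  assumes \<epsilon>: "0 < \<epsilon>" and k: "real k + 3 \<le> 1 / \<epsilon>" and t: "1 + \<bar>ln T\<bar> + 2 * \<bar>ln Z\<bar> \<le> - ln \<epsilon>"
  shows "real (primal_iters P xs (acc \<epsilon> k)) \<le> 14 * a * ln (Z / \<epsilon>)"
proof -
  define D where "D = bregman_radius (XX P) (om_bar P) xs"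
  define L where "L = L_f P + L_xx P"
  have \<kappa>: "kappa_X P = L / mu P" by (simp add: kappa_X_def L_def)
  have "0 < L" using const_facts by (simp add: L_def)
  then have \<kappa>0: "0 < kappa_X P" using const_facts(2) by (simp add: \<kappa>)
  have n: "1 \<le> real (nn P)" using const_facts(3) by simp
  have a1: "1 \<le> a" unfolding a_def using n \<kappa>0 by (intro order_trans[OF n]) simp
  have aeq: "a = real (nn P) + sqrt (8 * real (nn P) * (L / mu P))" by (simp add: a_def \<kappa>)
  have Z: "0 < Z" unfolding Z_def using \<kappa>0 L_D_pos n by (intro mult_pos_pos add_pos_nonneg) auto
  have lnk: "ln (real k + 3) \<le> - ln \<epsilon>"
    using ln_mono[OF k] \<epsilon> by (simp add: ln_div)
  have "2 * (L / sqrt (mu P) + sqrt (mu P))\<^sup>2 * a * D / acc \<epsilon> k = T * ((real k + 3) * inverse \<epsilon>)"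
    using \<epsilon> by (simp add: T_def acc_def L_def D_def field_simps)
  then have "\<bar>ln (2 * (L / sqrt (mu P) + sqrt (mu P))\<^sup>2 * a * D / acc \<epsilon> k)\<bar>
      \<le> \<bar>ln T\<bar> + (\<bar>ln (real k + 3)\<bar> + \<bar>ln (inverse \<epsilon>)\<bar>)"
    using abs_ln_mult_le[of T "(real k + 3) * inverse \<epsilon>"] abs_ln_mult_le[of "real k + 3" "inverse \<epsilon>"] by simp
  also have "\<dots> \<le> 3 * - ln \<epsilon>" using lnk t by (simp add: ln_inverse)
  finally have "real (primal_iters P xs (acc \<epsilon> k)) \<le> 2 * a * (3 * - ln \<epsilon>) + 1"
    unfolding primal_iters_def L_def[symmetric] D_def[symmetric] aeq
    using a1 by (intro rpd_iters_le) (simp_all add: aeq)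
  also have "1 \<le> a * - ln \<epsilon>" using mult_mono[OF a1, of 1 "- ln \<epsilon>"] t a1 by simp
  finally have "real (primal_iters P xs (acc \<epsilon> k)) \<le> 7 * a * - ln \<epsilon>" by simp
  also have "\<dots> \<le> 7 * a * (2 * ln (Z / \<epsilon>))"
    using half_log_le[OF Z \<epsilon>] t a1 by (intro mult_left_mono) auto
  finally show ?thesis by simp
qed

text \<open>As in the primal case, but the smoothing parameter \<open>rho P j\<close> enters both the condition number and the
  logarithm. It decreases like \<open>1/j\<^sup>2\<close>, so its logarithm adds multiples of \<open>ln (j + 2)\<close>, and the square root
  of the condition number grows linearly in \<open>j\<close>. The index \<open>j\<close> is \<open>k\<close> or \<open>k + 1\<close> for the two dual solutions
  of iteration \<open>k\<close>.\<close>

lemma dual_iters_le: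
  fixes \<epsilon> :: real and k j :: nat and ls :: 'b
  defines "q \<equiv> sqrt (real (nn P) * L_ll P / L_D P)"
  defines "Z \<equiv> L_ll P * (real (nn P) + q)"
    and "D \<equiv> bregman_radius (LL P) (om P) ls"
  assumes \<epsilon>: "0 < \<epsilon>" and k: "real k + 3 \<le> 1 / \<epsilon>" and L0: "0 < L_ll P" and j: "j \<le> Suc k"
    and t: "1 + \<bar>ln (8 * D)\<bar> + 2 * (\<bar>ln (L_ll P)\<bar> + \<bar>ln (L_ll P + 8 * L_D P)\<bar>) + \<bar>ln (16 * L_D P)\<bar>
       + \<bar>ln (real (nn P) + q)\<bar> + 2 * \<bar>ln Z\<bar> \<le> - ln \<epsilon>"
  shows "real (dual_iters P ls (rho P j) (acc \<epsilon> k)) \<le> 28 * (real (nn P) + (real k + 3) * q) * ln (Z / \<epsilon>)"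
proof -
  define r where "r = rho P j"
  define a where "a = real (nn P) + sqrt (8 * real (nn P) * (L_ll P / r))"
  define J where "J = (real j + 1) * (real j + 2)"
  have n: "1 \<le> real (nn P)" using const_facts(3) by simp
  have tle: "1 \<le> - ln \<epsilon>" by (rule order_trans[OF _ t]) simp
  have scale: "14 * (x * (2 * y)) = 28 * x * y" for x y :: real by simp
  have J1: "2 \<le> J" unfolding J_def using mult_mono[of 1 "real j + 1" 2 "real j + 2"] by simp
  have J2: "J \<le> (real j + 2)\<^sup>2" unfolding J_def power2_eq_square by (intro mult_right_mono) auto
  have j2: "real j + 2 \<le> real k + 3" using j by simp
  have r: "r = 16 * L_D P / J" "0 < r" using L_D_pos J1 by (simp_all add: r_def J_def rho_eq)
  have r8: "r \<le> 8 * L_D P" using L_D_pos J1 by (simp add: r(1) field_simps)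
  have q0: "0 \<le> q" using L0 L_D_pos by (simp add: q_def)
  have "sqrt (8 * real (nn P) * (L_ll P / r)) = sqrt (J / 2 * (real (nn P) * L_ll P / L_D P))"
    using L_D_pos J1 by (simp add: r(1) field_simps)
  also have "\<dots> \<le> sqrt ((real j + 2)\<^sup>2 * (real (nn P) * L_ll P / L_D P))"
    using J1 J2 L0 L_D_pos by (intro real_sqrt_le_mono mult_right_mono) auto
  also have "\<dots> = (real j + 2) * q" by (subst real_sqrt_mult) (simp add: q_def)
  finally have aj: "a \<le> real (nn P) + (real j + 2) * q" by (simp add: a_def)
  have a1: "1 \<le> a" unfolding a_def using n L0 r(2) by (intro order_trans[OF n]) simp
  have ak: "a \<le> real (nn P) + (real k + 3) * q"
    using aj mult_right_mono[OF j2 q0] by linarith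
  have "real (nn P) + (real j + 2) * q \<le> (real j + 2) * (real (nn P) + q)"
    using n by (simp add: distrib_left)
  then have "a \<le> (real j + 2) * (real (nn P) + q)" using aj by linarith
  then have "ln a \<le> ln ((real j + 2) * (real (nn P) + q))" using a1 by (intro ln_mono) auto
  also have "\<dots> \<le> ln (real j + 2) + \<bar>ln (real (nn P) + q)\<bar>" using n q0 by (simp add: ln_mult)
  finally have lna: "\<bar>ln a\<bar> \<le> ln (real j + 2) + \<bar>ln (real (nn P) + q)\<bar>" using a1 by simp
  have lnk: "ln (real k + 3) \<le> - ln \<epsilon>"
    using ln_mono[OF k] \<epsilon> by (simp add: ln_div)
  have lnj: "ln (real j + 2) \<le> - ln \<epsilon>" by (rule order_trans[OF ln_mono[OF j2] lnk]) simp
  have lnJ: "\<bar>ln J\<bar> \<le> 2 * ln (real j + 2)"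
    using ln_mono[OF J2] J1 by (simp add: ln_realpow)
  have lnr: "\<bar>ln r\<bar> \<le> \<bar>ln (16 * L_D P)\<bar> + 2 * ln (real j + 2)"
    using abs_ln_mult_le[of "16 * L_D P" "inverse J"] lnJ by (simp add: r(1) divide_inverse ln_inverse)
  have lnLr: "\<bar>ln (L_ll P + r)\<bar> \<le> \<bar>ln (L_ll P)\<bar> + \<bar>ln (L_ll P + 8 * L_D P)\<bar>"
  proof -
    have "ln (L_ll P) \<le> ln (L_ll P + r)" "ln (L_ll P + r) \<le> ln (L_ll P + 8 * L_D P)"
      using L0 r(2) r8 by (auto intro!: ln_mono)
    then show ?thesis by linarith
  qed
  have "(L_ll P / sqrt r + sqrt r)\<^sup>2 = (L_ll P + r)\<^sup>2 * inverse r"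
  proof -
    have "L_ll P / sqrt r + sqrt r = (L_ll P + r) / sqrt r"
      using r(2) by (simp add: add_divide_distrib real_div_sqrt)
    then have "(L_ll P / sqrt r + sqrt r)\<^sup>2 = ((L_ll P + r) / sqrt r)\<^sup>2" by (simp only:)
    also have "\<dots> = (L_ll P + r)\<^sup>2 / r" using r(2) by (simp add: power_divide)
    finally show ?thesis by (simp only: divide_inverse)
  qed
  then have "\<bar>ln ((L_ll P / sqrt r + sqrt r)\<^sup>2)\<bar> \<le> 2 * \<bar>ln (L_ll P + r)\<bar> + \<bar>ln r\<bar>"
    using abs_ln_mult_le[of "(L_ll P + r)\<^sup>2" "inverse r"] by (simp add: ln_realpow ln_inverse abs_mult)
  also have "\<dots> \<le> 2 * (\<bar>ln (L_ll P)\<bar> + \<bar>ln (L_ll P + 8 * L_D P)\<bar>) + (\<bar>ln (16 * L_D P)\<bar> + 2 * ln (real j + 2))"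
    by (intro add_mono mult_left_mono lnLr lnr) simp
  finally have sq: "\<bar>ln ((L_ll P / sqrt r + sqrt r)\<^sup>2)\<bar>
      \<le> 2 * (\<bar>ln (L_ll P)\<bar> + \<bar>ln (L_ll P + 8 * L_D P)\<bar>) + \<bar>ln (16 * L_D P)\<bar> + 2 * ln (real j + 2)"
    by (simp only: add.assoc)
  have "2 * (L_ll P / sqrt r + sqrt r)\<^sup>2 * a * D / acc \<epsilon> k
     = (L_ll P / sqrt r + sqrt r)\<^sup>2 * (a * ((8 * D) * ((real k + 3) * inverse \<epsilon>)))" (is "_ = ?u * (a * (?v * (?x * ?y)))")
    using \<epsilon> by (simp add: acc_def field_simps)
  then have "\<bar>ln (2 * (L_ll P / sqrt r + sqrt r)\<^sup>2 * a * D / acc \<epsilon> k)\<bar>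
      \<le> \<bar>ln ?u\<bar> + (\<bar>ln a\<bar> + (\<bar>ln ?v\<bar> + (\<bar>ln ?x\<bar> + \<bar>ln ?y\<bar>)))"
    using abs_ln_mult_le[of ?u "a * (?v * (?x * ?y))"] abs_ln_mult_le[of a "?v * (?x * ?y)"]
      abs_ln_mult_le[of ?v "?x * ?y"] abs_ln_mult_le[of ?x ?y] by simp
  also have "\<dots> \<le> 6 * - ln \<epsilon>"
  proof -
    have x: "\<bar>ln ?x\<bar> = ln ?x" by simp
    then have "ln \<epsilon> \<le> 0" using lnk by linarith
    then have y: "\<bar>ln ?y\<bar> = - ln \<epsilon>" by (simp add: ln_inverse)
    have "u + (la + (v + (lx + e))) \<le> 6 * e"
      if "u \<le> 2 * (p + p') + p'' + 2 * lj" "la \<le> lj + m" "lx \<le> e" "lj \<le> e"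
        "1 + v + 2 * (p + p') + p'' + m + 2 * z \<le> e" "0 \<le> z" for u la v lx e p p' p'' lj m z :: real
      using that by linarith
    from this[OF sq lna lnk lnj t] show ?thesis unfolding x y by simp
  qed
  finally have "real (dual_iters P ls r (acc \<epsilon> k)) \<le> 2 * a * (6 * - ln \<epsilon>) + 1"
    unfolding dual_iters_def D_def[symmetric] a_def
    using a1 by (intro rpd_iters_le) (simp_all add: a_def)
  also have "1 \<le> a * - ln \<epsilon>" using mult_mono[OF a1, of 1 "- ln \<epsilon>"] t a1 by simp
  finally have "real (dual_iters P ls r (acc \<epsilon> k)) \<le> 14 * (a * - ln \<epsilon>)" by simp
  also have "\<dots> \<le> 14 * ((real (nn P) + (real k + 3) * q) * (2 * ln (Z / \<epsilon>)))"
  proof (intro mult_left_mono mult_mono)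
    have "0 < Z" unfolding Z_def using L0 n q0 by (intro mult_pos_pos add_pos_nonneg) auto
    then show "- ln \<epsilon> \<le> 2 * ln (Z / \<epsilon>)" using \<epsilon> t by (intro half_log_le) auto
  qed (use ak a1 tle n q0 in auto)
  also have "\<dots> = 28 * (real (nn P) + (real k + 3) * q) * ln (Z / \<epsilon>)"
    using scale[of "real (nn P) + (real k + 3) * q" "ln (Z / \<epsilon>)"] .
  finally show ?thesis unfolding r_def .
qed

lemma primal_calls_le:
  fixes \<epsilon> :: real and xs :: 'a and rpdX :: "'a composite \<Rightarrow> nat \<Rightarrow> 'a measure"
  defines "a \<equiv> real (nn P) + sqrt (8 * real (nn P) * kappa_X P)"
    and "Z \<equiv> kappa_X P * L_D P * (real (nn P) + sqrt (real (nn P) * kappa_X P))"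
  defines "T \<equiv> 8 * ((L_f P + L_xx P) / sqrt (mu P) + sqrt (mu P))\<^sup>2 * a * bregman_radius (XX P) (om_bar P) xs"
  assumes gX: "rpd_guarantee rpdX calls c" and xs: "xs \<in> XX P \<inter> interior (edom (om_bar P))"
    and \<epsilon>: "0 < \<epsilon>" and K: "real K + 2 \<le> 1 / \<epsilon>" and t: "1 + \<bar>ln T\<bar> + 2 * \<bar>ln Z\<bar> \<le> - ln \<epsilon>"
  shows "real (primal_calls P calls xs \<epsilon> K) \<le> 28 * \<bar>c\<bar> * real K * (a * ln (Z / \<epsilon>))"
proof -
  have each: "real (2 * calls (nn P) (primal_iters P xs (acc \<epsilon> k))) \<le> 2 * (\<bar>c\<bar> * (14 * a * ln (Z / \<epsilon>)))" if "k < K" for k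
  proof -
    obtain l where l: "l \<in> LL P" using L_facts(1) by blast
    have acc: "0 < acc \<epsilon> k" using \<epsilon> by (simp add: acc_def)
    have "real k + 3 \<le> 1 / \<epsilon>" using that K by linarith
    note N = primal_iters_le[OF \<epsilon> this, of xs, folded a_def Z_def, folded T_def, OF t]
    have "real (calls (nn P) (primal_iters P xs (acc \<epsilon> k))) \<le> c * real (primal_iters P xs (acc \<epsilon> k))"
      by (rule rpd_primal_step(3)[OF gX l acc xs])
    also have "\<dots> \<le> \<bar>c\<bar> * real (primal_iters P xs (acc \<epsilon> k))" by (intro mult_right_mono) auto
    also have "\<dots> \<le> \<bar>c\<bar> * (14 * a * ln (Z / \<epsilon>))" by (intro mult_left_mono N) auto
    finally have "2 * real (calls (nn P) (primal_iters P xs (acc \<epsilon> k))) \<le> 2 * (\<bar>c\<bar> * (14 * a * ln (Z / \<epsilon>)))"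
      by (rule mult_left_mono) simp
    then show ?thesis by (simp only: of_nat_mult of_nat_numeral)
  qed
  have "real (primal_calls P calls xs \<epsilon> K) = (\<Sum>k<K. real (2 * calls (nn P) (primal_iters P xs (acc \<epsilon> k))))"
    by (simp add: primal_calls_def)
  also have "\<dots> \<le> (\<Sum>k<K. 2 * (\<bar>c\<bar> * (14 * a * ln (Z / \<epsilon>))))"
    by (intro sum_mono each) simp
  finally show ?thesis by (simp add: algebra_simps)
qed

lemma dual_calls_le:
  fixes \<epsilon> :: real and ls :: 'b and rpdL :: "'b composite \<Rightarrow> nat \<Rightarrow> 'b measure"
  defines "q \<equiv> sqrt (real (nn P) * L_ll P / L_D P)"
  defines "Z \<equiv> L_ll P * (real (nn P) + q)"
    and "D \<equiv> bregman_radius (LL P) (om P) ls"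
  assumes gL: "rpd_guarantee rpdL calls c" and ls: "ls \<in> LL P \<inter> interior (edom (om P))"
    and \<epsilon>: "0 < \<epsilon>" and K: "real K + 2 \<le> 1 / \<epsilon>" and L0: "0 < L_ll P"
    and t: "1 + \<bar>ln (8 * D)\<bar> + 2 * (\<bar>ln (L_ll P)\<bar> + \<bar>ln (L_ll P + 8 * L_D P)\<bar>) + \<bar>ln (16 * L_D P)\<bar>
       + \<bar>ln (real (nn P) + q)\<bar> + 2 * \<bar>ln Z\<bar> \<le> - ln \<epsilon>"
  shows "real (dual_calls P calls ls \<epsilon> K) \<le> 56 * \<bar>c\<bar> * real K * ((real (nn P) + (real K + 2) * q) * ln (Z / \<epsilon>))"
proof -
  have q0: "0 \<le> q" using L0 L_D_pos by (simp add: q_def)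
  have n: "1 \<le> real (nn P)" using const_facts(3) by simp
  have Z: "0 < Z" unfolding Z_def using L0 n q0 by (intro mult_pos_pos add_pos_nonneg) auto
  have "- ln \<epsilon> \<le> 2 * ln (Z / \<epsilon>)" using half_log_le[OF Z \<epsilon>] t by simp
  then have ln0: "0 \<le> ln (Z / \<epsilon>)" using t by simp
  have each: "real (calls (nn P) (dual_iters P ls (rho P j) (acc \<epsilon> k)))
      \<le> \<bar>c\<bar> * (28 * (real (nn P) + (real K + 2) * q) * ln (Z / \<epsilon>))" if k: "k < K" and j: "j \<le> Suc k" for k j
  proof -
    obtain x where x: "x \<in> XX P" using X_facts(1) by blast
    have acc: "0 < acc \<epsilon> k" using \<epsilon> by (simp add: acc_def)
    have kK: "real k + 3 \<le> real K + 2" using k by simp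
    then have "real k + 3 \<le> 1 / \<epsilon>" using K by linarith
    from dual_iters_le[OF \<epsilon> this L0 j, of ls, folded q_def, folded Z_def D_def, OF t]
    have "real (dual_iters P ls (rho P j) (acc \<epsilon> k)) \<le> 28 * (real (nn P) + (real k + 3) * q) * ln (Z / \<epsilon>)" .
    also have "\<dots> \<le> 28 * (real (nn P) + (real K + 2) * q) * ln (Z / \<epsilon>)"
      using kK q0 ln0 by (intro mult_right_mono mult_left_mono add_left_mono) auto
    finally have N: "real (dual_iters P ls (rho P j) (acc \<epsilon> k)) \<le> 28 * (real (nn P) + (real K + 2) * q) * ln (Z / \<epsilon>)" .
    have "real (calls (nn P) (dual_iters P ls (rho P j) (acc \<epsilon> k))) \<le> c * real (dual_iters P ls (rho P j) (acc \<epsilon> k))"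
      by (rule rpd_dual_step(3)[OF gL x rho_pos acc ls])
    also have "\<dots> \<le> \<bar>c\<bar> * real (dual_iters P ls (rho P j) (acc \<epsilon> k))" by (intro mult_right_mono) auto
    also have "\<dots> \<le> \<bar>c\<bar> * (28 * (real (nn P) + (real K + 2) * q) * ln (Z / \<epsilon>))" by (intro mult_left_mono N) auto
    finally show ?thesis .
  qed
  have "real (dual_calls P calls ls \<epsilon> K) = (\<Sum>k<K. real (calls (nn P) (dual_iters P ls (rho P k) (acc \<epsilon> k)))
      + real (calls (nn P) (dual_iters P ls (rho P (Suc k)) (acc \<epsilon> k))))"
    by (simp only: dual_calls_def of_nat_sum of_nat_add)
  also have "\<dots> \<le> (\<Sum>k<K. \<bar>c\<bar> * (28 * (real (nn P) + (real K + 2) * q) * ln (Z / \<epsilon>))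
      + \<bar>c\<bar> * (28 * (real (nn P) + (real K + 2) * q) * ln (Z / \<epsilon>)))"
    by (intro sum_mono add_mono each) auto
  finally show ?thesis by (simp add: algebra_simps)
qed

text \<open>The number \<open>K\<close> of iterations is chosen so that division by \<open>K\<^sup>2\<close> brings the contribution of the initial gap
  and of the smoothing below \<open>\<epsilon>/2\<close>; it is at most \<open>k0 * sqrt (L_D / \<epsilon>)\<close> when \<open>\<epsilon> < L_D\<close>. In the dual count the number of iterations enters twice, once through
  the sum and once through the condition numbers, whence the product \<open>k0 * (k0 + 2)\<close>.\<close>

lemma oracle_complexity:
  fixes c :: real and rpdX :: "'a composite \<Rightarrow> nat \<Rightarrow> 'a measure" and rpdL :: "'b composite \<Rightarrow> nat \<Rightarrow> 'b measure" and x0 :: 'a and l0 :: 'b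
  defines "k0 \<equiv> \<lambda>B R. sqrt \<bar>4 * R + 64 * B\<bar> + 1"
  defines "A \<equiv> \<lambda>B R. 100 * \<bar>c\<bar> * (k0 B R * (k0 B R + 2))"
    and "R \<equiv> real_of_ereal (gap P x0 l0) / L_D P" and "n \<equiv> real (nn P)"
  assumes gX: "rpd_guarantee rpdX calls c" and gL: "rpd_guarantee rpdL calls c"
    and xs: "xs \<in> XX P \<inter> interior (edom (om_bar P))" and ls: "ls \<in> LL P \<inter> interior (edom (om P))"
    and x0: "x0 \<in> XX P" and l0: "l0 \<in> LL P"
  shows "\<exists>\<epsilon>0>0. \<forall>\<epsilon>. 0 < \<epsilon> \<and> \<epsilon> < \<epsilon>0 \<longrightarrow> (\<exists>K.
      real (primal_calls P calls xs \<epsilon> K) \<le>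
            A (B_om P) R * ((n + sqrt (n * kappa_X P)) * sqrt (L_D P / \<epsilon>) *
                 ln (kappa_X P * L_D P * (n + sqrt (n * kappa_X P)) / \<epsilon>)) \<and>
      (L_ll P > 0 \<longrightarrow>
            real (dual_calls P calls ls \<epsilon> K) \<le>
              A (B_om P) R * ((n * sqrt (L_D P / \<epsilon>) + sqrt (n * L_ll P * L_D P) / \<epsilon>) *
                   ln (L_ll P * (n + sqrt (n * L_ll P / L_D P)) / \<epsilon>))) \<and>
      (\<forall>(M :: 'w measure) lt xt lt'. ipds_run P rpdX rpdL xs ls x0 l0 \<epsilon> M lt xt lt' \<longrightarrow>
          ipds_accuracy P x0 l0 \<epsilon> M lt xt lt' \<and>
          expected_gap P x0 l0 M xt lt' K \<le> ennreal \<epsilon>))"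
    (is "\<exists>\<epsilon>0>0. \<forall>\<epsilon>. _ \<longrightarrow> (\<exists>K. ?P \<epsilon> K)")
proof -
  define a where "a = n + sqrt (8 * n * kappa_X P)"
  define q where "q = sqrt (n * L_ll P / L_D P)"
  define Z1 where "Z1 = kappa_X P * L_D P * (n + sqrt (n * kappa_X P))"
  define Z2 where "Z2 = L_ll P * (n + q)"
  define T where "T = 8 * ((L_f P + L_xx P) / sqrt (mu P) + sqrt (mu P))\<^sup>2 * a * bregman_radius (XX P) (om_bar P) xs"
  define W1 where "W1 = 1 + \<bar>ln T\<bar> + 2 * \<bar>ln Z1\<bar>"
  define W2 where "W2 = 1 + \<bar>ln (8 * bregman_radius (LL P) (om P) ls)\<bar>
      + 2 * (\<bar>ln (L_ll P)\<bar> + \<bar>ln (L_ll P + 8 * L_D P)\<bar>) + \<bar>ln (16 * L_D P)\<bar>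
       + \<bar>ln (n + q)\<bar> + 2 * \<bar>ln Z2\<bar>"
  define \<beta> where "\<beta> = 4 * R + 64 * B_om P"
  define \<kappa> where "\<kappa> = k0 (B_om P) R"
  \<comment> \<open>the bounds give, in this order: \<open>sqrt (L_D / \<epsilon>) \<ge> 1\<close>, which absorbs the rounding of \<open>K\<close>; \<open>K + 2 \<le> 1/\<epsilon>\<close>; and domination of the constants inside the logarithms\<close>
  define \<epsilon>0 where "\<epsilon>0 = min (L_D P) (min (1 / ((\<kappa> + 2)\<^sup>2 * L_D P)) (exp (- (W1 + W2))))"
  have R: "R = (pval 0 x0 - dval l0) / L_D P" by (simp add: R_def gap_eq[OF x0 l0])
  have R0: "0 \<le> R" using dval_le_pval[OF x0 l0] L_D_pos by (simp add: R)
  have \<beta>0: "0 \<le> \<beta>" using R0 B_om_bounds(2) by (simp add: \<beta>_def)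
  have \<kappa>: "\<kappa> = sqrt \<beta> + 1" using \<beta>0 by (simp add: \<kappa>_def k0_def \<beta>_def)
  have \<kappa>1: "1 \<le> \<kappa>" using \<beta>0 by (simp add: \<kappa>)
  have W: "0 \<le> W1" "0 \<le> W2" by (simp_all add: W1_def W2_def)
  have n: "1 \<le> n" using const_facts(3) by (simp add: n_def)
  have kX: "0 < kappa_X P" unfolding kappa_X_def using const_facts by (intro divide_pos_pos) linarith+
  have pos: "0 < \<epsilon>0" using L_D_pos \<kappa>1 by (simp add: \<epsilon>0_def)
  have main: "\<exists>K. ?P \<epsilon> K"
    if \<epsilon>: "0 < \<epsilon>" "\<epsilon> < \<epsilon>0" for \<epsilon>
  proof -
    define r where "r = sqrt (L_D P / \<epsilon>)"
    define K where "K = nat \<lceil>sqrt \<beta> * r\<rceil>"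
    have \<epsilon>D: "\<epsilon> < L_D P" "\<epsilon> < 1 / ((\<kappa> + 2)\<^sup>2 * L_D P)" "\<epsilon> < exp (- (W1 + W2))"
      using \<epsilon>(2) by (simp_all add: \<epsilon>0_def)
    have r1: "1 \<le> r" using \<epsilon>D(1) \<epsilon>(1) by (simp add: r_def)
    have r2: "r\<^sup>2 = L_D P / \<epsilon>" using L_D_pos \<epsilon>(1) by (simp add: r_def)
    have br: "0 \<le> sqrt \<beta> * r" using \<beta>0 r1 by simp
    have K_ge: "sqrt \<beta> * r \<le> real K" unfolding K_def by linarith
    have "real K \<le> sqrt \<beta> * r + 1" unfolding K_def using br by linarith
    also have "\<dots> \<le> \<kappa> * r" using r1 by (simp add: \<kappa> distrib_right)
    finally have K_le: "real K \<le> \<kappa> * r" .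
    have K2_le: "real K + 2 \<le> (\<kappa> + 2) * r" using K_le r1 by (simp add: distrib_right)
    have "(\<kappa> + 2) * r \<le> 1 / \<epsilon>"
    proof (rule power2_le_imp_le)
      have "\<epsilon> * ((\<kappa> + 2)\<^sup>2 * L_D P) \<le> 1"
        using \<epsilon>D(2) L_D_pos \<kappa>1 by (simp add: pos_less_divide_eq less_imp_le)
      then have "(\<kappa> + 2)\<^sup>2 * (L_D P / \<epsilon>) \<le> 1 / \<epsilon> / \<epsilon>"
        using \<epsilon>(1) by (simp add: field_simps)
      then show "((\<kappa> + 2) * r)\<^sup>2 \<le> (1 / \<epsilon>)\<^sup>2"
        unfolding power_mult_distrib r2 power_divide by (simp add: power2_eq_square)
    qed (use \<epsilon>(1) in simp)
    then have K_small: "real K + 2 \<le> 1 / \<epsilon>" using K2_le by linarith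
    have "ln \<epsilon> \<le> - (W1 + W2)" using ln_mono[OF less_imp_le[OF \<epsilon>D(3)] \<epsilon>(1)] by simp
    then have t1: "W1 \<le> - ln \<epsilon>" and t2: "W2 \<le> - ln \<epsilon>" using W by simp_all
    have primal: "real (primal_calls P calls xs \<epsilon> K) \<le> A (B_om P) R * ((n + sqrt (n * kappa_X P)) * r * ln (Z1 / \<epsilon>))"
    proof -
      have "0 < Z1" unfolding Z1_def using kX L_D_pos n by (intro mult_pos_pos add_pos_nonneg) auto
      from half_log_le[OF this \<epsilon>(1)] have ln0: "0 \<le> ln (Z1 / \<epsilon>)" using t1 unfolding W1_def by linarith
      have "sqrt (8 * n * kappa_X P) \<le> 3 * sqrt (n * kappa_X P)"
      proof -
        have "sqrt (8 * n * kappa_X P) = sqrt 8 * sqrt (n * kappa_X P)" by (simp add: real_sqrt_mult)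
        moreover have "sqrt 8 \<le> 3" by (rule real_le_lsqrt) auto
        ultimately show ?thesis using kX n by (simp add: mult_right_mono)
      qed
      then have a: "a \<le> 3 * (n + sqrt (n * kappa_X P))" using n by (simp add: a_def)
      have "real (primal_calls P calls xs \<epsilon> K) \<le> 28 * \<bar>c\<bar> * real K * (a * ln (Z1 / \<epsilon>))"
        by (rule primal_calls_le[OF gX xs \<epsilon>(1) K_small, folded n_def, folded a_def Z1_def, folded T_def, folded W1_def, OF t1])
      also have "\<dots> \<le> 28 * \<bar>c\<bar> * (\<kappa> * r) * ((3 * (n + sqrt (n * kappa_X P))) * ln (Z1 / \<epsilon>))"
        using K_le a ln0 \<kappa>1 r1 n kX by (intro mult_mono mult_nonneg_nonneg) (auto simp: a_def)
      also have "\<dots> = (84 * \<bar>c\<bar> * \<kappa>) * ((n + sqrt (n * kappa_X P)) * r * ln (Z1 / \<epsilon>))" by simp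
      also have "\<dots> \<le> A (B_om P) R * ((n + sqrt (n * kappa_X P)) * r * ln (Z1 / \<epsilon>))"
      proof (rule mult_right_mono)
        have "84 * \<bar>c\<bar> * (\<kappa> * 1) \<le> 100 * \<bar>c\<bar> * (\<kappa> * (\<kappa> + 2))"
          using \<kappa>1 by (intro mult_mono mult_nonneg_nonneg) auto
        then show "84 * \<bar>c\<bar> * \<kappa> \<le> A (B_om P) R" by (simp add: A_def \<kappa>_def)
      qed (use ln0 r1 n kX in simp)
      finally show ?thesis .
    qed
    have dual: "real (dual_calls P calls ls \<epsilon> K) \<le> A (B_om P) R * ((n * r + sqrt (n * L_ll P * L_D P) / \<epsilon>) * ln (Z2 / \<epsilon>))"
      if L0: "0 < L_ll P"
    proof -
      have q0: "0 \<le> q" using L0 L_D_pos n by (simp add: q_def)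
      have "0 < Z2" unfolding Z2_def using L0 n q0 by (intro mult_pos_pos add_pos_nonneg) auto
      moreover have "2 * \<bar>ln Z2\<bar> \<le> - ln \<epsilon>" by (rule order_trans[OF _ t2]) (simp add: W2_def)
      ultimately have "- ln \<epsilon> \<le> 2 * ln (Z2 / \<epsilon>)" using \<epsilon>(1) by (intro half_log_le)
      then have ln0: "0 \<le> ln (Z2 / \<epsilon>)" using order_trans[OF W(2) t2] by linarith
      have "r\<^sup>2 * q = sqrt (n * L_ll P * L_D P) / \<epsilon>"
      proof -
        have "L_D P * q = sqrt ((L_D P)\<^sup>2 * (n * L_ll P / L_D P))"
          using L_D_pos by (simp only: q_def real_sqrt_mult) simp
        also have "(L_D P)\<^sup>2 * (n * L_ll P / L_D P) = n * L_ll P * L_D P" using L_D_pos by (simp add: power2_eq_square)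
        finally show ?thesis by (simp add: r2)
      qed
      then have rq: "r * (r * q) = sqrt (n * L_ll P * L_D P) / \<epsilon>" by (simp add: power2_eq_square mult.assoc)
      have "real (dual_calls P calls ls \<epsilon> K) \<le> 56 * \<bar>c\<bar> * real K * ((n + (real K + 2) * q) * ln (Z2 / \<epsilon>))"
        by (rule dual_calls_le[OF gL ls \<epsilon>(1) K_small L0, folded n_def, folded q_def, folded Z2_def, folded W2_def, OF t2])
      also have "\<dots> \<le> 56 * \<bar>c\<bar> * (\<kappa> * r) * (((\<kappa> + 2) * (n + r * q)) * ln (Z2 / \<epsilon>))"
      proof -
        have "(real K + 2) * q \<le> (\<kappa> + 2) * r * q" using K2_le q0 by (rule mult_right_mono)
        moreover have "n \<le> (\<kappa> + 2) * n" using \<kappa>1 n by simp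
        ultimately have "n + (real K + 2) * q \<le> (\<kappa> + 2) * (n + r * q)" by (simp add: distrib_left mult.assoc)
        then show ?thesis
          using K_le ln0 \<kappa>1 r1 n q0 by (intro mult_mono mult_nonneg_nonneg) auto
      qed
      also have "\<dots> = (56 * \<bar>c\<bar> * (\<kappa> * (\<kappa> + 2))) * ((n * r + r * (r * q)) * ln (Z2 / \<epsilon>))"
        by (simp add: algebra_simps)
      also have "\<dots> \<le> A (B_om P) R * ((n * r + r * (r * q)) * ln (Z2 / \<epsilon>))"
      proof (rule mult_right_mono)
        have "56 * \<bar>c\<bar> * (\<kappa> * (\<kappa> + 2)) \<le> 100 * \<bar>c\<bar> * (\<kappa> * (\<kappa> + 2))"
          using \<kappa>1 by (intro mult_right_mono) auto
        then show "56 * \<bar>c\<bar> * (\<kappa> * (\<kappa> + 2)) \<le> A (B_om P) R" by (simp add: A_def \<kappa>_def)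
      qed (use ln0 r1 n q0 in simp)
      finally show ?thesis unfolding rq .
    qed
    have gap: "ipds_accuracy P x0 l0 \<epsilon> M lt xt lt' \<and> expected_gap P x0 l0 M xt lt' K \<le> ennreal \<epsilon>"
      if run: "ipds_run P rpdX rpdL xs ls x0 l0 \<epsilon> M lt xt lt'" for M :: "'w measure" and lt xt lt'
    proof
      show "ipds_accuracy P x0 l0 \<epsilon> M lt xt lt'" by (rule run_errors(1)[OF run gX gL xs ls x0 l0 \<epsilon>(1)])
      let ?N = "2 * (pval 0 x0 - dval l0) + 32 * L_D P * B_om P" and ?A = "(real K + 1) * (real K + 2)"
      have RL: "pval 0 x0 - dval l0 = R * L_D P" using L_D_pos by (simp add: R)
      have "2 * ?N / \<epsilon> = \<beta> * r\<^sup>2"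
        unfolding RL r2 \<beta>_def by (simp add: algebra_simps add_divide_distrib)
      also have "\<dots> = (sqrt \<beta> * r)\<^sup>2" using \<beta>0 by (simp add: power_mult_distrib)
      also have "\<dots> \<le> (real K)\<^sup>2" using K_ge br by (rule power_mono)
      also have "\<dots> \<le> ?A" by (simp add: power2_eq_square algebra_simps)
      finally have "2 * ?N \<le> ?A * \<epsilon>" using \<epsilon>(1) by (simp add: pos_divide_le_eq)
      moreover have "0 < ?A" by simp
      ultimately have "?N / ?A \<le> \<epsilon> / 2" by (simp add: pos_divide_le_eq mult.commute)
      then have "ennreal (?N / ?A + \<epsilon> / 2) \<le> ennreal \<epsilon>" by (intro ennreal_leI) linarith
      with expected_gap_le[OF run gX gL xs ls x0 l0 \<epsilon>(1), of K]
      show "expected_gap P x0 l0 M xt lt' K \<le> ennreal \<epsilon>" by (rule order_trans)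
    qed
    show ?thesis
    proof (intro exI[of _ K] conjI impI allI)
      show "real (primal_calls P calls xs \<epsilon> K) \<le>
            A (B_om P) R * ((n + sqrt (n * kappa_X P)) * sqrt (L_D P / \<epsilon>) *
                 ln (kappa_X P * L_D P * (n + sqrt (n * kappa_X P)) / \<epsilon>))"
        using primal unfolding Z1_def r_def .
      show "real (dual_calls P calls ls \<epsilon> K) \<le>
              A (B_om P) R * ((n * sqrt (L_D P / \<epsilon>) + sqrt (n * L_ll P * L_D P) / \<epsilon>) *
                   ln (L_ll P * (n + sqrt (n * L_ll P / L_D P)) / \<epsilon>))" if "0 < L_ll P"
        using dual[OF that] unfolding Z2_def q_def r_def .
      fix M :: "'w measure" and lt xt lt'
      assume run: "ipds_run P rpdX rpdL xs ls x0 l0 \<epsilon> M lt xt lt'"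
      show "ipds_accuracy P x0 l0 \<epsilon> M lt xt lt'" by (rule gap[OF run, THEN conjunct1])
      show "expected_gap P x0 l0 M xt lt' K \<le> ennreal \<epsilon>" by (rule gap[OF run, THEN conjunct2])
    qed
  qed
  show ?thesis
    by (intro exI[of _ \<epsilon>0] conjI allI impI, rule pos, rule main, erule conjunct1, erule conjunct2)
qed

end

theorem theorem4p3:
  fixes c :: real
  shows "\<exists>C :: real \<Rightarrow> real \<Rightarrow> real.
    \<forall>(P :: ('a::fin_dim_normed, 'b::fin_dim_normed) saddle) rpdX rpdL calls x_start l_start x0 l0.
      saddle_ok P \<and> bounded (LL P) \<and> L_D P > 0 \<and>
      rpd_guarantee rpdX calls c \<and> rpd_guarantee rpdL calls c \<and>
      x_start \<in> XX P \<inter> interior (edom (om_bar P)) \<and> l_start \<in> LL P \<inter> interior (edom (om P)) \<and>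
      x0 \<in> XX P \<and> l0 \<in> LL P
    \<longrightarrow>
      (\<exists>\<epsilon>0>0. \<forall>\<epsilon>. 0 < \<epsilon> \<and> \<epsilon> < \<epsilon>0 \<longrightarrow> (\<exists>K.
        (let A = C (B_om P) (real_of_ereal (gap P x0 l0) / L_D P); n = real (nn P) in
          real (primal_calls P calls x_start \<epsilon> K) \<le>
            A * ((n + sqrt (n * kappa_X P)) * sqrt (L_D P / \<epsilon>) *
                 ln (kappa_X P * L_D P * (n + sqrt (n * kappa_X P)) / \<epsilon>)) \<and>
          (L_ll P > 0 \<longrightarrow>
            real (dual_calls P calls l_start \<epsilon> K) \<le>
              A * ((n * sqrt (L_D P / \<epsilon>) + sqrt (n * L_ll P * L_D P) / \<epsilon>) *
                   ln (L_ll P * (n + sqrt (n * L_ll P / L_D P)) / \<epsilon>)))) \<and>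
        (\<forall>(M :: 'w measure) lt xt lt'. ipds_run P rpdX rpdL x_start l_start x0 l0 \<epsilon> M lt xt lt' \<longrightarrow>
          ipds_accuracy P x0 l0 \<epsilon> M lt xt lt' \<and>
          expected_gap P x0 l0 M xt lt' K \<le> ennreal \<epsilon>)))"
proof (rule exI[where x = "\<lambda>B R. 100 * \<bar>c\<bar> * ((sqrt \<bar>4 * R + 64 * B\<bar> + 1) * (sqrt \<bar>4 * R + 64 * B\<bar> + 1 + 2))"],
    intro allI impI, elim conjE, goal_cases)
  case (1 P rpdX rpdL calls x_start l_start x0 l0)
  interpret saddle_problem P using 1(1-3) by unfold_locales
  show ?case unfolding Let_def conj_assoc by (rule oracle_complexity[OF 1(4-9)])
qed

end
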